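(* Let $P$ be the standard parabolic subgroup of $\mathrm{GL}(n,\mathbb{F}_q)$ of type $(n_1,\dots,n_s)$, let $\mathbb{D}$ be a block-rook placement in $\Delta_J$ and let $\lambda_{\mathbb{D}}\in J^*$ be an element associated with $\mathbb{D}$. Let $\theta$ and $\theta'$ be disjoint $S$-invariant characters of the subgroup $R_{\mathbb{D}}^\circ$. Then the characters $\chi_{\mathbb{D},\theta}$ and $\chi_{\mathbb{D},\theta'}$ of $P$ are disjoint.
   Context: $\mathbb{F}_q$ is a finite field, $n=n_1+\dots+n_s$, and $\{1,\dots,n\}$ is divided into consecutive segments $I_1,\dots,I_s$ of sizes $n_1,\dots,n_s$. The standard parabolic subgroup of type $(n_1,\dots,n_s)$ is the group $P$ of invertible block upper triangular matrices with diagonal blocks of sizes $n_1,\dots,n_s$. $P=RN$, where $R=\mathrm{GL}(n_1,\mathbb{F}_q)\times\dots\times \mathrm{GL}(n_s,\mathbb{F}_q)$ is the block-diagonal subgroup and $N=1+J$, with $J$ the algebra of strictly block upper triangular matrices. Put $\Delta_J=\bigcup_{1\le k<\ell\le s} I_k\times I_\ell$; the matrix units $\{E_\alpha:\alpha\in\Delta_J\}$ form a basis of $J$ with dual basis $\{E_\alpha^*\}$ of $J^*$. A block-rook is a subset $A_k\times A_\ell\subseteq I_k\times I_\ell$ with $k<\ell$, $A_k\subseteq I_k$, $A_\ell\subseteq I_\ell$ and $|A_k|=|A_\ell|$. A subset $\mathbb{D}\subseteq\Delta_J$ is a block-rook placement if it is a union of block-rooks such that each row and each column intersects at most one of the block-rooks.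 An element $\lambda_{\mathbb{D}}\in J^*$ is associated with $\mathbb{D}$ if $\lambda_{\mathbb{D}}=\sum_{(i,j)\in\mathbb{D}}\lambda_{ij}E^*_{ij}$ and for each block-rook $A_k\times A_\ell\subset\mathbb{D}$ of the placement the square matrix $(\lambda_{ij})_{i\in A_k,\,j\in A_\ell}$ is non-degenerate. Put $J_{\mathbb{D},\mathrm{right}}=\{x\in J:\lambda_{\mathbb{D}}(xy)=0\ \forall y\in J\}$, $N_{\mathbb{D},\mathrm{right}}=1+J_{\mathbb{D},\mathrm{right}}$, $R_{\mathbb{D},\mathrm{right}}=\{r\in R:\lambda_{\mathbb{D}}(rx)=\lambda_{\mathbb{D}}(x)\ \forall x\in J\}$, $R_{\mathbb{D},\mathrm{left}}=\{r\in R:\lambda_{\mathbb{D}}(xr)=\lambda_{\mathbb{D}}(x)\ \forall x\in J\}$, $R_{\mathbb{D}}^\circ=R_{\mathbb{D},\mathrm{right}}\cap R_{\mathbb{D},\mathrm{left}}$, and $P_{\mathbb{D}}=R_{\mathbb{D}}^\circ N_{\mathbb{D},\mathrm{right}}$, a subgroup of $P$ each of whose elements is uniquely $g=r+x$ with $r\in R_{\mathbb{D}}^\circ$, $x\in J_{\mathbb{D},\mathrm{right}}$. Fix a nontrivial character $t\mapsto\varepsilon^t$ of the additive group of $\mathbb{F}_q$ with values in $\mathbb{C}^*$. For a character $\theta$ of $R_{\mathbb{D}}^\circ$, the function $\xi_{\mathbb{D},\theta}(r+x)=\theta(r)\varepsilon^{\lambda_{\mathbb{D}}(x)}$ is a character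 of $P_{\mathbb{D}}$, and $\chi_{\mathbb{D},\theta}=\mathrm{Ind}_{P_{\mathbb{D}}}^{P}\xi_{\mathbb{D},\theta}$. $S$ is the subgroup of $P$ consisting of all $g_0\in P$ such that $\mathrm{Ad}_{g_0}(x)=g_0xg_0^{-1}$ preserves $J_{\mathbb{D},\mathrm{right}}$ and stabilizes the restriction of $\lambda_{\mathbb{D}}$ to $J_{\mathbb{D},\mathrm{right}}$ (i.e. $\lambda_{\mathbb{D}}(g_0xg_0^{-1})=\lambda_{\mathbb{D}}(x)$ for $x\in J_{\mathbb{D},\mathrm{right}}$). For $g_0=bt\in S$ with $b\in N$, $t\in R$, conjugation $r\mapsto trt^{-1}$ maps $R_{\mathbb{D}}^\circ$ to itself, and this gives an action of $S$ on $R_{\mathbb{D}}^\circ$; a character $\theta$ of $R_{\mathbb{D}}^\circ$ is $S$-invariant if $\theta(trt^{-1})=\theta(r)$ for all $r\in R_{\mathbb{D}}^\circ$ and all such $g_0=bt\in S$. Two characters are disjoint if they have no common irreducible constituent. *)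

theory Defs
  imports
    "HOL-Library.Disjoint_Sets"
    "Jordan_Normal_Form.VS_Connect"
    "Jordan_Normal_Form.DL_Submatrix"
begin

section \<open>Characters of finite groups\<close>

definition GL :: "'a::field itself \<Rightarrow> nat \<Rightarrow> 'a mat monoid" where
  "GL ty n = units_of (ring_mat ty n ())"

definition trace :: "'a::comm_monoid_add mat \<Rightarrow> 'a" where
  "trace A = (\<Sum>i<dim_row A. A $$ (i, i))"

definition representation :: "('g, 'b) monoid_scheme \<Rightarrow> nat \<Rightarrow> ('g \<Rightarrow> complex mat) \<Rightarrow> bool" where
  "representation G d \<rho> \<longleftrightarrow> 0 < d \<and> \<rho> \<in> hom G (GL TYPE(complex) d)"

definition irreducible_representation ::
  "('g, 'b) monoid_scheme \<Rightarrow> nat \<Rightarrow> ('g \<Rightarrow> complex mat) \<Rightarrow> bool" where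
  "irreducible_representation G d \<rho> \<longleftrightarrow> representation G d \<rho> \<and>
     (\<forall>W. VectorSpace.subspace class_ring W (module_vec TYPE(complex) d) \<longrightarrow>
          (\<forall>g\<in>carrier G. \<forall>w\<in>W. \<rho> g *\<^sub>v w \<in> W) \<longrightarrow>
          W = {0\<^sub>v d} \<or> W = carrier_vec d)"

text \<open>Characters are functions on the carrier of the group; their values elsewhere are irrelevant.\<close>

definition group_character :: "('g, 'b) monoid_scheme \<Rightarrow> ('g \<Rightarrow> complex) \<Rightarrow> bool" where
  "group_character G \<phi> \<longleftrightarrow>
     (\<exists>d \<rho>. representation G d \<rho> \<and> (\<forall>g\<in>carrier G. \<phi> g = trace (\<rho> g)))"

definition irreducible_character :: "('g, 'b) monoid_scheme \<Rightarrow> ('g \<Rightarrow> complex) \<Rightarrow> bool" where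
  "irreducible_character G \<phi> \<longleftrightarrow>
     (\<exists>d \<rho>. irreducible_representation G d \<rho> \<and> (\<forall>g\<in>carrier G. \<phi> g = trace (\<rho> g)))"

text \<open>An irreducible character \<open>\<psi>\<close> is a constituent of \<open>\<phi>\<close> if \<open>\<phi> - \<psi>\<close> is zero or a character.\<close>

definition irreducible_constituent ::
  "('g, 'b) monoid_scheme \<Rightarrow> ('g \<Rightarrow> complex) \<Rightarrow> ('g \<Rightarrow> complex) \<Rightarrow> bool" where
  "irreducible_constituent G \<psi> \<phi> \<longleftrightarrow> irreducible_character G \<psi> \<and>
     ((\<forall>g\<in>carrier G. \<phi> g = \<psi> g) \<or> group_character G (\<lambda>g. \<phi> g - \<psi> g))"

definition disjoint_characters ::
  "('g, 'b) monoid_scheme \<Rightarrow> ('g \<Rightarrow> complex) \<Rightarrow> ('g \<Rightarrow> complex) \<Rightarrow> bool" where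
  "disjoint_characters G \<phi> \<phi>' \<longleftrightarrow>
     \<not> (\<exists>\<psi>. irreducible_constituent G \<psi> \<phi> \<and> irreducible_constituent G \<psi> \<phi>')"

definition induced_character ::
  "('g, 'b) monoid_scheme \<Rightarrow> 'g set \<Rightarrow> ('g \<Rightarrow> complex) \<Rightarrow> 'g \<Rightarrow> complex" where
  "induced_character G H \<phi> g =
     (\<Sum>x\<in>carrier G.
        let y = x \<otimes>\<^bsub>G\<^esub> g \<otimes>\<^bsub>G\<^esub> inv\<^bsub>G\<^esub> x in if y \<in> H then \<phi> y else 0) / of_nat (card H)"

definition nontrivial_additive_character :: "('a::field \<Rightarrow> complex) \<Rightarrow> bool" where
  "nontrivial_additive_character \<epsilon> \<longleftrightarrow>
     (\<forall>s t. \<epsilon> (s + t) = \<epsilon> s * \<epsilon> t) \<and> (\<forall>t. \<epsilon> t \<noteq> 0) \<and> (\<exists>t. \<epsilon> t \<noteq> 1)"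


section \<open>The parabolic subgroup of a given type\<close>

text \<open>The type is a list \<open>ns\<close>, and \<open>n = sum_list ns\<close>. Blocks, rows and columns are numbered
  from 0, as matrix entries are in the library.\<close>

definition segment :: "nat list \<Rightarrow> nat \<Rightarrow> nat set" where
  "segment ns k = {sum_list (take k ns) ..< sum_list (take (Suc k) ns)}"

definition Delta_J :: "nat list \<Rightarrow> (nat \<times> nat) set" where
  "Delta_J ns = (\<Union>l<length ns. \<Union>k<l. segment ns k \<times> segment ns l)"

definition algebra_J :: "nat list \<Rightarrow> 'a::field mat set" where
  "algebra_J ns = {x \<in> carrier_mat (sum_list ns) (sum_list ns).
     \<forall>i<sum_list ns. \<forall>j<sum_list ns. (i, j) \<notin> Delta_J ns \<longrightarrow> x $$ (i, j) = 0}"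

definition group_P :: "nat list \<Rightarrow> 'a::field mat set" where
  "group_P ns = {g \<in> carrier (GL TYPE('a) (sum_list ns)).
     \<forall>k<length ns. \<forall>l<k. \<forall>i\<in>segment ns k. \<forall>j\<in>segment ns l. g $$ (i, j) = 0}"

definition group_R :: "nat list \<Rightarrow> 'a::field mat set" where
  "group_R ns = {g \<in> carrier (GL TYPE('a) (sum_list ns)).
     \<forall>k<length ns. \<forall>l<length ns. k \<noteq> l \<longrightarrow>
       (\<forall>i\<in>segment ns k. \<forall>j\<in>segment ns l. g $$ (i, j) = 0)}"

definition group_N :: "nat list \<Rightarrow> 'a::field mat set" where
  "group_N ns = (\<lambda>x. 1\<^sub>m (sum_list ns) + x) ` algebra_J ns"

definition subgroup_of_GL :: "nat list \<Rightarrow> 'a::field mat set \<Rightarrow> 'a mat monoid" where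
  "subgroup_of_GL ns H = (GL TYPE('a) (sum_list ns))\<lparr>carrier := H\<rparr>"


section \<open>Block-rook placements\<close>

text \<open>A block-rook is given by the pair of its sets of rows and columns.\<close>

definition block_rook :: "nat list \<Rightarrow> nat set \<times> nat set \<Rightarrow> bool" where
  "block_rook ns = (\<lambda>(A, B). \<exists>l<length ns. \<exists>k<l.
     A \<subseteq> segment ns k \<and> B \<subseteq> segment ns l \<and> card A = card B)"

text \<open>Disjointness of the row sets (of the column sets) says that each row (each column)
  intersects at most one of the block-rooks. The set of nonempty block-rooks is determined by
  their union \<open>D\<close>.\<close>

definition block_rooks_of ::
  "nat list \<Rightarrow> (nat \<times> nat) set \<Rightarrow> (nat set \<times> nat set) set \<Rightarrow> bool" where
  "block_rooks_of ns D \<B> \<longleftrightarrow>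
     (\<forall>X\<in>\<B>. block_rook ns X) \<and> D = (\<Union>(A, B)\<in>\<B>. A \<times> B) \<and>
     disjoint_family_on fst \<B> \<and> disjoint_family_on snd \<B>"

definition block_rook_placement :: "nat list \<Rightarrow> (nat \<times> nat) set \<Rightarrow> bool" where
  "block_rook_placement ns D \<longleftrightarrow> D \<subseteq> Delta_J ns \<and> (\<exists>\<B>. block_rooks_of ns D \<B>)"

text \<open>An element of the dual space of \<open>J\<close> is a function on matrices of which only the values on \<open>J\<close>
  matter. The matrix \<open>c\<close> holds the coefficients \<open>\<lambda>\<^sub>i\<^sub>j\<close>, of which only those with \<open>(i, j) \<in> D\<close>
  are used.\<close>

definition associated_functional ::
  "nat list \<Rightarrow> (nat \<times> nat) set \<Rightarrow> ('a::field mat \<Rightarrow> 'a) \<Rightarrow> bool" where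
  "associated_functional ns D lam \<longleftrightarrow>
     (\<exists>c\<in>carrier_mat (sum_list ns) (sum_list ns). \<exists>\<B>. block_rooks_of ns D \<B> \<and>
        (\<forall>x\<in>algebra_J ns. lam x = (\<Sum>(i, j)\<in>D. c $$ (i, j) * x $$ (i, j))) \<and>
        (\<forall>(A, B)\<in>\<B>. det (submatrix c A B) \<noteq> 0))"


section \<open>The characters attached to a functional on \<open>J\<close>\<close>

definition J_right :: "nat list \<Rightarrow> ('a::field mat \<Rightarrow> 'a) \<Rightarrow> 'a mat set" where
  "J_right ns lam = {x \<in> algebra_J ns. \<forall>y\<in>algebra_J ns. lam (x * y) = 0}"

definition N_right :: "nat list \<Rightarrow> ('a::field mat \<Rightarrow> 'a) \<Rightarrow> 'a mat set" where
  "N_right ns lam = (\<lambda>x. 1\<^sub>m (sum_list ns) + x) ` J_right ns lam"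

definition R_right :: "nat list \<Rightarrow> ('a::field mat \<Rightarrow> 'a) \<Rightarrow> 'a mat set" where
  "R_right ns lam = {r \<in> group_R ns. \<forall>x\<in>algebra_J ns. lam (r * x) = lam x}"

definition R_left :: "nat list \<Rightarrow> ('a::field mat \<Rightarrow> 'a) \<Rightarrow> 'a mat set" where
  "R_left ns lam = {r \<in> group_R ns. \<forall>x\<in>algebra_J ns. lam (x * r) = lam x}"

definition R_circ :: "nat list \<Rightarrow> ('a::field mat \<Rightarrow> 'a) \<Rightarrow> 'a mat set" where
  "R_circ ns lam = R_right ns lam \<inter> R_left ns lam"

definition P_sub :: "nat list \<Rightarrow> ('a::field mat \<Rightarrow> 'a) \<Rightarrow> 'a mat set" where
  "P_sub ns lam = {r * u | r u. r \<in> R_circ ns lam \<and> u \<in> N_right ns lam}"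

text \<open>Every element of \<open>P_sub ns lam\<close> is uniquely \<open>r + x\<close> with \<open>r \<in> R_circ ns lam\<close> and
  \<open>x \<in> J_right ns lam\<close>, so the description below determines the value on \<open>P_sub ns lam\<close>.\<close>

definition xi ::
  "nat list \<Rightarrow> ('a::field mat \<Rightarrow> 'a) \<Rightarrow> ('a \<Rightarrow> complex) \<Rightarrow> ('a mat \<Rightarrow> complex) \<Rightarrow> 'a mat \<Rightarrow> complex" where
  "xi ns lam \<epsilon> \<theta> g =
     (THE z. \<exists>r\<in>R_circ ns lam. \<exists>x\<in>J_right ns lam. g = r + x \<and> z = \<theta> r * \<epsilon> (lam x))"

definition chi ::
  "nat list \<Rightarrow> ('a::field mat \<Rightarrow> 'a) \<Rightarrow> ('a \<Rightarrow> complex) \<Rightarrow> ('a mat \<Rightarrow> complex) \<Rightarrow> 'a mat \<Rightarrow> complex" where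
  "chi ns lam \<epsilon> \<theta> =
     induced_character (subgroup_of_GL ns (group_P ns)) (P_sub ns lam) (xi ns lam \<epsilon> \<theta>)"

definition group_S :: "nat list \<Rightarrow> ('a::field mat \<Rightarrow> 'a) \<Rightarrow> 'a mat set" where
  "group_S ns lam = {g \<in> group_P ns. \<forall>x\<in>J_right ns lam.
     g * x * inv\<^bsub>GL TYPE('a) (sum_list ns)\<^esub> g \<in> J_right ns lam \<and>
     lam (g * x * inv\<^bsub>GL TYPE('a) (sum_list ns)\<^esub> g) = lam x}"

definition S_invariant :: "nat list \<Rightarrow> ('a::field mat \<Rightarrow> 'a) \<Rightarrow> ('a mat \<Rightarrow> complex) \<Rightarrow> bool" where
  "S_invariant ns lam \<theta> \<longleftrightarrow>
     (\<forall>b\<in>group_N ns. \<forall>t\<in>group_R ns. b * t \<in> group_S ns lam \<longrightarrow>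
        (\<forall>r\<in>R_circ ns lam. \<theta> (t * r * inv\<^bsub>GL TYPE('a) (sum_list ns)\<^esub> t) = \<theta> r))"

end

(* For complex functions f, f' on a finite group G put <f, f'> = sum of f(g) f'(g^-1). Two
   characters are disjoint if and only if this pairing vanishes, so by Mackey's formula it suffices
   that for every z in P the sum of xi(h) xi'(z h^-1 z^-1), over those h in P_sub for which the second
   argument lies in P_sub too, is zero.

   Write lam(x) = tr(L x) with L strictly block lower triangular; then x in J lies in J_right if and
   only if L x is block upper triangular. If conjugation by z changes lam at some x in J_right with
   z x z^-1 in J_right, then replacing h by h(1 + c x) for a suitable scalar c shows that the sum is 0.
   Otherwise duality in the space of matrices shows that L z - h L is block upper triangular for some
   block upper triangular h with the block-diagonal part t of z. Hence z lies in S. For r in R_circ,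
   each row and each column of L meeting only one block, t r t^-1 lies in R_circ and
   z r z^-1 - t r t^-1 lies in the kernel of lam on J_right. So xi'(z h z^-1) = xi'(h) by
   S-invariance, and the sum is the order of J_right times the pairing of theta and theta', which is
   zero. *)

theory Submission
  imports Defs "Jordan_Normal_Form.Spectral_Radius"
begin

section \<open>Adapted bases and annihilators\<close>

text \<open>Mackey's formula is used in its crudest form, with z running over all of P instead of
  double coset representatives. The obstacle is that a compatible z need not fix the functional on
  J; it is controlled only on those x in J_right whose conjugate lies in J_right too. These x form
  the annihilator of P + J L + J L z under the trace form, so duality gives z^-1 L z - L = p + u L +
  v L z with p in P and u, v in J. Solving for L z gives h = (1 - z v)^-1 z (1 + u): two unipotent
  factors absorb the error and leave the diagonal part alone. The rook condition then turns
  relations modulo P into exact relations for diagonal parts.\<close>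

lemma subspaceI:
  assumes "W \<subseteq> carrier_vec d" "0\<^sub>v d \<in> W"
    and "\<And>v w. v \<in> W \<Longrightarrow> w \<in> W \<Longrightarrow> v + w \<in> W"
    and "\<And>c v. v \<in> W \<Longrightarrow> c \<cdot>\<^sub>v v \<in> W"
  shows "VectorSpace.subspace class_ring W (module_vec TYPE('a::field) d)"
  unfolding VectorSpace.subspace_def
proof
  show "vectorspace class_ring (module_vec TYPE('a) d)" by (rule vec_vs)
  show "submodule class_ring W (module_vec TYPE('a) d)"
    using assms by (intro submodule.intro vec_module) (auto simp: module_vec_simps)
qed

lemma subspaceD:
  assumes "VectorSpace.subspace class_ring W (module_vec TYPE('a::field) d)"
  shows "W \<subseteq> carrier_vec d" "0\<^sub>v d \<in> W"
    and "\<And>v w. v \<in> W \<Longrightarrow> w \<in> W \<Longrightarrow> v + w \<in> W"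
    and "\<And>c v. v \<in> W \<Longrightarrow> c \<cdot>\<^sub>v v \<in> W"
proof -
  have "submodule class_ring W (module_vec TYPE('a) d)"
    using assms unfolding VectorSpace.subspace_def by blast
  from submodule.subset[OF this] submodule.m_closed[OF this] submodule.smult_closed[OF this]
    submodule.zero_closed[OF this]
  show "W \<subseteq> carrier_vec d" "0\<^sub>v d \<in> W"
    and "\<And>v w. v \<in> W \<Longrightarrow> w \<in> W \<Longrightarrow> v + w \<in> W"
    and "\<And>c v. v \<in> W \<Longrightarrow> c \<cdot>\<^sub>v v \<in> W"
    by (auto simp: module_vec_simps)
qed

lemma mult_unit_vec: "Q \<in> carrier_mat n d \<Longrightarrow> m < d \<Longrightarrow> Q *\<^sub>v unit_vec d m = col Q (m::nat)"
  for Q :: "'a::field mat"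
  by (rule eq_vecI) (auto simp: mult_mat_vec_def)

text \<open>For m = k this puts into W every combination of the first k columns of Q. The cutoff m
  is kept apart from k so that it can be raised one column at a time.\<close>

lemma mult_truncated_mem_subspace:
  fixes Q :: "'a::field mat"
  assumes W: "VectorSpace.subspace class_ring W (module_vec TYPE('a) d)"
    and Q: "Q \<in> carrier_mat d d" and cols: "\<And>i. i < k \<Longrightarrow> col Q i \<in> W"
    and m: "m \<le> k" "m \<le> d"
  shows "Q *\<^sub>v vec d (\<lambda>i. if i < m then u i else 0) \<in> W"
  using m
proof (induction m)
  case 0
  have "vec d (\<lambda>i. if i < (0::nat) then u i else 0) = 0\<^sub>v d" by auto
  moreover have "Q *\<^sub>v 0\<^sub>v d = 0\<^sub>v d" using Q by (auto simp: mult_mat_vec_def)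
  ultimately show ?case using subspaceD(2)[OF W] by simp
next
  case (Suc m)
  have "vec d (\<lambda>i. if i < Suc m then u i else 0)
      = vec d (\<lambda>i. if i < m then u i else 0) + u m \<cdot>\<^sub>v unit_vec d m"
    using Suc.prems by (intro eq_vecI) (auto simp: less_Suc_eq)
  then have "Q *\<^sub>v vec d (\<lambda>i. if i < Suc m then u i else 0)
      = Q *\<^sub>v vec d (\<lambda>i. if i < m then u i else 0) + u m \<cdot>\<^sub>v col Q m"
    using Q Suc.prems mult_add_distrib_mat_vec[OF Q] mult_mat_vec[OF Q] mult_unit_vec[OF Q]
    by simp
  then show ?case using Suc cols[of m] subspaceD(3,4)[OF W] by simp
qed

text \<open>The exchange step for bases. Once y stands in column k, the unit vector of index i is
  dispensable because \<open>y i\<close> is nonzero; the unit vector of index k takes its place in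
  column i. For i = k only one column changes.\<close>

lemma replace_column_invertible:
  fixes y :: "nat \<Rightarrow> 'a::field"
  assumes k: "k < d" and i: "i < d" and yi: "y i \<noteq> 0"
  obtains M M' where "M \<in> carrier_mat d d" "M' \<in> carrier_mat d d"
    "M * M' = 1\<^sub>m d" "M' * M = 1\<^sub>m d" "col M k = vec d y"
    "\<And>j. j < d \<Longrightarrow> j \<noteq> k \<Longrightarrow> j \<noteq> i \<Longrightarrow> col M j = unit_vec d j"
proof -
  define M where "M = mat d d (\<lambda>(r,c). if c = k then y r else
      if c = i then (if r = k then 1 else 0) else if r = c then 1 else (0::'a))"
  have M: "M \<in> carrier_mat d d" by (simp add: M_def)
  have "det M \<noteq> 0"
  proof
    assume "det M = 0"
    then obtain u where u: "u \<in> carrier_vec d" "u \<noteq> 0\<^sub>v d" "M *\<^sub>v u = 0\<^sub>v d"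
      using det_0_iff_vec_prod_zero_field[OF M] by blast
    \<comment> \<open>Coordinate r of the product of \<open>M\<close> and \<open>u\<close>, written
      uniformly in r. Row i forces \<open>u $ k\<close> to vanish because \<open>y i\<close> does
      not, then row k forces \<open>u $ i\<close> to vanish, and every other row reads
      \<open>u $ r = 0\<close>.\<close>
    have row: "y r * u $ k + (if i \<noteq> k \<and> r = k then u $ i else 0)
        + (if r \<noteq> k \<and> r \<noteq> i then u $ r else 0) = 0" if r: "r < d" for r
    proof -
      have "0 = (M *\<^sub>v u) $ r" using u r by simp
      also have "\<dots> = (\<Sum>c<d. M $$ (r,c) * u $ c)"
        using u(1) r M by (simp add: scalar_prod_def atLeast0LessThan)
      also have "\<dots> = (\<Sum>c<d. (if c = k then y r * u $ k else 0)
          + (if c = i then (if i \<noteq> k \<and> r = k then u $ i else 0) else 0)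
          + (if c = r then (if r \<noteq> k \<and> r \<noteq> i then u $ r else 0) else 0))"
        using r by (intro sum.cong) (auto simp: M_def)
      finally show ?thesis using r k i by (simp add: sum.distrib)
    qed
    have uk: "u $ k = 0" using row[OF i] yi k by (auto split: if_splits)
    have ui: "u $ i = 0" using row[OF k] uk by (auto split: if_splits)
    have "u $ r = 0" if "r < d" for r using row[OF that] uk ui by (auto split: if_splits)
    then have "u = 0\<^sub>v d" using u(1) by auto
    with u(2) show False by blast
  qed
  then have "M \<in> Units (ring_mat TYPE('a) d ())"
    by (rule det_non_zero_imp_unit[OF M])
  then obtain M' where M': "M' \<in> carrier_mat d d" "M * M' = 1\<^sub>m d" "M' * M = 1\<^sub>m d"
    by (auto simp: Units_def ring_mat_simps)
  show thesis
    by (rule that[OF M M']) (use k i in \<open>auto simp: M_def intro!: eq_vecI\<close>)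
qed

text \<open>Take an invertible Q with as many leading columns in W as possible. A vector of W with a
  nonzero coordinate at or beyond k could be exchanged into column k, against maximality. Membership
  is phrased through coordinates because block triangular shape is read off from them later.\<close>

lemma adapted_basis:
  fixes W :: "'a::field vec set"
  assumes W: "VectorSpace.subspace class_ring W (module_vec TYPE('a) d)"
  obtains Q Q' k where "Q \<in> carrier_mat d d" "Q' \<in> carrier_mat d d"
    "Q * Q' = 1\<^sub>m d" "Q' * Q = 1\<^sub>m d" "k \<le> d"
    "\<And>v. v \<in> carrier_vec d \<Longrightarrow> v \<in> W \<longleftrightarrow> (\<forall>i. k \<le> i \<longrightarrow> i < d \<longrightarrow> (Q' *\<^sub>v v) $ i = 0)"
proof -
  define good where "good k \<longleftrightarrow> k \<le> d \<and> (\<exists>Q Q'. Q \<in> carrier_mat d d \<and> Q' \<in> carrier_mat d d \<and>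
    Q * Q' = 1\<^sub>m d \<and> Q' * Q = 1\<^sub>m d \<and> (\<forall>i<k. col Q i \<in> W))" for k
  have "good 0" unfolding good_def
    by (intro conjI exI[of _ "1\<^sub>m d"]) auto
  moreover have "\<forall>k. good k \<longrightarrow> k \<le> d" by (simp add: good_def)
  ultimately obtain k where k: "good k" and max: "\<And>j. good j \<Longrightarrow> j \<le> k"
    by (metis Nat.ex_has_greatest_nat)
  then obtain Q Q' where Q: "Q \<in> carrier_mat d d" and Q': "Q' \<in> carrier_mat d d"
    and QQ: "Q * Q' = 1\<^sub>m d" "Q' * Q = 1\<^sub>m d" and cols: "\<And>i. i < k \<Longrightarrow> col Q i \<in> W"
    and kd: "k \<le> d" unfolding good_def by blast
  have QQv: "Q *\<^sub>v (Q' *\<^sub>v v) = v" if "v \<in> carrier_vec d" for v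
    using assoc_mult_mat_vec[OF Q Q' that] QQ that by simp
  have "v \<in> W \<longleftrightarrow> (\<forall>i. k \<le> i \<longrightarrow> i < d \<longrightarrow> (Q' *\<^sub>v v) $ i = 0)" if v: "v \<in> carrier_vec d" for v
  proof
    assume z: "\<forall>i. k \<le> i \<longrightarrow> i < d \<longrightarrow> (Q' *\<^sub>v v) $ i = 0"
    have "Q' *\<^sub>v v = vec d (\<lambda>i. if i < k then (Q' *\<^sub>v v) $ i else 0)"
      using z Q' by (intro eq_vecI) auto
    then have "Q *\<^sub>v (Q' *\<^sub>v v) \<in> W"
      using mult_truncated_mem_subspace[OF W Q cols order_refl kd] by metis
    then show "v \<in> W" using QQv[OF v] by simp
  next
    assume vW: "v \<in> W"
    show "\<forall>i. k \<le> i \<longrightarrow> i < d \<longrightarrow> (Q' *\<^sub>v v) $ i = 0"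
    proof (rule ccontr)
      assume "\<not> ?thesis"
      then obtain i where i: "k \<le> i" "i < d" "(Q' *\<^sub>v v) $ i \<noteq> 0" by auto
      then obtain M M' where M: "M \<in> carrier_mat d d" "M' \<in> carrier_mat d d"
        "M * M' = 1\<^sub>m d" "M' * M = 1\<^sub>m d" "col M k = vec d (\<lambda>i. (Q' *\<^sub>v v) $ i)"
        "\<And>j. j < d \<Longrightarrow> j \<noteq> k \<Longrightarrow> j \<noteq> i \<Longrightarrow> col M j = unit_vec d j"
        using replace_column_invertible[where k=k and d=d and i=i and y="\<lambda>i. (Q' *\<^sub>v v) $ i"] by auto
      have 1: "(Q * M) * (M' * Q') = 1\<^sub>m d"
      proof -
        have "(Q * M) * (M' * Q') = Q * ((M * M') * Q')"
          using Q Q' M(1,2) by (simp add: assoc_mult_mat[of _ d d _ d _ d])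
        then show ?thesis using M(3) QQ(1) Q' by simp
      qed
      have 2: "(M' * Q') * (Q * M) = 1\<^sub>m d"
        by (rule mat_mult_left_right_inverse[OF _ _ 1]) (use Q Q' M in auto)
      have kd': "k < d" using i by simp
      \<comment> \<open>Column k of \<open>M\<close> holds the coordinates of v with respect to Q,
        so \<open>Q * M\<close> has v itself as column k. The columns before k are unchanged because
        k \<le> i.\<close>
      have "vec d (\<lambda>i. (Q' *\<^sub>v v) $ i) = Q' *\<^sub>v v" using Q' by auto
      then have colk: "col (Q * M) k = v"
        unfolding col_mult2[OF Q M(1) kd'] M(5) using QQv[OF v] by simp
      have "col (Q * M) j = col Q j" if "j < k" for j
        using that i kd' col_mult2[OF Q M(1), of j] M(6)[of j] mult_unit_vec[OF Q] by simp
      then have "good (Suc k)" unfolding good_def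
        using 1 2 Q Q' M(1,2) colk cols vW kd'
        by (intro conjI exI[of _ "Q * M"] exI[of _ "M' * Q'"]) (auto simp: less_Suc_eq)
      then show False using max by fastforce
    qed
  qed
  then show thesis using that Q Q' QQ kd by blast
qed

lemma annihilator_separates:
  fixes U :: "('i \<Rightarrow> 'a::field) set"
  assumes "finite I"
    and "\<And>u v. u \<in> U \<Longrightarrow> v \<in> U \<Longrightarrow> (\<lambda>i. u i + v i) \<in> U"
    and "\<And>c u. u \<in> U \<Longrightarrow> (\<lambda>i. c * u i) \<in> U"
    and "U \<noteq> {}"
    and "\<And>u i. u \<in> U \<Longrightarrow> i \<notin> I \<Longrightarrow> u i = 0"
    and "\<And>i. i \<notin> I \<Longrightarrow> f i = 0"
    and "f \<notin> U"
  shows "\<exists>x. (\<forall>u\<in>U. (\<Sum>i\<in>I. x i * u i) = 0) \<and> (\<Sum>i\<in>I. x i * f i) \<noteq> 0"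
  using assms
proof (induction I arbitrary: U f)
  case empty
  then obtain w where "w \<in> U" by blast
  moreover from empty this have "w = f" by (auto simp: fun_eq_iff)
  ultimately show ?case using empty by blast
next
  case (insert a I)
  define U0 where "U0 = {u \<in> U. u a = 0}"
  from insert.prems(3) obtain w where "w \<in> U" by blast
  with insert.prems(2)[of w 0] have zero: "(\<lambda>_. 0) \<in> U" by simp
  have U0: "\<And>u v. u \<in> U0 \<Longrightarrow> v \<in> U0 \<Longrightarrow> (\<lambda>i. u i + v i) \<in> U0"
    "\<And>c u. u \<in> U0 \<Longrightarrow> (\<lambda>i. c * u i) \<in> U0" "U0 \<noteq> {}"
    "\<And>u i. u \<in> U0 \<Longrightarrow> i \<notin> I \<Longrightarrow> u i = 0"
  proof -
    show "U0 \<noteq> {}" using zero by (auto simp: U0_def)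
    show "u i = 0" if "u \<in> U0" "i \<notin> I" for u i
      using that insert.prems(4)[of u i] by (cases "i = a") (auto simp: U0_def)
  qed (use insert.prems(1,2) in \<open>auto simp: U0_def\<close>)
  show ?case
  proof (cases "\<forall>u\<in>U. u a = 0")
    case True
    show ?thesis
    proof (cases "f a = 0")
      case fa: False
      show ?thesis
        by (rule exI[of _ "\<lambda>i. if i = a then 1 else 0"])
          (use True fa insert.hyps in \<open>auto simp: if_distrib[where f="\<lambda>x. x * _"] cong: if_cong\<close>)
    next
      case fa: True
      have "\<exists>x. (\<forall>u\<in>U0. (\<Sum>i\<in>I. x i * u i) = 0) \<and> (\<Sum>i\<in>I. x i * f i) \<noteq> 0"
        proof (rule insert.IH[where U=U0])
        show "f i = 0" if "i \<notin> I" for i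
          using that fa insert.prems(5)[of i] by (cases "i = a") auto
        show "f \<notin> U0" using insert.prems(6) by (simp add: U0_def)
      qed (use U0 in blast)+
      then obtain x where "\<forall>u\<in>U0. (\<Sum>i\<in>I. x i * u i) = 0" "(\<Sum>i\<in>I. x i * f i) \<noteq> 0"
        by blast
      then show ?thesis using True fa insert.hyps by (intro exI[of _ x]) (auto simp: U0_def)
    qed
  next
    case False
    then obtain u1 where u1: "u1 \<in> U" "u1 a \<noteq> 0" by blast
    define v where "v = (\<lambda>i. inverse (u1 a) * u1 i)"
    have v: "v \<in> U" "v a = 1" using u1 insert.prems(2)[of u1] by (auto simp: v_def)
    define f' where "f' = (\<lambda>i. f i + (- f a) * v i)"
    have f'1: "f' \<notin> U0"
    proof
      assume "f' \<in> U0"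
      then have "(\<lambda>i. f' i + f a * v i) \<in> U"
        using insert.prems(1)[of f'] insert.prems(2)[OF v(1)] by (auto simp: U0_def)
      then show False using insert.prems(6) by (simp add: f'_def)
    qed
    have f'2: "f' i = 0" if "i \<notin> I" for i
      using that v insert.prems(4)[of v i] insert.prems(5)[of i] by (cases "i = a") (auto simp: f'_def)
    have "\<exists>x. (\<forall>u\<in>U0. (\<Sum>i\<in>I. x i * u i) = 0) \<and> (\<Sum>i\<in>I. x i * f' i) \<noteq> 0"
      by (rule insert.IH[where U=U0 and f=f']) (use U0 f'1 f'2 in blast)+
    then obtain x where x: "\<And>u. u \<in> U0 \<Longrightarrow> (\<Sum>i\<in>I. x i * u i) = 0"
      "(\<Sum>i\<in>I. x i * f' i) \<noteq> 0"
      by blast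
    \<comment> \<open>The value at a is chosen so that the extended functional kills v; on any g it
      then equals x applied to \<open>g - g a * v\<close>.\<close>
    define y where "y = (\<lambda>i. if i = a then - (\<Sum>i\<in>I. x i * v i) else x i)"
    have y: "(\<Sum>i\<in>insert a I. y i * g i) = (\<Sum>i\<in>I. x i * (g i + (- g a) * v i))" for g
    proof -
      have "(\<Sum>i\<in>I. y i * g i) = (\<Sum>i\<in>I. x i * g i)"
        using insert.hyps by (intro sum.cong) (auto simp: y_def)
      then show ?thesis using insert.hyps
        by (simp add: y_def algebra_simps sum.distrib sum_subtractf sum_distrib_left)
    qed
    show ?thesis
    proof (intro exI conjI ballI)
      fix u assume u: "u \<in> U"
      have "(\<lambda>i. u i + (- u a) * v i) \<in> U0"
        using insert.prems(1)[OF u insert.prems(2)[OF v(1), of "- u a"]] v(2) by (simp add: U0_def)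
      from x(1)[OF this] show "(\<Sum>i\<in>insert a I. y i * u i) = 0" unfolding y .
    next
      show "(\<Sum>i\<in>insert a I. y i * f i) \<noteq> 0" unfolding y using x(2) by (simp add: f'_def)
    qed
  qed
qed

section \<open>Decomposition of representations\<close>

lemma trace_mult_comm:
  fixes A :: "'a::comm_semiring_0 mat"
  assumes "A \<in> carrier_mat n m" "B \<in> carrier_mat m n"
  shows "trace (A * B) = trace (B * A)"
proof -
  have "trace (A * B) = (\<Sum>i<n. \<Sum>j<m. A $$ (i,j) * B $$ (j,i))"
    using assms by (simp add: trace_def scalar_prod_def atLeast0LessThan)
  also have "\<dots> = (\<Sum>j<m. \<Sum>i<n. B $$ (j,i) * A $$ (i,j))"
    by (subst sum.swap) (simp add: mult.commute)
  also have "\<dots> = trace (B * A)"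
    using assms by (simp add: trace_def scalar_prod_def atLeast0LessThan)
  finally show ?thesis .
qed

section \<open>Matrix representations and their characters\<close>

lemma carrier_GL: "carrier (GL TYPE('a::field) n)
    = {A \<in> carrier_mat n n. \<exists>B\<in>carrier_mat n n. A * B = 1\<^sub>m n \<and> B * A = 1\<^sub>m n}"
  by (auto simp: GL_def units_of_def Units_def ring_mat_simps)

lemma mult_GL: "x \<otimes>\<^bsub>GL TYPE('a::field) n\<^esub> y = x * y"
  by (simp add: GL_def units_of_def ring_mat_simps)

lemma one_GL: "\<one>\<^bsub>GL TYPE('a::field) n\<^esub> = 1\<^sub>m n"
  by (simp add: GL_def units_of_def ring_mat_simps)

lemma group_GL: "group (GL TYPE('a::field) n)"
proof -
  interpret ring "ring_mat TYPE('a) n ()" by (rule ring_mat)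
  show ?thesis unfolding GL_def by (rule units_group)
qed

lemma inv_GL:
  assumes "A \<in> carrier (GL TYPE('a::field) n)"
  shows "inv\<^bsub>GL TYPE('a) n\<^esub> A \<in> carrier_mat n n"
    "A * inv\<^bsub>GL TYPE('a) n\<^esub> A = 1\<^sub>m n" "inv\<^bsub>GL TYPE('a) n\<^esub> A * A = 1\<^sub>m n"
  using group.inv_closed[OF group_GL assms] group.r_inv[OF group_GL assms]
    group.l_inv[OF group_GL assms]
  by (simp_all add: carrier_GL mult_GL one_GL)

lemma representationD:
  assumes "group G" "representation G d \<rho>"
  shows "0 < d" "g \<in> carrier G \<Longrightarrow> \<rho> g \<in> carrier_mat d d"
    and "g \<in> carrier G \<Longrightarrow> h \<in> carrier G \<Longrightarrow> \<rho> (g \<otimes>\<^bsub>G\<^esub> h) = \<rho> g * \<rho> h"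
    and "\<rho> \<one>\<^bsub>G\<^esub> = 1\<^sub>m d"
proof -
  have hom: "\<rho> \<in> hom G (GL TYPE(complex) d)" using assms by (simp add: representation_def)
  show "0 < d" using assms by (simp add: representation_def)
  show "g \<in> carrier G \<Longrightarrow> \<rho> g \<in> carrier_mat d d"
    using hom_in_carrier[OF hom] by (auto simp: carrier_GL)
  show "g \<in> carrier G \<Longrightarrow> h \<in> carrier G \<Longrightarrow> \<rho> (g \<otimes>\<^bsub>G\<^esub> h) = \<rho> g * \<rho> h"
    using hom_mult[OF hom] by (auto simp: mult_GL)
  show "\<rho> \<one>\<^bsub>G\<^esub> = 1\<^sub>m d"
    using hom_one[OF hom assms(1) group_GL] by (simp add: one_GL)
qed

text \<open>The image of an inverse is an inverse matrix, so multiplicativity and the value at the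
  unit already give invertibility.\<close>

lemma representationI:
  assumes "group G" "0 < d" "\<And>g. g \<in> carrier G \<Longrightarrow> \<rho> g \<in> carrier_mat d d"
    and mult: "\<And>g h. g \<in> carrier G \<Longrightarrow> h \<in> carrier G \<Longrightarrow> \<rho> (g \<otimes>\<^bsub>G\<^esub> h) = \<rho> g * \<rho> h"
    and one: "\<rho> \<one>\<^bsub>G\<^esub> = 1\<^sub>m d"
  shows "representation G d \<rho>"
proof -
  have "\<rho> g \<in> carrier (GL TYPE(complex) d)" if g: "g \<in> carrier G" for g
  proof -
    have "inv\<^bsub>G\<^esub> g \<in> carrier G" using assms(1) g by (simp add: group.inv_closed)
    moreover have "\<rho> g * \<rho> (inv\<^bsub>G\<^esub> g) = 1\<^sub>m d" "\<rho> (inv\<^bsub>G\<^esub> g) * \<rho> g = 1\<^sub>m d"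
      using g assms(1) mult[symmetric] one
      by (simp_all add: group.inv_closed group.r_inv group.l_inv)
    ultimately show ?thesis using assms(3) g by (auto simp: carrier_GL)
  qed
  then show ?thesis using assms by (auto simp: representation_def hom_def mult_GL)
qed

lemma group_character_add:
  assumes G: "group G" and "group_character G \<phi>" "group_character G \<psi>"
  shows "group_character G (\<lambda>g. \<phi> g + \<psi> g)"
proof -
  from assms obtain d \<rho> e \<sigma> where \<rho>: "representation G d \<rho>" and \<phi>: "\<forall>g\<in>carrier G. \<phi> g = trace (\<rho> g)"
    and \<sigma>: "representation G e \<sigma>" and \<psi>: "\<forall>g\<in>carrier G. \<psi> g = trace (\<sigma> g)"
    unfolding group_character_def by blast
  note R = representationD[OF G \<rho>] and S = representationD[OF G \<sigma>]
  define \<tau> where "\<tau> g = four_block_mat (\<rho> g) (0\<^sub>m d e) (0\<^sub>m e d) (\<sigma> g)" for g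
  have "representation G (d + e) \<tau>"
  proof (rule representationI[OF G])
    fix g h assume g: "g \<in> carrier G" and h: "h \<in> carrier G"
    have "\<tau> g * \<tau> h = four_block_mat (\<rho> g * \<rho> h) (0\<^sub>m d e) (0\<^sub>m e d) (\<sigma> g * \<sigma> h)"
      unfolding \<tau>_def
      by (subst mult_four_block_mat[of _ d d _ e _ e _ _ d _ e]) (use R(2)[OF g] R(2)[OF h] S(2)[OF g] S(2)[OF h] in auto)
    then show "\<tau> (g \<otimes>\<^bsub>G\<^esub> h) = \<tau> g * \<tau> h" using R(3)[OF g h] S(3)[OF g h] by (simp add: \<tau>_def)
  qed (use R S in \<open>auto simp: \<tau>_def\<close>)
  moreover have "\<phi> g + \<psi> g = trace (\<tau> g)" if g: "g \<in> carrier G" for g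
  proof -
    have "trace (\<tau> g) = (\<Sum>i\<in>{..<d} \<union> {d..<d+e}. \<tau> g $$ (i,i))"
      using R(2)[OF g] S(2)[OF g] by (auto simp: trace_def \<tau>_def intro!: sum.cong)
    also have "\<dots> = (\<Sum>i<d. \<tau> g $$ (i,i)) + (\<Sum>i=0+d..<e+d. \<tau> g $$ (i,i))"
      by (subst sum.union_disjoint) (auto simp: add.commute)
    also have "\<dots> = trace (\<rho> g) + trace (\<sigma> g)"
      unfolding sum.shift_bounds_nat_ivl
      using R(2)[OF g] S(2)[OF g] by (simp add: trace_def \<tau>_def atLeast0LessThan)
    finally show ?thesis using \<phi> \<psi> g by simp
  qed
  ultimately show ?thesis unfolding group_character_def by blast
qed

text \<open>In a basis adapted to W all matrices are block upper triangular. The two diagonal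
  blocks, the actions on W and on the quotient by W, are again multiplicative and carry the whole
  trace, so no invariant complement is required.\<close>

lemma invariant_subspace_split:
  assumes G: "group G" and \<rho>: "representation G d \<rho>"
    and W: "VectorSpace.subspace class_ring W (module_vec TYPE(complex) d)"
    and inv: "\<forall>g\<in>carrier G. \<forall>w\<in>W. \<rho> g *\<^sub>v w \<in> W"
    and ne: "W \<noteq> {0\<^sub>v d}" "W \<noteq> carrier_vec d"
  obtains k l \<sigma> \<tau> where "k < d" "l < d" "representation G k \<sigma>" "representation G l \<tau>"
    "\<forall>g\<in>carrier G. trace (\<rho> g) = trace (\<sigma> g) + trace (\<tau> g)"
proof -
  note R = representationD[OF G \<rho>]
  obtain Q Q' k where Q: "Q \<in> carrier_mat d d" and Q': "Q' \<in> carrier_mat d d"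
    and QQ: "Q * Q' = 1\<^sub>m d" "Q' * Q = 1\<^sub>m d" and kd: "k \<le> d"
    and Wiff: "\<And>v. v \<in> carrier_vec d \<Longrightarrow> v \<in> W \<longleftrightarrow> (\<forall>i. k \<le> i \<longrightarrow> i < d \<longrightarrow> (Q' *\<^sub>v v) $ i = 0)"
    using adapted_basis[OF W] by blast
  have "k \<noteq> d" using ne(2) Wiff subspaceD(1)[OF W] by auto
  have "k \<noteq> 0"
  proof
    assume "k = 0"
    have "w = 0\<^sub>v d" if w: "w \<in> W" for w
    proof -
      have wd: "w \<in> carrier_vec d" using w subspaceD(1)[OF W] by auto
      have "Q' *\<^sub>v w = 0\<^sub>v d" using Wiff[OF wd] w \<open>k = 0\<close> Q' by (intro eq_vecI) auto
      then have "Q *\<^sub>v (Q' *\<^sub>v w) = 0\<^sub>v d" using Q by (auto simp: mult_mat_vec_def)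
      then show ?thesis using assoc_mult_mat_vec[OF Q Q' wd] QQ wd by simp
    qed
    with ne(1) subspaceD(2)[OF W] show False by blast
  qed
  define A where "A g = Q' * \<rho> g * Q" for g
  have A: "A g \<in> carrier_mat d d" if "g \<in> carrier G" for g
    using R(2)[OF that] Q Q' by (simp add: A_def)
  have A_mult: "A (g \<otimes>\<^bsub>G\<^esub> h) = A g * A h" if g: "g \<in> carrier G" and h: "h \<in> carrier G" for g h
  proof -
    note c = R(2)[OF g] R(2)[OF h] Q Q'
    have "A g * A h = Q' * \<rho> g * ((Q * Q') * (\<rho> h * Q))"
      unfolding A_def using c by (simp add: assoc_mult_mat[of _ d d _ d _ d])
    also have "\<dots> = A (g \<otimes>\<^bsub>G\<^esub> h)"
      unfolding A_def R(3)[OF g h] using QQ c by (simp add: assoc_mult_mat[of _ d d _ d _ d])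
    finally show ?thesis ..
  qed
  have A_one: "A \<one>\<^bsub>G\<^esub> = 1\<^sub>m d" unfolding A_def R(4) using Q Q' QQ by simp
  have A_trace: "trace (A g) = trace (\<rho> g)" if g: "g \<in> carrier G" for g
  proof -
    note c = R(2)[OF g] Q Q'
    have "trace (A g) = trace (Q * (Q' * \<rho> g))" unfolding A_def
      by (rule trace_mult_comm) (use c in auto)
    also have "Q * (Q' * \<rho> g) = \<rho> g" 
      using assoc_mult_mat[OF Q Q' R(2)[OF g], symmetric] QQ c by simp
    finally show ?thesis .
  qed
  have A_zero: "A g $$ (r,c) = 0" if g: "g \<in> carrier G" and rc: "k \<le> r" "r < d" "c < k" for g r c
  proof -
    have u: "unit_vec d c \<in> carrier_vec d" by simp
    \<comment> \<open>Its adapted coordinates are those of the unit vector of index c, and c <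
      k.\<close>
    have "Q *\<^sub>v unit_vec d c \<in> W"
      using Wiff[of "Q *\<^sub>v unit_vec d c"] Q rc kd assoc_mult_mat_vec[OF Q' Q u, symmetric] QQ by simp
    then have "\<rho> g *\<^sub>v (Q *\<^sub>v unit_vec d c) \<in> W" using inv g by blast
    then have "(Q' *\<^sub>v (\<rho> g *\<^sub>v (Q *\<^sub>v unit_vec d c))) $ r = 0"
      using Wiff[of "\<rho> g *\<^sub>v (Q *\<^sub>v unit_vec d c)"] rc subspaceD(1)[OF W] by auto
    also have "Q' *\<^sub>v (\<rho> g *\<^sub>v (Q *\<^sub>v unit_vec d c)) = A g *\<^sub>v unit_vec d c"
      unfolding A_def using R(2)[OF g] Q Q' u
      by (simp add: assoc_mult_mat_vec[of _ d d _ d] assoc_mult_mat[of _ d d _ d _ d])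
    finally show ?thesis using A[OF g] rc kd mult_unit_vec[OF A[OF g], of c] by simp
  qed
  have A_sum: "A (g \<otimes>\<^bsub>G\<^esub> h) $$ (i,j)
      = (\<Sum>l<k. A g $$ (i,l) * A h $$ (l,j)) + (\<Sum>l<d-k. A g $$ (i,l+k) * A h $$ (l+k,j))"
    if g: "g \<in> carrier G" and h: "h \<in> carrier G" and ij: "i < d" "j < d" for g h i j
  proof -
    have "A (g \<otimes>\<^bsub>G\<^esub> h) $$ (i,j) = (\<Sum>l<d. A g $$ (i,l) * A h $$ (l,j))"
      unfolding A_mult[OF g h] using A[OF g] A[OF h] ij by (simp add: scalar_prod_def atLeast0LessThan)
    also have "{..<d} = {..<k} \<union> {0+k..<(d-k)+k}" using kd by auto
    also have "(\<Sum>l\<in>\<dots>. A g $$ (i,l) * A h $$ (l,j)) = (\<Sum>l<k. A g $$ (i,l) * A h $$ (l,j))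
        + (\<Sum>l=0+k..<(d-k)+k. A g $$ (i,l) * A h $$ (l,j))"
      by (subst sum.union_disjoint) auto
    finally show ?thesis unfolding sum.shift_bounds_nat_ivl by (simp add: atLeast0LessThan)
  qed
  define \<sigma> where "\<sigma> g = mat k k (\<lambda>(i,j). A g $$ (i,j))" for g
  define \<tau> where "\<tau> g = mat (d-k) (d-k) (\<lambda>(i,j). A g $$ (i+k,j+k))" for g
  have "representation G k \<sigma>"
  proof (rule representationI[OF G])
    fix g h assume g: "g \<in> carrier G" and h: "h \<in> carrier G"
    show "\<sigma> (g \<otimes>\<^bsub>G\<^esub> h) = \<sigma> g * \<sigma> h"
      by (rule eq_matI) (use kd A_zero[OF h] A_sum[OF g h] in
          \<open>auto simp: \<sigma>_def scalar_prod_def atLeast0LessThan\<close>)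
  qed (use \<open>k \<noteq> 0\<close> A_one kd in \<open>auto simp: \<sigma>_def\<close>)
  moreover have "representation G (d-k) \<tau>"
  proof (rule representationI[OF G])
    fix g h assume g: "g \<in> carrier G" and h: "h \<in> carrier G"
    show "\<tau> (g \<otimes>\<^bsub>G\<^esub> h) = \<tau> g * \<tau> h"
      by (rule eq_matI) (use kd A_zero[OF g] A_sum[OF g h] in
          \<open>auto simp: \<tau>_def scalar_prod_def atLeast0LessThan\<close>)
  qed (use kd \<open>k \<noteq> d\<close> A_one in \<open>auto simp: \<tau>_def\<close>)
  moreover have "trace (\<rho> g) = trace (\<sigma> g) + trace (\<tau> g)" if g: "g \<in> carrier G" for g
  proof -
    have "trace (\<rho> g) = (\<Sum>i<d. A g $$ (i,i))"
      using A_trace[OF g] A[OF g] by (simp add: trace_def)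
    also have "{..<d} = {..<k} \<union> {0+k..<(d-k)+k}" using kd by auto
    also have "(\<Sum>i\<in>\<dots>. A g $$ (i,i)) = (\<Sum>i<k. A g $$ (i,i)) + (\<Sum>i=0+k..<(d-k)+k. A g $$ (i,i))"
      by (subst sum.union_disjoint) auto
    finally show ?thesis unfolding sum.shift_bounds_nat_ivl
      by (simp add: atLeast0LessThan trace_def \<sigma>_def \<tau>_def)
  qed
  ultimately show thesis using that[of k "d-k" \<sigma> \<tau>] kd \<open>k \<noteq> 0\<close> \<open>k \<noteq> d\<close> by auto
qed

text \<open>Induction on the dimension by splitting off invariant subspaces. The summands form a
  list because an irreducible character can occur repeatedly.\<close>

lemma irreducible_decomposition:
  assumes G: "group G" and "representation G d \<rho>"
  shows "\<exists>\<Psi>. \<Psi> \<noteq> [] \<and> (\<forall>\<psi>\<in>set \<Psi>. irreducible_character G \<psi>) \<and>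
    (\<forall>g\<in>carrier G. trace (\<rho> g) = (\<Sum>\<psi>\<leftarrow>\<Psi>. \<psi> g))"
  using assms(2)
proof (induction d arbitrary: \<rho> rule: less_induct)
  case (less d)
  show ?case
  proof (cases "irreducible_representation G d \<rho>")
    case True
    then show ?thesis
      by (intro exI[of _ "[\<lambda>g. trace (\<rho> g)]"]) (auto simp: irreducible_character_def)
  next
    case False
    then obtain W where "VectorSpace.subspace class_ring W (module_vec TYPE(complex) d)"
      "\<forall>g\<in>carrier G. \<forall>w\<in>W. \<rho> g *\<^sub>v w \<in> W" "W \<noteq> {0\<^sub>v d}" "W \<noteq> carrier_vec d"
      using less.prems unfolding irreducible_representation_def by blast
    from invariant_subspace_split[OF G less.prems this] obtain k l \<sigma> \<tau> where
      kl: "k < d" "l < d" "representation G k \<sigma>" "representation G l \<tau>"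
      and tr: "\<forall>g\<in>carrier G. trace (\<rho> g) = trace (\<sigma> g) + trace (\<tau> g)" .
    from less.IH[OF kl(1,3)] obtain \<Psi> where \<Psi>: "\<Psi> \<noteq> []" "\<forall>\<psi>\<in>set \<Psi>. irreducible_character G \<psi>"
      "\<forall>g\<in>carrier G. trace (\<sigma> g) = (\<Sum>\<psi>\<leftarrow>\<Psi>. \<psi> g)" by blast
    from less.IH[OF kl(2,4)] obtain \<Psi>' where \<Psi>': "\<forall>\<psi>\<in>set \<Psi>'. irreducible_character G \<psi>"
      "\<forall>g\<in>carrier G. trace (\<tau> g) = (\<Sum>\<psi>\<leftarrow>\<Psi>'. \<psi> g)" by blast
    show ?thesis by (rule exI[of _ "\<Psi> @ \<Psi>'"]) (use \<Psi> \<Psi>' tr in auto)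
  qed
qed

text \<open>The empty list is excluded because representations have positive dimension, so the zero
  function is not a character.\<close>

lemma group_character_sum_list:
  assumes G: "group G" and "\<Psi> \<noteq> []" "\<forall>\<psi>\<in>set \<Psi>. irreducible_character G \<psi>"
  shows "group_character G (\<lambda>g. \<Sum>\<psi>\<leftarrow>\<Psi>. \<psi> g)"
  using assms(2,3)
proof (induction \<Psi>)
  case (Cons \<psi> \<Psi>)
  have \<psi>: "group_character G \<psi>" using Cons.prems
    by (auto simp: irreducible_character_def irreducible_representation_def group_character_def)
  show ?case
  proof (cases "\<Psi> = []")
    case True
    then show ?thesis using \<psi> by simp
  next
    case False
    then show ?thesis using group_character_add[OF G \<psi>] Cons by simp
  qed
qed simp

text \<open>Removing one occurrence of \<psi> leaves the empty list or a nonempty one; these are the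
  two alternatives in the definition of a constituent.\<close>

lemma irreducible_constituent_of_sum_list:
  assumes G: "group G" and "\<forall>\<psi>\<in>set \<Psi>. irreducible_character G \<psi>" "\<psi> \<in> set \<Psi>"
    and \<phi>: "\<forall>g\<in>carrier G. \<phi> g = (\<Sum>\<psi>\<leftarrow>\<Psi>. \<psi> g)"
  shows "irreducible_constituent G \<psi> \<phi>"
proof -
  obtain xs ys where \<Psi>: "\<Psi> = xs @ \<psi> # ys" using assms(3) by (meson split_list)
  show ?thesis
  proof (cases "xs @ ys = []")
    case True
    then show ?thesis using assms \<Psi> by (auto simp: irreducible_constituent_def)
  next
    case False
    from group_character_sum_list[OF G False] assms(2) \<Psi>
    have "group_character G (\<lambda>g. \<Sum>\<psi>\<leftarrow>xs @ ys. \<psi> g)" by auto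
    then have "group_character G (\<lambda>g. \<phi> g - \<psi> g)"
      using \<phi> \<Psi> unfolding group_character_def by auto
    then show ?thesis using assms by (auto simp: irreducible_constituent_def)
  qed
qed

section \<open>Schur orthogonality\<close>

lemma mat_eq_of_mult_unit_vec:
  fixes A B :: "'a::field mat"
  assumes "A \<in> carrier_mat n m" "B \<in> carrier_mat n m"
    and "\<And>j. j < m \<Longrightarrow> A *\<^sub>v unit_vec m j = B *\<^sub>v unit_vec m j"
  shows "A = B"
proof (rule eq_matI)
  fix i j assume "i < dim_row B" "j < dim_col B"
  then have ij: "i < n" "j < m" using assms by auto
  have "col A j = col B j"
    using assms(3)[OF ij(2)] mult_unit_vec[OF assms(1) ij(2)] mult_unit_vec[OF assms(2) ij(2)] by simp
  then have "col A j $ i = col B j $ i" by simp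
  then show "A $$ (i,j) = B $$ (i,j)" using ij assms by simp
qed (use assms in auto)

text \<open>The kernel K and the image M of X are invariant; as X is nonzero, irreducibility makes K
  trivial and M everything. Preimages of the unit vectors form a right inverse Y, and it is a left
  inverse too, since X kills \<open>Y X v - v\<close>.\<close>

theorem schur:
  assumes G: "group G" and \<rho>: "irreducible_representation G d \<rho>"
    and \<sigma>: "irreducible_representation G e \<sigma>" and X: "X \<in> carrier_mat d e" "X \<noteq> 0\<^sub>m d e"
    and XX: "\<And>g. g \<in> carrier G \<Longrightarrow> \<rho> g * X = X * \<sigma> g"
  obtains Y where "Y \<in> carrier_mat e d" "X * Y = 1\<^sub>m d" "Y * X = 1\<^sub>m e"
proof -
  have r: "representation G d \<rho>" "representation G e \<sigma>"
    using \<rho> \<sigma> by (simp_all add: irreducible_representation_def)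
  note R = representationD[OF G r(1)] and S = representationD[OF G r(2)]
  have XXv: "\<rho> g *\<^sub>v (X *\<^sub>v v) = X *\<^sub>v (\<sigma> g *\<^sub>v v)" if "g \<in> carrier G" "v \<in> carrier_vec e" for g v
    using assoc_mult_mat_vec[OF R(2)[OF that(1)] X(1) that(2)]
      assoc_mult_mat_vec[OF X(1) S(2)[OF that(1)] that(2)] XX[OF that(1)] by simp
  have X0: "X *\<^sub>v 0\<^sub>v e = 0\<^sub>v d" using X(1) by (auto simp: mult_mat_vec_def)
  obtain j where j: "j < e" "X *\<^sub>v unit_vec e j \<noteq> 0\<^sub>v d"
  proof -
    have "\<exists>j<e. X *\<^sub>v unit_vec e j \<noteq> 0\<^sub>m d e *\<^sub>v unit_vec e j"
      using mat_eq_of_mult_unit_vec[OF X(1) zero_carrier_mat] X(2) by blast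
    moreover have "0\<^sub>m d e *\<^sub>v unit_vec e j = (0\<^sub>v d :: complex vec)" for j
      by (auto simp: mult_mat_vec_def)
    ultimately show ?thesis using that by auto
  qed
  define K where "K = {v \<in> carrier_vec e. X *\<^sub>v v = 0\<^sub>v d}"
  have "VectorSpace.subspace class_ring K (module_vec TYPE(complex) e)"
    by (rule subspaceI)
      (use X0 in \<open>auto simp: K_def mult_add_distrib_mat_vec[OF X(1)] mult_mat_vec[OF X(1)]\<close>)
  moreover have "\<forall>g\<in>carrier G. \<forall>w\<in>K. \<sigma> g *\<^sub>v w \<in> K"
  proof (intro ballI)
    fix g w assume g: "g \<in> carrier G" and w: "w \<in> K"
    then have "X *\<^sub>v (\<sigma> g *\<^sub>v w) = \<rho> g *\<^sub>v 0\<^sub>v d" using XXv[OF g, of w] by (simp add: K_def)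
    also have "\<dots> = 0\<^sub>v d" using R(2)[OF g] by (auto simp: mult_mat_vec_def)
    finally show "\<sigma> g *\<^sub>v w \<in> K" using S(2)[OF g] w by (auto simp: K_def)
  qed
  moreover have "unit_vec e j \<notin> K" using j(2) by (simp add: K_def)
  then have "K \<noteq> carrier_vec e" using unit_vec_carrier[of e j] by metis
  ultimately have K: "K = {0\<^sub>v e}" using \<sigma> unfolding irreducible_representation_def by blast
  define M where "M = (\<lambda>v. X *\<^sub>v v) ` carrier_vec e"
  have "VectorSpace.subspace class_ring M (module_vec TYPE(complex) d)"
  proof (rule subspaceI)
    show "M \<subseteq> carrier_vec d" using X(1) by (auto simp: M_def)
    show "0\<^sub>v d \<in> M" unfolding M_def using X0 by (metis imageI zero_carrier_vec)
    fix v w assume "v \<in> M" "w \<in> M"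
    then obtain a b where ab: "v = X *\<^sub>v a" "a \<in> carrier_vec e" "w = X *\<^sub>v b" "b \<in> carrier_vec e"
      unfolding M_def by blast
    then have "v + w = X *\<^sub>v (a + b)" using mult_add_distrib_mat_vec[OF X(1)] by simp
    then show "v + w \<in> M" using ab by (auto simp: M_def)
  next
    fix c v assume "v \<in> M"
    then obtain a where ab: "v = X *\<^sub>v a" "a \<in> carrier_vec e" unfolding M_def by blast
    then have "c \<cdot>\<^sub>v v = X *\<^sub>v (c \<cdot>\<^sub>v a)" using mult_mat_vec[OF X(1)] by simp
    then show "c \<cdot>\<^sub>v v \<in> M" using ab by (auto simp: M_def)
  qed
  moreover have "\<forall>g\<in>carrier G. \<forall>w\<in>M. \<rho> g *\<^sub>v w \<in> M"
    using XXv S(2) by (fastforce simp: M_def)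
  moreover have "X *\<^sub>v unit_vec e j \<in> M" by (simp add: M_def)
  then have "M \<noteq> {0\<^sub>v d}" using j(2) by blast
  ultimately have M: "M = carrier_vec d" using \<rho> unfolding irreducible_representation_def by blast
  have "\<forall>i. \<exists>v. v \<in> carrier_vec e \<and> X *\<^sub>v v = unit_vec d i"
  proof
    fix i
    have "unit_vec d i \<in> M" unfolding M by simp
    then show "\<exists>v. v \<in> carrier_vec e \<and> X *\<^sub>v v = unit_vec d i" unfolding M_def by auto
  qed
  then obtain y where y: "\<And>i. y i \<in> carrier_vec e" "\<And>i. X *\<^sub>v y i = unit_vec d i" by metis
  define Y where "Y = mat e d (\<lambda>(i,j). y j $ i)"
  have Y: "Y \<in> carrier_mat e d" by (simp add: Y_def)
  have coly: "Y *\<^sub>v unit_vec d i = y i" if i: "i < d" for i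
    unfolding mult_unit_vec[OF Y i] using i y(1)[of i] by (intro eq_vecI) (auto simp: Y_def)
  have XY: "X * Y = 1\<^sub>m d"
  proof (rule mat_eq_of_mult_unit_vec)
    fix i assume i: "i < d"
    have "X * Y *\<^sub>v unit_vec d i = X *\<^sub>v (Y *\<^sub>v unit_vec d i)"
      by (rule assoc_mult_mat_vec[OF X(1) Y]) simp
    then show "X * Y *\<^sub>v unit_vec d i = 1\<^sub>m d *\<^sub>v unit_vec d i" using coly[OF i] y(2) by simp
  qed (use X(1) Y in auto)
  have "Y * X = 1\<^sub>m e"
  proof (rule mat_eq_of_mult_unit_vec)
    fix i assume i: "i < e"
    define v where "v = (unit_vec e i :: complex vec)"
    have v: "v \<in> carrier_vec e" by (simp add: v_def)
    define w where "w = Y *\<^sub>v (X *\<^sub>v v)"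
    have w: "w \<in> carrier_vec e" using X(1) Y v by (simp add: w_def)
    have "X *\<^sub>v w = X *\<^sub>v v"
    proof -
      have "X *\<^sub>v v \<in> carrier_vec d" using X(1) v by simp
      from assoc_mult_mat_vec[OF X(1) Y this] show ?thesis using XY X(1) v by (simp add: w_def)
    qed
    then have "X *\<^sub>v (w - v) = 0\<^sub>v d"
      using mult_minus_distrib_mat_vec[OF X(1) w v] X(1) v by (simp add: minus_cancel_vec[of _ d])
    then have "w - v \<in> K" using v w by (simp add: K_def)
    then have "w - v = 0\<^sub>v e" using K by simp
    then have "w = v" using v w by (simp add: vec_eq_iff)
    then show "Y * X *\<^sub>v unit_vec e i = 1\<^sub>m e *\<^sub>v unit_vec e i"
      using assoc_mult_mat_vec[OF Y X(1) v] v by (simp add: w_def v_def)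
  qed (use X(1) Y in auto)
  then show thesis using that Y XY by blast
qed

lemma schur_trace:
  assumes G: "group G" and \<rho>: "irreducible_representation G d \<rho>"
    and \<sigma>: "irreducible_representation G e \<sigma>" and X: "X \<in> carrier_mat d e" "X \<noteq> 0\<^sub>m d e"
    and XX: "\<And>g. g \<in> carrier G \<Longrightarrow> \<rho> g * X = X * \<sigma> g" and g: "g \<in> carrier G"
  shows "trace (\<rho> g) = trace (\<sigma> g)"
proof -
  obtain Y where Y: "Y \<in> carrier_mat e d" "X * Y = 1\<^sub>m d" "Y * X = 1\<^sub>m e"
    using schur[OF G \<rho> \<sigma> X XX] by blast
  have c: "\<rho> g \<in> carrier_mat d d" "\<sigma> g \<in> carrier_mat e e"
    using \<rho> \<sigma> representationD(2)[OF G _ g] by (auto simp: irreducible_representation_def)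
  have "\<rho> g = \<rho> g * X * Y" using c X Y by (simp add: assoc_mult_mat[of _ d d _ e _ d])
  also have "trace \<dots> = trace (Y * (\<rho> g * X))"
    by (rule trace_mult_comm) (use c X Y in auto)
  also have "Y * (\<rho> g * X) = Y * X * \<sigma> g"
    unfolding XX[OF g] using assoc_mult_mat[OF Y(1) X(1) c(2)] by simp
  also have "\<dots> = \<sigma> g" using Y(3) c by simp
  finally show ?thesis .
qed

text \<open>Over the complex numbers X has an eigenvalue c. The matrix X - c also commutes with the
  representation but kills an eigenvector, so it is not invertible and must vanish.\<close>

lemma schur_scalar:
  assumes G: "group G" and \<rho>: "irreducible_representation G d \<rho>" and X: "X \<in> carrier_mat d d"
    and XX: "\<And>g. g \<in> carrier G \<Longrightarrow> \<rho> g * X = X * \<rho> g"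
  obtains c where "X = c \<cdot>\<^sub>m 1\<^sub>m d"
proof -
  have r: "representation G d \<rho>" using \<rho> by (simp add: irreducible_representation_def)
  note R = representationD[OF G r]
  obtain c where "c \<in> spectrum X" using spectrum_non_empty[OF X] R(1) by blast
  then have "eigenvalue X c" by (simp add: spectrum_def)
  then obtain v where v: "v \<in> carrier_vec d" "v \<noteq> 0\<^sub>v d" "char_matrix X c *\<^sub>v v = 0\<^sub>v d"
    unfolding eigenvalue_char_matrix[OF X] by blast
  define Z where "Z = char_matrix X c"
  have Z_eq: "Z = X + (- c) \<cdot>\<^sub>m 1\<^sub>m d" using X by (simp add: Z_def char_matrix_def)
  have Z: "Z \<in> carrier_mat d d" using X by (simp add: Z_eq)
  have ZZ: "\<rho> g * Z = Z * \<rho> g" if g: "g \<in> carrier G" for g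
    unfolding Z_eq using R(2)[OF g] X XX[OF g]
    by (simp add: mult_add_distrib_mat[of _ d d _ d] add_mult_distrib_mat[of _ d d _ _ d]
        mult_smult_distrib[of _ d d _ d] mult_smult_assoc_mat[of _ d d _ d])
  have "Z = 0\<^sub>m d d"
  proof (rule ccontr)
    assume "Z \<noteq> 0\<^sub>m d d"
    from schur[OF G \<rho> \<rho> Z this ZZ] obtain Y where Y: "Y \<in> carrier_mat d d" "Y * Z = 1\<^sub>m d" by blast
    have "v = Y *\<^sub>v (Z *\<^sub>v v)" using assoc_mult_mat_vec[OF Y(1) Z v(1)] Y(2) v(1) by simp
    also have "\<dots> = 0\<^sub>v d" using v(3) Y(1) by (auto simp: Z_def mult_mat_vec_def)
    finally show False using v(2) by blast
  qed
  then have "X = c \<cdot>\<^sub>m 1\<^sub>m d"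
    using X unfolding Z_eq by (auto simp: mat_eq_iff)
  then show thesis by (rule that)
qed

text \<open>For characters of a finite group this is the usual inner product multiplied by the order
  of the group.\<close>

definition character_pairing ::
  "('g, 'b) monoid_scheme \<Rightarrow> ('g \<Rightarrow> complex) \<Rightarrow> ('g \<Rightarrow> complex) \<Rightarrow> complex" where
  "character_pairing G \<phi> \<psi> = (\<Sum>g\<in>carrier G. \<phi> g * \<psi> (inv\<^bsub>G\<^esub> g))"

text \<open>The sum over g of \<rho>(g) E \<sigma>(g^-1), where E is the d by e matrix unit at
  position (a,b): the averaging that turns an arbitrary matrix into an intertwiner.\<close>

definition average_unit :: "('g, 'b) monoid_scheme \<Rightarrow> nat \<Rightarrow> ('g \<Rightarrow> complex mat) \<Rightarrow>
    nat \<Rightarrow> ('g \<Rightarrow> complex mat) \<Rightarrow> nat \<Rightarrow> nat \<Rightarrow> complex mat" where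
  "average_unit G d \<rho> e \<sigma> a b = mat d e (\<lambda>(i,j). \<Sum>g\<in>carrier G. \<rho> g $$ (i,a) * \<sigma> (inv\<^bsub>G\<^esub> g) $$ (b,j))"

text \<open>Substituting h^-1 g for g in the sum moves h from the argument of \<rho> to that of
  \<sigma>.\<close>

lemma average_unit_intertwines:
  assumes G: "group G" and \<rho>: "representation G d \<rho>" and \<sigma>: "representation G e \<sigma>"
    and h: "h \<in> carrier G" and ab: "a < d" "b < e"
  shows "\<rho> h * average_unit G d \<rho> e \<sigma> a b = average_unit G d \<rho> e \<sigma> a b * \<sigma> h"
proof -
  interpret group G by (rule G)
  note R = representationD[OF G \<rho>] and S = representationD[OF G \<sigma>]
  have R_ent: "\<rho> (x \<otimes>\<^bsub>G\<^esub> y) $$ (i,j) = (\<Sum>k<d. \<rho> x $$ (i,k) * \<rho> y $$ (k,j))"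
    if "x \<in> carrier G" "y \<in> carrier G" "i < d" "j < d" for x y i j
    using R(2)[OF that(1)] R(2)[OF that(2)] R(3)[OF that(1,2)] that(3,4)
    by (simp add: scalar_prod_def atLeast0LessThan)
  have S_ent: "\<sigma> (x \<otimes>\<^bsub>G\<^esub> y) $$ (i,j) = (\<Sum>k<e. \<sigma> x $$ (i,k) * \<sigma> y $$ (k,j))"
    if "x \<in> carrier G" "y \<in> carrier G" "i < e" "j < e" for x y i j
    using S(2)[OF that(1)] S(2)[OF that(2)] S(3)[OF that(1,2)] that(3,4)
    by (simp add: scalar_prod_def atLeast0LessThan)
  show ?thesis
  proof (rule eq_matI)
    fix i j assume "i < dim_row (average_unit G d \<rho> e \<sigma> a b * \<sigma> h)"
      "j < dim_col (average_unit G d \<rho> e \<sigma> a b * \<sigma> h)"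
    then have i: "i < d" and j: "j < e" using S(2)[OF h] by (auto simp: average_unit_def)
    have "(\<rho> h * average_unit G d \<rho> e \<sigma> a b) $$ (i,j)
        = (\<Sum>k<d. \<rho> h $$ (i,k) * (\<Sum>g\<in>carrier G. \<rho> g $$ (k,a) * \<sigma> (inv\<^bsub>G\<^esub> g) $$ (b,j)))"
      using i j R(2)[OF h] by (simp add: average_unit_def scalar_prod_def atLeast0LessThan)
    also have "\<dots> = (\<Sum>g\<in>carrier G. \<rho> (h \<otimes>\<^bsub>G\<^esub> g) $$ (i,a) * \<sigma> (inv\<^bsub>G\<^esub> g) $$ (b,j))"
      unfolding sum_distrib_left
      by (subst sum.swap) (simp add: R_ent h i ab sum_distrib_right mult.assoc)
    also have "\<dots> = (\<Sum>g\<in>carrier G. \<rho> g $$ (i,a) * \<sigma> (inv\<^bsub>G\<^esub> g \<otimes>\<^bsub>G\<^esub> h) $$ (b,j))"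
      by (rule sum.reindex_bij_witness[of _ "\<lambda>g. inv\<^bsub>G\<^esub> h \<otimes>\<^bsub>G\<^esub> g" "\<lambda>g. h \<otimes>\<^bsub>G\<^esub> g"])
        (use h in \<open>auto simp: m_assoc[symmetric] inv_mult_group\<close>, simp add: m_assoc)
    also have "\<dots> = (\<Sum>k<e. (\<Sum>g\<in>carrier G. \<rho> g $$ (i,a) * \<sigma> (inv\<^bsub>G\<^esub> g) $$ (b,k)) * \<sigma> h $$ (k,j))"
      unfolding sum_distrib_right
      by (subst sum.swap) (simp add: S_ent h j ab sum_distrib_left mult.assoc)
    also have "\<dots> = (average_unit G d \<rho> e \<sigma> a b * \<sigma> h) $$ (i,j)"
      using i j S(2)[OF h] by (simp add: average_unit_def scalar_prod_def atLeast0LessThan)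
    finally show "(\<rho> h * average_unit G d \<rho> e \<sigma> a b) $$ (i,j)
      = (average_unit G d \<rho> e \<sigma> a b * \<sigma> h) $$ (i,j)" .
  qed (use R(2)[OF h] S(2)[OF h] in \<open>auto simp: average_unit_def\<close>)
qed

text \<open>Multiplying out the two traces expresses the pairing by single entries of averaged
  matrix units, to which Schur's lemma applies.\<close>

lemma pairing_trace:
  assumes G: "group G" and \<rho>: "representation G d \<rho>" and \<sigma>: "representation G e \<sigma>"
  shows "character_pairing G (\<lambda>g. trace (\<rho> g)) (\<lambda>g. trace (\<sigma> g))
    = (\<Sum>i<d. \<Sum>j<e. average_unit G d \<rho> e \<sigma> i j $$ (i,j))"
proof -
  note R = representationD(2)[OF G \<rho>] and S = representationD(2)[OF G \<sigma>]
  have "character_pairing G (\<lambda>g. trace (\<rho> g)) (\<lambda>g. trace (\<sigma> g))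
    = (\<Sum>g\<in>carrier G. \<Sum>i<d. \<Sum>j<e. \<rho> g $$ (i,i) * \<sigma> (inv\<^bsub>G\<^esub> g) $$ (j,j))"
    unfolding character_pairing_def
  proof (rule sum.cong[OF refl])
    fix g assume g: "g \<in> carrier G"
    with R[OF g] S[OF group.inv_closed[OF G g]]
    show "trace (\<rho> g) * trace (\<sigma> (inv\<^bsub>G\<^esub> g))
        = (\<Sum>i<d. \<Sum>j<e. \<rho> g $$ (i,i) * \<sigma> (inv\<^bsub>G\<^esub> g) $$ (j,j))"
      by (simp add: trace_def sum_product)
  qed
  also have "\<dots> = (\<Sum>i<d. \<Sum>j<e. \<Sum>g\<in>carrier G. \<rho> g $$ (i,i) * \<sigma> (inv\<^bsub>G\<^esub> g) $$ (j,j))"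
    by (subst sum.swap, subst (2) sum.swap) simp
  finally show ?thesis by (simp add: average_unit_def)
qed

lemma character_pairing_cong:
  assumes "group G" "\<And>g. g \<in> carrier G \<Longrightarrow> \<phi> g = \<phi>' g" "\<And>g. g \<in> carrier G \<Longrightarrow> \<psi> g = \<psi>' g"
  shows "character_pairing G \<phi> \<psi> = character_pairing G \<phi>' \<psi>'"
  unfolding character_pairing_def using assms by (intro sum.cong) (auto simp: group.inv_closed)

text \<open>If the characters differ, every average vanishes, since a nonzero intertwiner would make
  the traces agree. If they agree, one representation can serve on both sides, and each average is a
  scalar matrix. The case distinction is on the characters themselves, so isomorphism of
  representations need not be discussed.\<close>

lemma irreducible_character_pairing:
  assumes G: "group G" and "irreducible_character G \<phi>" "irreducible_character G \<psi>"
  shows "character_pairing G \<phi> \<psi>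
    = of_nat (if \<forall>g\<in>carrier G. \<phi> g = \<psi> g then card (carrier G) else 0)"
proof -
  from assms obtain d \<rho> e \<sigma> where \<rho>: "irreducible_representation G d \<rho>"
    and \<phi>: "\<forall>g\<in>carrier G. \<phi> g = trace (\<rho> g)"
    and \<sigma>: "irreducible_representation G e \<sigma>" and \<psi>: "\<forall>g\<in>carrier G. \<psi> g = trace (\<sigma> g)"
    unfolding irreducible_character_def by blast
  have r: "representation G d \<rho>" and s: "representation G e \<sigma>"
    using \<rho> \<sigma> by (simp_all add: irreducible_representation_def)
  note R = representationD[OF G r]
  show ?thesis
  proof (cases "\<forall>g\<in>carrier G. \<phi> g = \<psi> g")
    case False
    have "average_unit G d \<rho> e \<sigma> i j = 0\<^sub>m d e" if ij: "i < d" "j < e" for i j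
    proof (rule ccontr)
      assume "average_unit G d \<rho> e \<sigma> i j \<noteq> 0\<^sub>m d e"
      then have "trace (\<rho> g) = trace (\<sigma> g)" if "g \<in> carrier G" for g
        using schur_trace[OF G \<rho> \<sigma> _ _ average_unit_intertwines[OF G r s _ ij] that]
        by (simp add: average_unit_def)
      with False \<phi> \<psi> show False by auto
    qed
    then have "character_pairing G (\<lambda>g. trace (\<rho> g)) (\<lambda>g. trace (\<sigma> g)) = 0"
      unfolding pairing_trace[OF G r s] by simp
    moreover have "character_pairing G \<phi> \<psi>
        = character_pairing G (\<lambda>g. trace (\<rho> g)) (\<lambda>g. trace (\<sigma> g))"
      by (rule character_pairing_cong[OF G]) (use \<phi> \<psi> in auto)
    ultimately show ?thesis using False by auto
  next
    case True
    have "\<exists>c. \<forall>i j. i < d \<longrightarrow> j < d \<longrightarrow> average_unit G d \<rho> d \<rho> i j = c i j \<cdot>\<^sub>m 1\<^sub>m d"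
    proof -
      have "\<exists>c. i < d \<longrightarrow> j < d \<longrightarrow> average_unit G d \<rho> d \<rho> i j = c \<cdot>\<^sub>m 1\<^sub>m d" for i j
      proof (cases "i < d \<and> j < d")
        case True
        have "average_unit G d \<rho> d \<rho> i j \<in> carrier_mat d d" by (simp add: average_unit_def)
        then obtain c where "average_unit G d \<rho> d \<rho> i j = c \<cdot>\<^sub>m 1\<^sub>m d"
          using schur_scalar[OF G \<rho>] average_unit_intertwines[OF G r r] True by metis
        then show ?thesis by blast
      qed blast
      then show ?thesis by metis
    qed
    then obtain c where c: "\<And>i j. i < d \<Longrightarrow> j < d \<Longrightarrow> average_unit G d \<rho> d \<rho> i j = c i j \<cdot>\<^sub>m 1\<^sub>m d"
      by blast
    \<comment> \<open>The trace of the average determines the scalar: summing the diagonal entries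
      gives entry (i,i) of \<rho>(g^-1) \<rho>(g) = 1 once for each g.\<close>
    have cii: "of_nat d * c i i = of_nat (card (carrier G))" if i: "i < d" for i
    proof -
      have "of_nat d * c i i = (\<Sum>k<d. average_unit G d \<rho> d \<rho> i i $$ (k,k))"
        unfolding c[OF i i] by simp
      also have "\<dots> = (\<Sum>k<d. \<Sum>g\<in>carrier G. \<rho> g $$ (k,i) * \<rho> (inv\<^bsub>G\<^esub> g) $$ (i,k))"
        by (simp add: average_unit_def)
      also have "\<dots> = (\<Sum>g\<in>carrier G. \<Sum>k<d. \<rho> (inv\<^bsub>G\<^esub> g) $$ (i,k) * \<rho> g $$ (k,i))"
        by (subst sum.swap) (simp add: mult.commute)
      also have "\<dots> = (\<Sum>g\<in>carrier G. 1)"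
      proof (rule sum.cong[OF refl])
        fix g assume g: "g \<in> carrier G"
        then have g': "inv\<^bsub>G\<^esub> g \<in> carrier G" using G by (simp add: group.inv_closed)
        have "\<rho> (inv\<^bsub>G\<^esub> g) * \<rho> g = 1\<^sub>m d"
          using R(3)[OF g' g] R(4) group.l_inv[OF G g] by simp
        then have "(\<rho> (inv\<^bsub>G\<^esub> g) * \<rho> g) $$ (i,i) = 1" using i by simp
        then show "(\<Sum>k<d. \<rho> (inv\<^bsub>G\<^esub> g) $$ (i,k) * \<rho> g $$ (k,i)) = 1"
          using R(2)[OF g] R(2)[OF g'] i by (simp add: scalar_prod_def atLeast0LessThan)
      qed
      finally show ?thesis by simp
    qed
    have "character_pairing G \<phi> \<psi> = character_pairing G (\<lambda>g. trace (\<rho> g)) (\<lambda>g. trace (\<rho> g))"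
      by (rule character_pairing_cong[OF G]) (use \<phi> True in auto)
    \<comment> \<open>A scalar matrix has entry 0 at (i,j) for distinct i and j, so only the
      averages with equal indices contribute.\<close>
    also have "\<dots> = (\<Sum>i<d. \<Sum>j<d. if j = i then c i i else 0)"
      unfolding pairing_trace[OF G r r] by (intro sum.cong) (auto simp: c)
    also have "\<dots> = (\<Sum>i<d. of_nat (card (carrier G)) / of_nat d)"
      using cii R(1) by (intro sum.cong) (auto simp: field_simps)
    also have "\<dots> = of_nat (card (carrier G))" using R(1) by simp
    finally show ?thesis using True by simp
  qed
qed

section \<open>Disjointness and vanishing of the pairing\<close>

lemma character_pairing_sum_list:
  "character_pairing G (\<lambda>g. \<Sum>\<phi>\<leftarrow>\<Phi>. \<phi> g) (\<lambda>g. \<Sum>\<psi>\<leftarrow>\<Psi>. \<psi> g)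
    = (\<Sum>\<phi>\<leftarrow>\<Phi>. \<Sum>\<psi>\<leftarrow>\<Psi>. character_pairing G \<phi> \<psi>)"
proof -
  have right: "character_pairing G \<phi> (\<lambda>g. \<Sum>\<psi>\<leftarrow>\<Psi>. \<psi> g) = (\<Sum>\<psi>\<leftarrow>\<Psi>. character_pairing G \<phi> \<psi>)" for \<phi>
    by (induction \<Psi>) (simp_all add: character_pairing_def distrib_left sum.distrib)
  show ?thesis
    by (induction \<Phi>) (simp_all add: right[symmetric], simp_all add: character_pairing_def distrib_right sum.distrib)
qed

lemma pairing_eq_0_if_disjoint:
  assumes G: "group G" and "group_character G \<phi>" "group_character G \<psi>" "disjoint_characters G \<phi> \<psi>"
  shows "character_pairing G \<phi> \<psi> = 0"
proof -
  obtain \<Phi> where \<Phi>: "\<forall>\<chi>\<in>set \<Phi>. irreducible_character G \<chi>" "\<forall>g\<in>carrier G. \<phi> g = (\<Sum>\<chi>\<leftarrow>\<Phi>. \<chi> g)"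
    using assms(2) irreducible_decomposition[OF G] unfolding group_character_def by metis
  obtain \<Psi> where \<Psi>: "\<forall>\<chi>\<in>set \<Psi>. irreducible_character G \<chi>" "\<forall>g\<in>carrier G. \<psi> g = (\<Sum>\<chi>\<leftarrow>\<Psi>. \<chi> g)"
    using assms(3) irreducible_decomposition[OF G] unfolding group_character_def by metis
  have zero: "character_pairing G \<chi> \<chi>' = 0" if \<chi>: "\<chi> \<in> set \<Phi>" "\<chi>' \<in> set \<Psi>" for \<chi> \<chi>'
  proof -
    have "irreducible_constituent G \<chi> \<phi>" "irreducible_constituent G \<chi>' \<psi>"
      using irreducible_constituent_of_sum_list[OF G] \<Phi> \<Psi> \<chi> by blast+
    \<comment> \<open>Characters matter only on the carrier, so two list members may be different
      functions and still be the same character; being a constituent has to be transferred between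
      them.\<close>
    moreover have "irreducible_constituent G \<chi> \<psi>"
      if eq: "\<forall>g\<in>carrier G. \<chi> g = \<chi>' g" and "irreducible_constituent G \<chi>' \<psi>"
      using that \<Phi>(1) \<chi>(1) unfolding irreducible_constituent_def group_character_def by auto
    ultimately have "\<not> (\<forall>g\<in>carrier G. \<chi> g = \<chi>' g)"
      using assms(4) unfolding disjoint_characters_def by blast
    then show ?thesis using irreducible_character_pairing[OF G, of \<chi> \<chi>'] \<Phi>(1) \<Psi>(1) \<chi> by auto
  qed
  have "character_pairing G \<phi> \<psi> = (\<Sum>\<chi>\<leftarrow>\<Phi>. \<Sum>\<chi>'\<leftarrow>\<Psi>. character_pairing G \<chi> \<chi>')"
    unfolding character_pairing_sum_list[symmetric]
    by (rule character_pairing_cong[OF G]) (use \<Phi> \<Psi> in auto)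
  also have "\<dots> = (\<Sum>\<chi>\<leftarrow>\<Phi>. \<Sum>\<chi>'\<leftarrow>\<Psi>. 0)"
    using zero by (intro arg_cong[of _ _ sum_list] map_cong refl) auto
  finally show ?thesis by simp
qed

lemma irreducible_constituent_decomposition:
  assumes G: "group G" and "irreducible_constituent G \<psi> \<phi>"
  obtains \<Psi> where "\<psi> \<in> set \<Psi>" "\<forall>\<chi>\<in>set \<Psi>. irreducible_character G \<chi>"
    "\<forall>g\<in>carrier G. \<phi> g = (\<Sum>\<chi>\<leftarrow>\<Psi>. \<chi> g)"
proof (cases "\<forall>g\<in>carrier G. \<phi> g = \<psi> g")
  case True
  then show ?thesis using that[of "[\<psi>]"] assms(2) by (auto simp: irreducible_constituent_def)
next
  case False
  then obtain d \<rho> where "representation G d \<rho>" "\<forall>g\<in>carrier G. \<phi> g - \<psi> g = trace (\<rho> g)"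
    using assms(2) unfolding irreducible_constituent_def group_character_def by blast
  with irreducible_decomposition[OF G] obtain \<Psi> where
    "\<forall>\<chi>\<in>set \<Psi>. irreducible_character G \<chi>" "\<forall>g\<in>carrier G. \<phi> g - \<psi> g = (\<Sum>\<chi>\<leftarrow>\<Psi>. \<chi> g)"
    by metis
  then show ?thesis using that[of "\<psi> # \<Psi>"] assms(2)
    by (auto simp: irreducible_constituent_def algebra_simps)
qed

text \<open>A common constituent itself yields decompositions of \<phi> and \<psi> into irreducible
  characters. All terms of the pairing are then natural numbers and the term of the common
  constituent is the group order. Induced class functions can thus be inserted without constructing
  induced representations.\<close>

lemma disjoint_if_pairing_eq_0:
  assumes G: "group G" and fin: "finite (carrier G)" and zero: "character_pairing G \<phi> \<psi> = 0"
  shows "disjoint_characters G \<phi> \<psi>"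
  unfolding disjoint_characters_def
proof
  assume "\<exists>\<chi>. irreducible_constituent G \<chi> \<phi> \<and> irreducible_constituent G \<chi> \<psi>"
  then obtain \<chi> \<Phi> \<Psi> where \<Phi>: "\<chi> \<in> set \<Phi>" "\<forall>\<chi>\<in>set \<Phi>. irreducible_character G \<chi>"
      "\<forall>g\<in>carrier G. \<phi> g = (\<Sum>\<chi>\<leftarrow>\<Phi>. \<chi> g)"
    and \<Psi>: "\<chi> \<in> set \<Psi>" "\<forall>\<chi>\<in>set \<Psi>. irreducible_character G \<chi>"
      "\<forall>g\<in>carrier G. \<psi> g = (\<Sum>\<chi>\<leftarrow>\<Psi>. \<chi> g)"
    using irreducible_constituent_decomposition[OF G] by metis
  \<comment> \<open>The terms are collected as natural numbers, where a vanishing sum forces every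
    term to vanish.\<close>
  define m where "m \<chi> \<chi>' = (if \<forall>g\<in>carrier G. \<chi> g = \<chi>' g then card (carrier G) else 0)"
    for \<chi> \<chi>' :: "'a \<Rightarrow> complex"
  have "character_pairing G \<phi> \<psi> = (\<Sum>\<chi>\<leftarrow>\<Phi>. \<Sum>\<chi>'\<leftarrow>\<Psi>. character_pairing G \<chi> \<chi>')"
    unfolding character_pairing_sum_list[symmetric]
    by (rule character_pairing_cong[OF G]) (use \<Phi> \<Psi> in auto)
  also have "\<dots> = (\<Sum>\<chi>\<leftarrow>\<Phi>. \<Sum>\<chi>'\<leftarrow>\<Psi>. of_nat (m \<chi> \<chi>'))"
    using irreducible_character_pairing[OF G] \<Phi>(2) \<Psi>(2)
    by (intro arg_cong[of _ _ sum_list] map_cong refl) (simp_all add: m_def)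
  also have "\<dots> = of_nat (\<Sum>\<chi>\<leftarrow>\<Phi>. \<Sum>\<chi>'\<leftarrow>\<Psi>. m \<chi> \<chi>')"
    by (simp add: sum_list_of_nat[symmetric] o_def flip: sum_list_of_nat)
  finally have "(\<Sum>\<chi>\<leftarrow>\<Phi>. \<Sum>\<chi>'\<leftarrow>\<Psi>. m \<chi> \<chi>') = 0" using zero by (metis of_nat_eq_0_iff)
  then have "m \<chi> \<chi> = 0" using \<Phi>(1) \<Psi>(1) by (auto simp: sum_list_eq_0_iff)
  moreover have "carrier G \<noteq> {}" using monoid.one_closed[OF group.is_monoid[OF G]] by blast
  ultimately show False using fin by (simp add: m_def)
qed

section \<open>Pairing of induced characters\<close>

text \<open>Expanding both inductions gives a sum over conjugators x, y and an element g. With h = x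
  g x^-1 and z = y x^-1 the sum over g depends on x and y through z alone and is the sum of the
  hypothesis.\<close>

lemma pairing_induced_eq_0:
  fixes G (structure)
  assumes G: "group G" and fin: "finite (carrier G)" and H: "H \<subseteq> carrier G"
    and zero: "\<And>z. z \<in> carrier G \<Longrightarrow>
      (\<Sum>h\<in>H. \<phi> h * (if z \<otimes> inv h \<otimes> inv z \<in> H
                     then \<psi> (z \<otimes> inv h \<otimes> inv z) else 0)) = 0"
  shows "character_pairing G (induced_character G H \<phi>) (induced_character G H \<psi>) = 0"
proof -
  interpret group G by (rule G)
  define \<phi>0 where "\<phi>0 y = (if y \<in> H then \<phi> y else 0)" for y
  define \<psi>0 where "\<psi>0 y = (if y \<in> H then \<psi> y else 0)" for y
  have inner: "(\<Sum>g\<in>carrier G. \<phi>0 (x \<otimes> g \<otimes> inv x) * \<psi>0 (y \<otimes> inv g \<otimes> inv y)) = 0"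
    if x: "x \<in> carrier G" and y: "y \<in> carrier G" for x y
  proof -
    define z where "z = y \<otimes> inv x"
    have z: "z \<in> carrier G" using x y by (simp add: z_def)
    have "(\<Sum>g\<in>carrier G. \<phi>0 (x \<otimes> g \<otimes> inv x) * \<psi>0 (y \<otimes> inv g \<otimes> inv y))
        = (\<Sum>h\<in>carrier G. \<phi>0 h * \<psi>0 (z \<otimes> inv h \<otimes> inv z))"
    proof (rule sum.reindex_bij_witness[of _ "\<lambda>h. inv x \<otimes> h \<otimes> x" "\<lambda>g. x \<otimes> g \<otimes> inv x"])
      fix g assume g: "g \<in> carrier G"
      show "inv x \<otimes> (x \<otimes> g \<otimes> inv x) \<otimes> x = g" using x g by (simp add: m_assoc[symmetric], simp add: m_assoc)
      show "x \<otimes> g \<otimes> inv x \<in> carrier G" using x g by simp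
      have c: "inv x \<otimes> (x \<otimes> w) = w" if "w \<in> carrier G" for w
        using x that by (simp add: m_assoc[symmetric])
      have "z \<otimes> inv (x \<otimes> g \<otimes> inv x) \<otimes> inv z = y \<otimes> inv g \<otimes> inv y"
        using x y g by (simp add: z_def inv_mult_group m_assoc c)
      then show "\<phi>0 (x \<otimes> g \<otimes> inv x) * \<psi>0 (z \<otimes> inv (x \<otimes> g \<otimes> inv x) \<otimes> inv z)
        = \<phi>0 (x \<otimes> g \<otimes> inv x) * \<psi>0 (y \<otimes> inv g \<otimes> inv y)" by simp
    next
      fix h assume h: "h \<in> carrier G"
      show "x \<otimes> (inv x \<otimes> h \<otimes> x) \<otimes> inv x = h" using x h by (simp add: m_assoc[symmetric], simp add: m_assoc)
      show "inv x \<otimes> h \<otimes> x \<in> carrier G" using x h by simp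
    qed
    also have "\<dots> = (\<Sum>h\<in>H. \<phi> h * \<psi>0 (z \<otimes> inv h \<otimes> inv z))"
      using fin H by (intro sum.mono_neutral_cong_right) (auto simp: \<phi>0_def)
    also have "\<dots> = 0" using zero[OF z] by (simp add: \<psi>0_def)
    finally show ?thesis .
  qed
  have ind: "induced_character G H \<phi> g = (\<Sum>x\<in>carrier G. \<phi>0 (x \<otimes> g \<otimes> inv x)) / of_nat (card H)"
    "induced_character G H \<psi> g = (\<Sum>x\<in>carrier G. \<psi>0 (x \<otimes> g \<otimes> inv x)) / of_nat (card H)" for g
    by (simp_all add: induced_character_def \<phi>0_def \<psi>0_def Let_def)
  have "(\<Sum>g\<in>carrier G. (\<Sum>x\<in>carrier G. \<phi>0 (x \<otimes> g \<otimes> inv x)) * (\<Sum>y\<in>carrier G. \<psi>0 (y \<otimes> inv g \<otimes> inv y)))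
      = (\<Sum>x\<in>carrier G. \<Sum>y\<in>carrier G. \<Sum>g\<in>carrier G. \<phi>0 (x \<otimes> g \<otimes> inv x) * \<psi>0 (y \<otimes> inv g \<otimes> inv y))"
    unfolding sum_product by (subst sum.swap, subst (2) sum.swap) simp
  also have "\<dots> = 0" using inner by simp
  finally have *: "(\<Sum>g\<in>carrier G. (\<Sum>x\<in>carrier G. \<phi>0 (x \<otimes> g \<otimes> inv x))
      * (\<Sum>y\<in>carrier G. \<psi>0 (y \<otimes> inv g \<otimes> inv y))) = 0" .
  have "character_pairing G (induced_character G H \<phi>) (induced_character G H \<psi>)
      = (\<Sum>g\<in>carrier G. (\<Sum>x\<in>carrier G. \<phi>0 (x \<otimes> g \<otimes> inv x))
          * (\<Sum>y\<in>carrier G. \<psi>0 (y \<otimes> inv g \<otimes> inv y))) / (of_nat (card H) * of_nat (card H))"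
    unfolding character_pairing_def ind times_divide_times_eq sum_divide_distrib[symmetric] ..
  then show ?thesis unfolding * by simp
qed

section \<open>Block triangular matrices\<close>

text \<open>Here \<open>\<beta> i\<close> is the number of the block containing i. Comparing block
  numbers replaces the segments in all matrix computations.\<close>

definition block_upper :: "nat \<Rightarrow> (nat \<Rightarrow> nat) \<Rightarrow> 'a::field mat set" where
  "block_upper n \<beta> = {A \<in> carrier_mat n n. \<forall>i<n. \<forall>j<n. \<beta> j < \<beta> i \<longrightarrow> A $$ (i,j) = 0}"

definition block_strict :: "nat \<Rightarrow> (nat \<Rightarrow> nat) \<Rightarrow> 'a::field mat set" where
  "block_strict n \<beta> = {A \<in> carrier_mat n n. \<forall>i<n. \<forall>j<n. \<beta> j \<le> \<beta> i \<longrightarrow> A $$ (i,j) = 0}"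

definition block_diag :: "nat \<Rightarrow> (nat \<Rightarrow> nat) \<Rightarrow> 'a::field mat set" where
  "block_diag n \<beta> = {A \<in> carrier_mat n n. \<forall>i<n. \<forall>j<n. \<beta> i \<noteq> \<beta> j \<longrightarrow> A $$ (i,j) = 0}"

text \<open>On block upper triangular matrices this is the projection modulo the strictly upper
  ones, and there it is multiplicative.\<close>

definition diag_part :: "nat \<Rightarrow> (nat \<Rightarrow> nat) \<Rightarrow> 'a::field mat \<Rightarrow> 'a mat" where
  "diag_part n \<beta> A = mat n n (\<lambda>(i,j). if \<beta> i = \<beta> j then A $$ (i,j) else 0)"

lemma trace_add: "A \<in> carrier_mat n n \<Longrightarrow> B \<in> carrier_mat n n \<Longrightarrow> trace (A + B) = trace A + trace B"
  for A B :: "'a::field mat"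
  by (simp add: trace_def sum.distrib)

lemma trace_minus: "A \<in> carrier_mat n n \<Longrightarrow> B \<in> carrier_mat n n \<Longrightarrow> trace (A - B) = trace A - trace B"
  for A B :: "'a::field mat"
  by (simp add: trace_def sum_subtractf)

lemma trace_smult: "A \<in> carrier_mat n n \<Longrightarrow> trace (c \<cdot>\<^sub>m A) = c * trace A"
  for A :: "'a::field mat"
  by (simp add: trace_def sum_distrib_left)

lemma index_mult: "A \<in> carrier_mat n n \<Longrightarrow> B \<in> carrier_mat n n \<Longrightarrow> i < n \<Longrightarrow> j < n
    \<Longrightarrow> (A * B) $$ (i,j) = (\<Sum>k<n. A $$ (i,k) * B $$ (k,j))"
  for A B :: "'a::field mat"
  by (simp add: scalar_prod_def atLeast0LessThan)

lemma trace_mult: "A \<in> carrier_mat n n \<Longrightarrow> B \<in> carrier_mat n n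
    \<Longrightarrow> trace (A * B) = (\<Sum>i<n. \<Sum>k<n. A $$ (i,k) * B $$ (k,i))"
  for A B :: "'a::field mat"
  by (simp add: trace_def scalar_prod_def atLeast0LessThan)

text \<open>Duality for the trace form. Matrices are encoded as functions on index pairs, extended
  by 0 so that equal functions come from equal matrices.\<close>

lemma trace_annihilator:
  fixes U :: "'a::field mat set"
  assumes U: "U \<subseteq> carrier_mat n n" "U \<noteq> {}" "\<And>A B. A \<in> U \<Longrightarrow> B \<in> U \<Longrightarrow> A + B \<in> U"
    "\<And>c A. A \<in> U \<Longrightarrow> c \<cdot>\<^sub>m A \<in> U" and F: "F \<in> carrier_mat n n" "F \<notin> U"
  obtains X where "X \<in> carrier_mat n n" "\<And>A. A \<in> U \<Longrightarrow> trace (X * A) = 0" "trace (X * F) \<noteq> 0"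
proof -
  define en where "en A = (\<lambda>(i,j). if i < n \<and> j < n then A $$ (i,j) else 0)" for A :: "'a mat"
  have en_inj: "A = B" if "A \<in> carrier_mat n n" "B \<in> carrier_mat n n" "en A = en B" for A B
  proof (rule eq_matI)
    fix i j assume "i < dim_row B" "j < dim_col B"
    then show "A $$ (i,j) = B $$ (i,j)"
      using fun_cong[OF that(3), of "(i,j)"] that(1,2) by (simp add: en_def)
  qed (use that in auto)
  have en_add: "en (A + B) = (\<lambda>i. en A i + en B i)"
    if "A \<in> carrier_mat n n" "B \<in> carrier_mat n n" for A B
    using that by (auto simp: en_def)
  have en_smult: "en (c \<cdot>\<^sub>m A) = (\<lambda>i. c * en A i)" if "A \<in> carrier_mat n n" for c A
    using that by (auto simp: en_def)
  have "\<exists>x. (\<forall>u\<in>en ` U. (\<Sum>i\<in>{..<n} \<times> {..<n}. x i * u i) = 0)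
      \<and> (\<Sum>i\<in>{..<n} \<times> {..<n}. x i * en F i) \<noteq> 0"
  proof (rule annihilator_separates)
    fix u v assume "u \<in> en ` U" "v \<in> en ` U"
    then obtain A B where "A \<in> U" "B \<in> U" "u = en A" "v = en B" by blast
    moreover from this have "(\<lambda>i. u i + v i) = en (A + B)" using en_add[of A B] subsetD[OF U(1)] by simp
    ultimately show "(\<lambda>i. u i + v i) \<in> en ` U" using U(3) by simp
  next
    fix c u assume "u \<in> en ` U"
    then obtain A where "A \<in> U" "u = en A" by blast
    moreover from this have "(\<lambda>i. c * u i) = en (c \<cdot>\<^sub>m A)" using en_smult[of A c] subsetD[OF U(1)] by simp
    ultimately show "(\<lambda>i. c * u i) \<in> en ` U" using U(4) by simp
  next
    show "en F \<notin> en ` U" using en_inj F U(1) by blast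
  qed (use U(2) in \<open>auto simp: en_def split: if_splits\<close>)
  then obtain x where x: "\<And>A. A \<in> U \<Longrightarrow> (\<Sum>i\<in>{..<n} \<times> {..<n}. x i * en A i) = 0"
    "(\<Sum>i\<in>{..<n} \<times> {..<n}. x i * en F i) \<noteq> 0" by auto
  \<comment> \<open>The indices are transposed, because the trace of \<open>X * A\<close> pairs
    entry (k,i) of A with entry (i,k) of X.\<close>
  define X where "X = mat n n (\<lambda>(j,i). x (i,j))"
  have X: "X \<in> carrier_mat n n" by (simp add: X_def)
  have tr: "trace (X * A) = (\<Sum>i\<in>{..<n} \<times> {..<n}. x i * en A i)" if A: "A \<in> carrier_mat n n" for A
    unfolding trace_mult[OF X A]
    by (subst sum.swap) (auto simp: sum.cartesian_product X_def en_def intro!: sum.cong)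
  show thesis
  proof (rule that[OF X])
    show "trace (X * A) = 0" if "A \<in> U" for A
      using tr[of A] x(1)[OF that] U(1) that by auto
    show "trace (X * F) \<noteq> 0" using tr[OF F(1)] x(2) by simp
  qed
qed

locale block_structure =
  fixes n :: nat and \<beta> :: "nat \<Rightarrow> nat" and ty :: "'a::{field,finite} itself"
  assumes mono: "i \<le> j \<Longrightarrow> j < n \<Longrightarrow> \<beta> i \<le> \<beta> j"
begin

abbreviation P :: "'a mat set" where "P \<equiv> block_upper n \<beta>"
abbreviation J :: "'a mat set" where "J \<equiv> block_strict n \<beta>"
abbreviation B :: "'a mat set" where "B \<equiv> block_diag n \<beta>"
abbreviation M :: "'a mat set" where "M \<equiv> carrier_mat n n"
abbreviation \<delta> :: "'a mat \<Rightarrow> 'a mat" where "\<delta> \<equiv> diag_part n \<beta>"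

lemma P_M: "A \<in> P \<Longrightarrow> A \<in> M" and J_M: "A \<in> J \<Longrightarrow> A \<in> M" and B_M: "A \<in> B \<Longrightarrow> A \<in> M"
  by (auto simp: block_upper_def block_strict_def block_diag_def)

lemma J_P: "A \<in> J \<Longrightarrow> A \<in> P" and B_P: "A \<in> B \<Longrightarrow> A \<in> P"
  by (auto simp: block_upper_def block_strict_def block_diag_def)

lemma mult_M: "A \<in> M \<Longrightarrow> C \<in> M \<Longrightarrow> A * C \<in> M" by (rule mult_carrier_mat)

lemma P_mult: "A \<in> P \<Longrightarrow> C \<in> P \<Longrightarrow> A * C \<in> P"
  by (auto simp: block_upper_def index_mult[of _ n] simp del: index_mult_mat intro!: sum.neutral)
    (meson leI le_less_trans)

lemma PJ_mult: assumes "A \<in> P" "C \<in> J" shows "A * C \<in> J"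
proof -
  have "A $$ (i,k) * C $$ (k,j) = 0" if "i < n" "j < n" "k < n" "\<beta> j \<le> \<beta> i" for i j k
    using assms that by (cases "\<beta> k < \<beta> i") (auto simp: block_upper_def block_strict_def)
  then show ?thesis using assms
    by (auto simp: block_upper_def block_strict_def index_mult[of _ n] simp del: index_mult_mat
        intro!: sum.neutral)
qed

lemma JP_mult: assumes "A \<in> J" "C \<in> P" shows "A * C \<in> J"
proof -
  have "A $$ (i,k) * C $$ (k,j) = 0" if "i < n" "j < n" "k < n" "\<beta> j \<le> \<beta> i" for i j k
    using assms that by (cases "\<beta> k \<le> \<beta> i") (auto simp: block_upper_def block_strict_def)
  then show ?thesis using assms
    by (auto simp: block_upper_def block_strict_def index_mult[of _ n] simp del: index_mult_mat
        intro!: sum.neutral)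
qed

lemma B_mult: assumes "A \<in> B" "C \<in> B" shows "A * C \<in> B"
proof -
  have "A $$ (i,k) * C $$ (k,j) = 0" if "i < n" "j < n" "k < n" "\<beta> i \<noteq> \<beta> j" for i j k
    using assms that by (cases "\<beta> k = \<beta> i") (auto simp: block_diag_def)
  then show ?thesis using assms
    by (auto simp: block_diag_def index_mult[of _ n] simp del: index_mult_mat intro!: sum.neutral)
qed

lemma P_add: "A \<in> P \<Longrightarrow> C \<in> P \<Longrightarrow> A + C \<in> P"
  and J_add: "A \<in> J \<Longrightarrow> C \<in> J \<Longrightarrow> A + C \<in> J"
  and P_minus: "A \<in> P \<Longrightarrow> C \<in> P \<Longrightarrow> A - C \<in> P"
  and P_smult: "A \<in> P \<Longrightarrow> c \<cdot>\<^sub>m A \<in> P"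
  and J_smult: "A \<in> J \<Longrightarrow> c \<cdot>\<^sub>m A \<in> J"
  by (auto simp: block_upper_def block_strict_def block_diag_def)

lemma zero_J: "0\<^sub>m n n \<in> J" and one_B: "1\<^sub>m n \<in> B"
  by (auto simp: block_strict_def block_diag_def)

lemma diag_part_B: "\<delta> A \<in> B"
  by (auto simp: block_diag_def diag_part_def)

lemma diag_part_of_B: "A \<in> B \<Longrightarrow> \<delta> A = A"
  by (rule eq_matI) (auto simp: block_diag_def diag_part_def)

lemma diag_part_of_J: "A \<in> J \<Longrightarrow> \<delta> A = 0\<^sub>m n n"
  by (rule eq_matI) (auto simp: block_strict_def diag_part_def)

lemma minus_diag_part: "A \<in> P \<Longrightarrow> A - \<delta> A \<in> J"
  by (auto simp: block_upper_def block_strict_def diag_part_def le_less)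

lemma J_iff_diag_part: "A \<in> J \<longleftrightarrow> A \<in> P \<and> \<delta> A = 0\<^sub>m n n"
proof
  assume A: "A \<in> P \<and> \<delta> A = 0\<^sub>m n n"
  have "A $$ (i,j) = 0" if "i < n" "j < n" "\<beta> j = \<beta> i" for i j
    using arg_cong[OF conjunct2[OF A], of "\<lambda>X. X $$ (i,j)"] that by (simp add: diag_part_def)
  with A show "A \<in> J" by (auto simp: block_upper_def block_strict_def le_less)
qed (auto simp: diag_part_of_J J_P)

lemma diag_part_add: "A \<in> M \<Longrightarrow> C \<in> M \<Longrightarrow> \<delta> (A + C) = \<delta> A + \<delta> C"
  and diag_part_minus: "A \<in> M \<Longrightarrow> C \<in> M \<Longrightarrow> \<delta> (A - C) = \<delta> A - \<delta> C"
  by (auto simp: diag_part_def)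

text \<open>If i and j lie in one block, block triangularity kills the product of the entries (i,k)
  and (k,j) unless k lies in that block as well.\<close>

lemma diag_part_mult: assumes A: "A \<in> P" and C: "C \<in> P" shows "\<delta> (A * C) = \<delta> A * \<delta> C"
proof (rule eq_matI)
  fix i j assume "i < dim_row (\<delta> A * \<delta> C)" "j < dim_col (\<delta> A * \<delta> C)"
  then have i: "i < n" and j: "j < n" by (auto simp: diag_part_def)
  have "\<delta> A $$ (i,k) * \<delta> C $$ (k,j) = (if \<beta> i = \<beta> j then A $$ (i,k) * C $$ (k,j) else 0)"
    if k: "k < n" for k
  proof (cases "\<beta> i = \<beta> j")
    case True
    then show ?thesis using i j k A C
      by (cases "\<beta> k" "\<beta> i" rule: linorder_cases) (auto simp: diag_part_def block_upper_def)
  qed (use i j k in \<open>auto simp: diag_part_def\<close>)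
  then have "(\<delta> A * \<delta> C) $$ (i,j) = (\<Sum>k<n. if \<beta> i = \<beta> j then A $$ (i,k) * C $$ (k,j) else 0)"
    using index_mult[OF B_M B_M i j] diag_part_B by simp
  also have "\<dots> = \<delta> (A * C) $$ (i,j)"
    using i j index_mult[OF P_M[OF A] P_M[OF C] i j] by (simp add: diag_part_def del: index_mult_mat)
  finally show "\<delta> (A * C) $$ (i,j) = (\<delta> A * \<delta> C) $$ (i,j)" by simp
qed (auto simp: diag_part_def)

lemma trace_J: "A \<in> J \<Longrightarrow> trace A = 0"
  by (auto simp: block_strict_def trace_def)

lemma trace_JP: "A \<in> J \<Longrightarrow> C \<in> P \<Longrightarrow> trace (A * C) = 0"
  and trace_PJ: "C \<in> P \<Longrightarrow> A \<in> J \<Longrightarrow> trace (C * A) = 0"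
  by (auto intro: trace_J JP_mult PJ_mult)

text \<open>P and J are orthogonal complements under the trace form: P J lies in J, where traces
  vanish, and pairing with a matrix unit of J reads off one entry of A below the diagonal
  blocks.\<close>

lemma P_iff_annihilates_J: assumes A: "A \<in> M" shows "A \<in> P \<longleftrightarrow> (\<forall>y\<in>J. trace (A * y) = 0)"
proof
  assume ann: "\<forall>y\<in>J. trace (A * y) = 0"
  have "A $$ (j,i) = 0" if ij: "i < n" "j < n" "\<beta> i < \<beta> j" for i j
  proof -
    define E where "E = mat n n (\<lambda>(r,c). if r = i \<and> c = j then 1 else (0::'a))"
    have E: "E \<in> J" using ij by (auto simp: E_def block_strict_def)
    have "0 = trace (A * E)" using ann E by simp
    also have "\<dots> = (\<Sum>c<n. \<Sum>r<n. if r = i then (if c = j then A $$ (c,r) else 0) else 0)"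
      unfolding trace_mult[OF A J_M[OF E]] by (intro sum.cong) (auto simp: E_def)
    also have "\<dots> = A $$ (j,i)" using ij by simp
    finally show ?thesis by simp
  qed
  with A show "A \<in> P" by (auto simp: block_upper_def)
qed (auto intro: trace_PJ)

lemma J_iff_annihilates_P: assumes A: "A \<in> M" shows "A \<in> J \<longleftrightarrow> (\<forall>y\<in>P. trace (A * y) = 0)"
proof
  assume ann: "\<forall>y\<in>P. trace (A * y) = 0"
  have "A $$ (j,i) = 0" if ij: "i < n" "j < n" "\<beta> i \<le> \<beta> j" for i j
  proof -
    define E where "E = mat n n (\<lambda>(r,c). if r = i \<and> c = j then 1 else (0::'a))"
    have E: "E \<in> P" using ij by (auto simp: E_def block_upper_def)
    have "0 = trace (A * E)" using ann E by simp
    also have "\<dots> = (\<Sum>c<n. \<Sum>r<n. if r = i then (if c = j then A $$ (c,r) else 0) else 0)"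
      unfolding trace_mult[OF A P_M[OF E]] by (intro sum.cong) (auto simp: E_def)
    also have "\<dots> = A $$ (j,i)" using ij by simp
    finally show ?thesis by simp
  qed
  with A show "A \<in> J" by (auto simp: block_strict_def)
qed (auto intro: trace_JP)

section \<open>Finiteness and closure under inverses\<close>

lemma finite_M: "finite M"
proof -
  have "M \<subseteq> (\<lambda>f. mat n n f) ` (({..<n} \<times> {..<n}) \<rightarrow>\<^sub>E (UNIV :: 'a set))"
  proof
    fix A assume A: "A \<in> M"
    then have "mat n n (restrict (\<lambda>(i,j). A $$ (i,j)) ({..<n} \<times> {..<n})) = A" by auto
    then show "A \<in> (\<lambda>f. mat n n f) ` (({..<n} \<times> {..<n}) \<rightarrow>\<^sub>E (UNIV :: 'a set))"
      by (metis PiE_UNIV_domain PiE_restrict Pi_I UNIV_I image_eqI restrict_PiE_iff)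
  qed
  then show ?thesis by (rule finite_subset) (intro finite_imageI finite_PiE, auto)
qed

lemma left_cancel: assumes "A \<in> M" "C \<in> M" "X \<in> M" "Y \<in> M" "C * A = 1\<^sub>m n" "A * X = A * Y" shows "X = Y"
  using assms assoc_mult_mat[of C n n A n X n] assoc_mult_mat[of C n n A n Y n] by simp

text \<open>Left multiplication by an invertible matrix permutes every finite set that it preserves,
  and hence the inverse stays in a set that contains 1.\<close>

lemma inverse_closed:
  assumes S: "S \<subseteq> M" "1\<^sub>m n \<in> S" "\<And>X. X \<in> S \<Longrightarrow> A * X \<in> S" and A: "A \<in> M"
    and C: "C \<in> M" "A * C = 1\<^sub>m n"
  shows "C \<in> S"
proof -
  have CA: "C * A = 1\<^sub>m n" by (rule mat_mult_left_right_inverse[OF A C])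
  have "inj_on (\<lambda>X. A * X) S"
    using left_cancel[OF A C(1) _ _ CA] S(1) by (auto intro!: inj_onI)
  moreover have "(\<lambda>X. A * X) ` S \<subseteq> S" using S(3) by blast
  moreover have "finite S" using S(1) finite_M by (rule finite_subset)
  ultimately have "(\<lambda>X. A * X) ` S = S" by (simp add: endo_inj_surj)
  with S(2) obtain X where X: "X \<in> S" "1\<^sub>m n = A * X" by blast
  then have "X = C" using left_cancel[OF A C(1) _ C(1) CA] S(1) C(2) by auto
  with X show ?thesis by simp
qed

lemma P_inverse: "A \<in> P \<Longrightarrow> C \<in> M \<Longrightarrow> A * C = 1\<^sub>m n \<Longrightarrow> C \<in> P"
  by (rule inverse_closed[of P A]) (auto intro: P_mult B_P one_B dest: P_M)

lemma B_inverse: "A \<in> B \<Longrightarrow> C \<in> M \<Longrightarrow> A * C = 1\<^sub>m n \<Longrightarrow> C \<in> B"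
  by (rule inverse_closed[of B A]) (auto intro: B_mult one_B dest: B_M)

text \<open>As \<beta> is nondecreasing, u is strictly upper triangular in the ordinary sense, so 1
  + u has determinant 1. Multiplicativity of the diagonal part then determines that of the
  inverse.\<close>

lemma unipotent_inverse:
  assumes u: "u \<in> J"
  obtains w where "w \<in> P" "(1\<^sub>m n + u) * w = 1\<^sub>m n" "w * (1\<^sub>m n + u) = 1\<^sub>m n" "\<delta> w = 1\<^sub>m n"
proof -
  have uM: "u \<in> M" by (rule J_M[OF u])
  have k: "1\<^sub>m n + u \<in> P" using u one_B by (auto intro: P_add J_P B_P)
  have zero: "u $$ (i,j) = 0" if "i < n" "j \<le> i" for i j
    using u mono[OF that(2,1)] that by (auto simp: block_strict_def)
  have "det (1\<^sub>m n + u) = prod_list (diag_mat (1\<^sub>m n + u))"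
    by (rule det_upper_triangular) (use uM zero in \<open>auto simp: upper_triangular_def\<close>)
  also have "\<dots> = (\<Prod>i=0..<n. 1)"
    unfolding prod_list_diag_prod using uM zero by (intro prod.cong) auto
  finally have "det (1\<^sub>m n + u) \<noteq> 0" by simp
  then have "1\<^sub>m n + u \<in> Units (ring_mat TYPE('a) n ())"
    by (rule det_non_zero_imp_unit[OF P_M[OF k]])
  then obtain w where w: "w \<in> M" "(1\<^sub>m n + u) * w = 1\<^sub>m n" "w * (1\<^sub>m n + u) = 1\<^sub>m n"
    by (auto simp: Units_def ring_mat_simps)
  have wP: "w \<in> P" by (rule P_inverse[OF k w(1,2)])
  have "\<delta> (1\<^sub>m n + u) = 1\<^sub>m n"
    using uM u one_B by (simp add: diag_part_add diag_part_of_B diag_part_of_J)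
  then have "\<delta> w = \<delta> (w * (1\<^sub>m n + u))"
    unfolding diag_part_mult[OF wP k] using B_M[OF diag_part_B, of w] by simp
  then have "\<delta> w = 1\<^sub>m n" unfolding w(3) using one_B by (simp add: diag_part_of_B)
  with that wP w show thesis by blast
qed

end

section \<open>Functionals supported on block-rooks\<close>

context block_structure
begin

lemmas M_simps = mult_M assoc_mult_mat[of _ n n _ n _ n]
  add_mult_distrib_mat[of _ n n _ _ n] mult_add_distrib_mat[of _ n n _ n]
  minus_mult_distrib_mat[of _ n n _ _ n] mult_minus_distrib_mat[of _ n n _ n]

lemma cancel_left: "A \<in> M \<Longrightarrow> C \<in> M \<Longrightarrow> X \<in> M \<Longrightarrow> A * C = 1\<^sub>m n \<Longrightarrow> A * (C * X) = X"
  by (simp add: assoc_mult_mat[of A n n C n X n, symmetric])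

end

text \<open>\<open>L\<close> represents the functional \<open>x \<mapsto> trace (L * x)\<close> on \<open>J\<close>. The assumptions
  \<open>row_block\<close> and \<open>col_block\<close> say that the nonzero entries of each row and of each column of \<open>L\<close>
  lie in a single block, because each row and each column meets at most one block-rook.\<close>

locale block_functional = block_structure n \<beta> ty
  for n \<beta> and ty :: "'a::{field,finite} itself" +
  fixes L :: "'a mat"
  assumes L_M: "L \<in> carrier_mat n n"
    and lower: "\<And>i j. i < n \<Longrightarrow> j < n \<Longrightarrow> L $$ (i,j) \<noteq> 0 \<Longrightarrow> \<beta> j < \<beta> i"
    and row_block: "\<And>i j j'. i < n \<Longrightarrow> j < n \<Longrightarrow> j' < n \<Longrightarrow>
      L $$ (i,j) \<noteq> 0 \<Longrightarrow> L $$ (i,j') \<noteq> 0 \<Longrightarrow> \<beta> j = \<beta> j'"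
    and col_block: "\<And>i i' j. i < n \<Longrightarrow> i' < n \<Longrightarrow> j < n \<Longrightarrow>
      L $$ (i,j) \<noteq> 0 \<Longrightarrow> L $$ (i',j) \<noteq> 0 \<Longrightarrow> \<beta> i = \<beta> i'"
begin

definition Jr :: "'a mat set" where "Jr = {x \<in> J. L * x \<in> P}"

text \<open>Invertibility is imposed only in \<open>RC\<close>; the matrix identities below use just
  these equations.\<close>

definition Rc :: "'a mat set" where "Rc = {r \<in> B. L * r = L \<and> r * L = L}"

lemma Jr_iff: "x \<in> Jr \<longleftrightarrow> x \<in> J \<and> (\<forall>y\<in>J. trace (L * (x * y)) = 0)"
proof (cases "x \<in> J")
  case True
  then have "x \<in> M" by (rule J_M)
  then have "L * x \<in> P \<longleftrightarrow> (\<forall>y\<in>J. trace (L * x * y) = 0)"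
    by (intro P_iff_annihilates_J mult_M L_M)
  then show ?thesis using True \<open>x \<in> M\<close> L_M J_M by (simp add: Jr_def M_simps)
qed (simp add: Jr_def)

lemma entries_zero_sum:
  assumes "A \<in> M" "C \<in> M" "i < n" "j < n" "(A * C) $$ (i,j) \<noteq> 0"
  obtains k where "k < n" "A $$ (i,k) \<noteq> 0" "C $$ (k,j) \<noteq> 0"
proof -
  have "(\<Sum>k<n. A $$ (i,k) * C $$ (k,j)) \<noteq> 0"
    using assms(5) unfolding index_mult[OF assms(1-4)] .
  then obtain k where "k \<in> {..<n}" "A $$ (i,k) * C $$ (k,j) \<noteq> 0" by (rule sum.not_neutral_contains_not_neutral)
  with that show thesis by auto
qed

text \<open>In \<open>L * A\<close> the contributions of the diagonal part of \<open>A\<close> and of the rest lie in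
  different blocks of each row, so they cannot cancel.\<close>

lemma diag_part_right_annihilator:
  assumes A: "A \<in> P" and LA: "L * A \<in> P"
  shows "L * \<delta> A = 0\<^sub>m n n"
proof (rule ccontr)
  define N where "N = A - \<delta> A"
  have N: "N \<in> J" unfolding N_def by (rule minus_diag_part[OF A])
  have c: "A \<in> M" "\<delta> A \<in> M" "N \<in> M" using A N B_M[OF diag_part_B] by (auto dest: P_M J_M)
  have AN: "A = \<delta> A + N" using c by (auto simp: N_def)
  assume "L * \<delta> A \<noteq> 0\<^sub>m n n"
  then obtain i j where ij: "i < n" "j < n" "(L * \<delta> A) $$ (i,j) \<noteq> 0"
    using L_M c by (auto simp: mat_eq_iff simp del: index_mult_mat(1))
  then obtain k where k: "k < n" "L $$ (i,k) \<noteq> 0" "\<delta> A $$ (k,j) \<noteq> 0"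
    using entries_zero_sum[OF L_M c(2)] by blast
  then have kj: "\<beta> k = \<beta> j" using diag_part_B[of A] ij by (auto simp: block_diag_def)
  have "(L * A) $$ (i,j) = (L * \<delta> A + L * N) $$ (i,j)"
    using AN mult_add_distrib_mat[OF L_M c(2,3)] by simp
  also have "\<dots> = (L * \<delta> A) $$ (i,j) + (L * N) $$ (i,j)"
    using L_M c ij by (simp del: index_mult_mat(1))
  finally have "(L * A) $$ (i,j) = (L * \<delta> A) $$ (i,j) + (L * N) $$ (i,j)" .
  \<comment> \<open>The nonzero entry of L at (i,k) gives \<beta> j = \<beta> k < \<beta> i, a
    position where a block upper triangular matrix vanishes.\<close>
  moreover have "(L * A) $$ (i,j) = 0"
    using LA ij lower[OF ij(1) k(1,2)] kj by (auto simp: block_upper_def)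
  ultimately have "(L * N) $$ (i,j) \<noteq> 0" using ij(3) by auto
  then obtain l where l: "l < n" "L $$ (i,l) \<noteq> 0" "N $$ (l,j) \<noteq> 0"
    using entries_zero_sum[OF L_M c(3) ij(1,2)] by blast
  then have "\<beta> l < \<beta> j" using N ij by (auto simp: block_strict_def not_le[symmetric])
  moreover have "\<beta> l = \<beta> k" using row_block ij k l by blast
  ultimately show False using kj by simp
qed

text \<open>The same absence of cancellation, read along columns: the nonzero entries of a column of
  L lie in one block of rows.\<close>

lemma diag_part_left_annihilator:
  assumes A: "A \<in> P" and AL: "A * L \<in> P"
  shows "\<delta> A * L = 0\<^sub>m n n"
proof (rule ccontr)
  define N where "N = A - \<delta> A"
  have N: "N \<in> J" unfolding N_def by (rule minus_diag_part[OF A])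
  have c: "A \<in> M" "\<delta> A \<in> M" "N \<in> M" using A N B_M[OF diag_part_B] by (auto dest: P_M J_M)
  have AN: "A = \<delta> A + N" using c by (auto simp: N_def)
  assume "\<delta> A * L \<noteq> 0\<^sub>m n n"
  then obtain i j where ij: "i < n" "j < n" "(\<delta> A * L) $$ (i,j) \<noteq> 0"
    using L_M c by (auto simp: mat_eq_iff simp del: index_mult_mat(1))
  then obtain k where k: "k < n" "\<delta> A $$ (i,k) \<noteq> 0" "L $$ (k,j) \<noteq> 0"
    using entries_zero_sum[OF c(2) L_M] by blast
  then have "\<beta> i = \<beta> k" using diag_part_B[of A] ij by (auto simp: block_diag_def)
  then have ki: "\<beta> k = \<beta> i" by simp
  have "(A * L) $$ (i,j) = (\<delta> A * L + N * L) $$ (i,j)"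
    using AN add_mult_distrib_mat[OF c(2,3) L_M] by simp
  also have "\<dots> = (\<delta> A * L) $$ (i,j) + (N * L) $$ (i,j)"
    using L_M c ij by (simp del: index_mult_mat(1))
  finally have "(A * L) $$ (i,j) = (\<delta> A * L) $$ (i,j) + (N * L) $$ (i,j)" .
  moreover have "(A * L) $$ (i,j) = 0"
    using AL ij lower[OF k(1) ij(2) k(3)] ki by (auto simp: block_upper_def)
  ultimately have "(N * L) $$ (i,j) \<noteq> 0" using ij(3) by auto
  then obtain l where l: "l < n" "N $$ (i,l) \<noteq> 0" "L $$ (l,j) \<noteq> 0"
    using entries_zero_sum[OF c(3) L_M ij(1,2)] by blast
  then have "\<beta> i < \<beta> l" using N ij by (auto simp: block_strict_def not_le[symmetric])
  moreover have "\<beta> l = \<beta> k" using col_block ij k l by blast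
  ultimately show False using ki by simp
qed

text \<open>For invertible z and h = z this says that z fixes the functional on all of J, since
  matrices modulo P are the functionals on J. Letting h differ from z by a strictly upper part
  weakens this to fixing its restriction to \<open>Jr\<close>.\<close>

definition twist :: "'a mat \<Rightarrow> 'a mat \<Rightarrow> bool" where
  "twist z h \<longleftrightarrow> L * z - h * L \<in> P \<and> \<delta> h = \<delta> z"

text \<open>A matrix X orthogonal to P, to J L and to J L z lies in \<open>Jr\<close> together with
  its conjugate by z. By compatibility X is then orthogonal to z^-1 L z - L, so duality places this
  matrix in the sum U of the three spaces.\<close>

lemma coadjoint_decomposition:
  assumes z: "z \<in> P" "z' \<in> P" "z * z' = 1\<^sub>m n" "z' * z = 1\<^sub>m n"
    and compat: "\<And>x. x \<in> Jr \<Longrightarrow> z * x * z' \<in> Jr \<Longrightarrow> trace (L * (z * x * z')) = trace (L * x)"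
  obtains p u v where "p \<in> P" "u \<in> J" "v \<in> J" "z' * L * z - L = p + u * L + v * L * z"
proof -
  note cz = P_M[OF z(1)] P_M[OF z(2)]
  define U where "U = {p + u * L + v * L * z | p u v. p \<in> P \<and> u \<in> J \<and> v \<in> J}"
  define F where "F = z' * L * z - L"
  have F: "F \<in> M" unfolding F_def by (intro minus_carrier_mat L_M)
  have zero_P: "0\<^sub>m n n \<in> P" by (rule J_P[OF zero_J])
  have U_intro: "X \<in> U" if "X = p + u * L + v * L * z" "p \<in> P" "u \<in> J" "v \<in> J" for X p u v
    using that unfolding U_def by blast
  have "F \<in> U"
  proof (rule ccontr)
    assume "F \<notin> U"
    moreover have "U \<subseteq> M" using cz L_M by (auto simp: U_def dest!: P_M J_M intro!: add_carrier_mat mult_M)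
    moreover have "U \<noteq> {}" using zero_P zero_J by (auto simp: U_def)
    moreover have "A + C \<in> U" if AC: "A \<in> U" "C \<in> U" for A C
    proof -
      obtain p u v where A: "A = p + u * L + v * L * z" "p \<in> P" "u \<in> J" "v \<in> J"
        using AC(1) unfolding U_def by blast
      obtain q s t where C: "C = q + s * L + t * L * z" "q \<in> P" "s \<in> J" "t \<in> J"
        using AC(2) unfolding U_def by blast
      have c: "p \<in> M" "u \<in> M" "v \<in> M" "q \<in> M" "s \<in> M" "t \<in> M" using A C by (auto dest: P_M J_M)
      have c': "p \<in> M" "u * L \<in> M" "v * L * z \<in> M" "q \<in> M" "s * L \<in> M" "t * L * z \<in> M"
        using c cz L_M by (auto intro: mult_M)
      have d: "(u + s) * L = u * L + s * L" "(v + t) * L * z = v * L * z + t * L * z"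
        using c cz L_M by (simp_all add: add_mult_distrib_mat[of _ n n _ _ n] mult_M)
      have "A + C = (p + q) + (u + s) * L + (v + t) * L * z"
        unfolding A(1) C(1) d using c c' cz L_M by (auto simp: mat_eq_iff simp del: index_mult_mat(1))
      then show ?thesis by (rule U_intro) (use A C in \<open>auto intro: P_add J_add\<close>)
    qed
    moreover have "c \<cdot>\<^sub>m A \<in> U" if A: "A \<in> U" for c A
    proof -
      obtain p u v where A: "A = p + u * L + v * L * z" "p \<in> P" "u \<in> J" "v \<in> J"
        using A unfolding U_def by blast
      have c: "p \<in> M" "u \<in> M" "v \<in> M" using A by (auto dest: P_M J_M)
      have c': "p \<in> M" "u * L \<in> M" "v * L * z \<in> M"
        using c cz L_M by (auto intro: mult_M)
      have d: "(c \<cdot>\<^sub>m u) * L = c \<cdot>\<^sub>m (u * L)" "(c \<cdot>\<^sub>m v) * L * z = c \<cdot>\<^sub>m (v * L * z)"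
        using c cz L_M by (simp_all add: mult_smult_assoc_mat[of _ n n _ n] mult_M)
      have "c \<cdot>\<^sub>m A = c \<cdot>\<^sub>m p + (c \<cdot>\<^sub>m u) * L + (c \<cdot>\<^sub>m v) * L * z"
        unfolding A(1) d using c c' cz L_M by (auto simp: mat_eq_iff distrib_left simp del: index_mult_mat(1))
      then show ?thesis by (rule U_intro) (use A in \<open>auto intro: P_smult J_smult\<close>)
    qed
    ultimately obtain X where X: "X \<in> M" "\<And>A. A \<in> U \<Longrightarrow> trace (X * A) = 0" "trace (X * F) \<noteq> 0"
      using trace_annihilator[OF _ _ _ _ F] by metis
    have zeros: "0\<^sub>m n n * L = 0\<^sub>m n n" "0\<^sub>m n n * L * z = 0\<^sub>m n n"
      using cz L_M by simp_all
    have "trace (X * p) = 0" if p: "p \<in> P" for p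
    proof -
      have "p \<in> U" by (rule U_intro[OF _ p zero_J zero_J]) (use P_M[OF p] zeros in simp)
      then show ?thesis by (rule X(2))
    qed
    then have XJ: "X \<in> J" using J_iff_annihilates_P[OF X(1)] by blast
    \<comment> \<open>By cyclicity, orthogonality to J L says that \<open>L * X\<close> annihilates
      J, hence lies in P.\<close>
    have "trace (L * X * u) = 0" if u: "u \<in> J" for u
    proof -
      have uL: "u * L \<in> M" using J_M[OF u] L_M by (rule mult_M)
      have "u * L \<in> U" by (rule U_intro[OF _ zero_P u zero_J]) (use uL zeros in simp)
      then have "0 = trace (X * (u * L))" using X(2) by simp
      also have "\<dots> = trace (X * u * L)" using X(1) J_M[OF u] L_M by (simp add: M_simps)
      also have "\<dots> = trace (L * (X * u))"
        by (rule trace_mult_comm) (use X(1) J_M[OF u] L_M in \<open>auto intro: mult_M\<close>)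
      also have "\<dots> = trace (L * X * u)" using X(1) J_M[OF u] L_M by (simp add: M_simps)
      finally show ?thesis by simp
    qed
    then have "L * X \<in> P" using P_iff_annihilates_J[of "L * X"] X(1) L_M by (auto intro: mult_M)
    then have XJr: "X \<in> Jr" using XJ by (simp add: Jr_def)
    \<comment> \<open>Orthogonality to J L z puts \<open>L * z * X\<close> into P; multiplying by
      z^-1 on the right gives the condition for the conjugate of X.\<close>
    have "trace (L * z * X * v) = 0" if v: "v \<in> J" for v
    proof -
      have vL: "v * L * z \<in> M" using J_M[OF v] L_M cz by (auto intro: mult_M)
      have "v * L * z \<in> U" by (rule U_intro[OF _ zero_P zero_J v]) (use vL zeros in simp)
      then have "0 = trace (X * (v * L * z))" using X(2) by simp
      also have "\<dots> = trace (X * v * (L * z))" using X(1) J_M[OF v] L_M cz by (simp add: M_simps)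
      also have "\<dots> = trace (L * z * (X * v))"
        by (rule trace_mult_comm) (use X(1) J_M[OF v] L_M cz in \<open>auto intro: mult_M\<close>)
      also have "\<dots> = trace (L * z * X * v)" using X(1) J_M[OF v] L_M cz by (simp add: M_simps)
      finally show ?thesis by simp
    qed
    then have "L * z * X \<in> P" using P_iff_annihilates_J[of "L * z * X"] X(1) L_M cz by (auto intro: mult_M)
    then have "L * z * X * z' \<in> P" using z(2) by (rule P_mult)
    then have "L * (z * X * z') \<in> P" using X(1) L_M cz by (simp add: M_simps)
    moreover have "z * X * z' \<in> J" using z XJ by (auto intro: PJ_mult JP_mult)
    ultimately have "z * X * z' \<in> Jr" by (simp add: Jr_def)
    from compat[OF XJr this] have 1: "trace (L * (z * X * z')) = trace (L * X)" .
    have "trace (X * (z' * L * z)) = trace (X * z' * (L * z))"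
      using X(1) L_M cz by (simp add: M_simps)
    also have "\<dots> = trace (L * z * (X * z'))"
      by (rule trace_mult_comm) (use X(1) L_M cz in \<open>auto intro: mult_M\<close>)
    also have "\<dots> = trace (L * (z * X * z'))" using X(1) L_M cz by (simp add: M_simps)
    finally have "trace (X * (z' * L * z)) = trace (X * L)"
      using 1 trace_mult_comm[OF X(1) L_M] by simp
    moreover have "X * F = X * (z' * L * z) - X * L"
      unfolding F_def using X(1) L_M cz by (intro mult_minus_distrib_mat[of _ n n _ n] mult_M)
    ultimately have "trace (X * F) = 0"
      using X(1) L_M cz by (simp add: trace_minus[of _ n] mult_M)
    with X(3) show False by simp
  qed
  then show thesis using that unfolding U_def F_def by blast
qed

text \<open>The decomposition reads (z^-1 - v) L z = (1 + u) L + p, and z^-1 - v = z^-1 (1 - z v).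
  Multiplying by m z, with m the inverse of 1 - z v, gives L z = h L + m z p for h = m z (1 + u).
  Both m and 1 + u have diagonal part 1, so h has that of z.\<close>

lemma twist_if_compatible:
  assumes z: "z \<in> P" "z' \<in> P" "z * z' = 1\<^sub>m n" "z' * z = 1\<^sub>m n"
    and compat: "\<And>x. x \<in> Jr \<Longrightarrow> z * x * z' \<in> Jr \<Longrightarrow> trace (L * (z * x * z')) = trace (L * x)"
  obtains h h' where "h \<in> P" "h' \<in> P" "h * h' = 1\<^sub>m n" "h' * h = 1\<^sub>m n" "twist z h"
proof -
  note cz = P_M[OF z(1)] P_M[OF z(2)]
  obtain p u v where puv: "p \<in> P" "u \<in> J" "v \<in> J" "z' * L * z - L = p + u * L + v * L * z"
    using coadjoint_decomposition[OF z compat] by blast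
  note c = P_M[OF puv(1)] J_M[OF puv(2)] J_M[OF puv(3)] L_M cz
  obtain k where k: "k \<in> P" "(1\<^sub>m n + u) * k = 1\<^sub>m n" "k * (1\<^sub>m n + u) = 1\<^sub>m n" "\<delta> k = 1\<^sub>m n"
    using unipotent_inverse[OF puv(2)] by blast
  have zv: "- 1 \<cdot>\<^sub>m (z * v) \<in> J" using PJ_mult[OF z(1) puv(3)] by (rule J_smult)
  obtain m where m: "m \<in> P" "(1\<^sub>m n + - 1 \<cdot>\<^sub>m (z * v)) * m = 1\<^sub>m n"
    "m * (1\<^sub>m n + - 1 \<cdot>\<^sub>m (z * v)) = 1\<^sub>m n" "\<delta> m = 1\<^sub>m n"
    using unipotent_inverse[OF zv] by blast
  have one_P: "1\<^sub>m n \<in> P" by (rule B_P[OF one_B])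
  define K where "K = 1\<^sub>m n + u"
  define W where "W = 1\<^sub>m n + - 1 \<cdot>\<^sub>m (z * v)"
  have KP: "K \<in> P" and WP: "W \<in> P"
    unfolding K_def W_def using one_P puv zv by (auto intro: P_add J_P)
  note cc = c P_M[OF k(1)] P_M[OF m(1)] P_M[OF KP] P_M[OF WP]
  have kK: "K * k = 1\<^sub>m n" "k * K = 1\<^sub>m n" and mW: "W * m = 1\<^sub>m n" "m * W = 1\<^sub>m n"
    using k m by (simp_all add: K_def W_def)
  have dK: "\<delta> K = 1\<^sub>m n" unfolding K_def
    using cc puv one_B by (simp add: diag_part_add diag_part_of_B diag_part_of_J)
  define h where "h = m * (z * K)"
  define h' where "h' = k * (z' * W)"
  \<comment> \<open>This is the reason for placing z v rather than v in W: the factor z^-1 comes out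
    on the left.\<close>
  have "z' * W = z' - v"
  proof -
    have "z' * W = z' + - 1 \<cdot>\<^sub>m (z' * (z * v))" unfolding W_def
      using cc by (simp add: M_simps mult_smult_distrib[of _ n n _ n])
    also have "z' * (z * v) = v" using cancel_left[of z' z v] cc z by simp
    also have "z' + - 1 \<cdot>\<^sub>m v = z' - v" using cc by auto
    finally show ?thesis .
  qed
  then have eq: "z' * W * L * z - K * L = p"
  proof -
    have "z' * W * L * z = z' * L * z - v * L * z"
      unfolding \<open>z' * W = z' - v\<close> using cc by (simp add: M_simps)
    moreover have "K * L = L + u * L" unfolding K_def using cc by (simp add: M_simps)
    moreover have "z' * L * z = (p + u * L + v * L * z) + L"
    proof -
      have "z' * L * z = (z' * L * z - L) + L"
        using cc by (auto simp: mat_eq_iff mult_M simp del: index_mult_mat(1))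
      then show ?thesis unfolding puv(4) .
    qed
    ultimately show ?thesis
      using cc by (auto simp: mat_eq_iff mult_M simp del: index_mult_mat(1))
  qed
  have hP: "h \<in> P" "h' \<in> P" unfolding h_def h'_def using z k(1) m(1) KP WP by (auto intro: P_mult)
  have "h * h' = m * (z * (K * (k * (z' * W))))"
    unfolding h_def h'_def using cc by (simp add: M_simps)
  also have "\<dots> = m * (z * (z' * W))" using cancel_left[of K k] kK cc by (simp add: mult_M)
  also have "\<dots> = 1\<^sub>m n" using cancel_left[of z z'] z mW cc by simp
  finally have hh: "h * h' = 1\<^sub>m n" .
  have hh': "h' * h = 1\<^sub>m n"
    by (rule mat_mult_left_right_inverse[OF P_M[OF hP(1)] P_M[OF hP(2)] hh])
  have "L * z - h * L = m * z * p"
  proof -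
    have "m * z * p = m * (z * (z' * (W * (L * z)))) - m * (z * (K * L))"
      unfolding eq[symmetric] using cc by (simp add: M_simps)
    also have "z * (z' * (W * (L * z))) = W * (L * z)"
      using cancel_left[of z z'] z cc by (simp add: mult_M)
    also have "m * (W * (L * z)) = L * z"
      using cancel_left[of m W] mW cc by (simp add: mult_M)
    also have "m * (z * (K * L)) = h * L" unfolding h_def using cc by (simp add: M_simps)
    finally show ?thesis ..
  qed
  moreover have "m * z * p \<in> P" using m(1) z(1) puv(1) by (auto intro: P_mult)
  moreover have "\<delta> h = \<delta> z"
    unfolding h_def using m(1,4) z(1) KP dK B_M[OF diag_part_B, of z]
    by (simp add: diag_part_mult P_mult)
  ultimately have "twist z h" by (simp add: twist_def)
  with that hP hh hh' show thesis by blast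
qed

section \<open>Conjugation by an element satisfying the twist relation\<close>

context
  fixes z z' h h' :: "'a mat"
  assumes z: "z \<in> P" "z' \<in> P" "z * z' = 1\<^sub>m n" "z' * z = 1\<^sub>m n"
    and h: "h \<in> P" "h' \<in> P" "h * h' = 1\<^sub>m n" "h' * h = 1\<^sub>m n"
    and twist: "twist z h"
begin

private definition "E = L * z - h * L"

private lemma cM: "z \<in> M" "z' \<in> M" "h \<in> M" "h' \<in> M" "L \<in> M" "E \<in> M"
  using z h L_M by (auto simp: E_def dest: P_M intro!: minus_carrier_mat mult_M)

private lemma E_P: "E \<in> P"
  using twist by (simp add: twist_def E_def)

private lemma Lz: "L * z = h * L + E"
  unfolding E_def using cM by (auto simp: mat_eq_iff mult_M simp del: index_mult_mat(1))

private lemma diag_inverse: "\<delta> z * \<delta> z' = 1\<^sub>m n" "\<delta> z' * \<delta> z = 1\<^sub>m n"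
  using z one_B by (simp_all add: diag_part_mult[symmetric] diag_part_of_B)

private lemma diag_h: "\<delta> h = \<delta> z"
  using twist by (simp add: twist_def)

private lemma diag_h': "\<delta> h' = \<delta> z'"
proof -
  have d: "\<delta> A \<in> M" for A by (rule B_M[OF diag_part_B])
  have "\<delta> h' * \<delta> z = 1\<^sub>m n"
    using h one_B by (simp add: diag_h[symmetric] diag_part_mult[symmetric] diag_part_of_B)
  then have "\<delta> h' * (\<delta> z * \<delta> z') = \<delta> z'"
    using d by (simp add: assoc_mult_mat[of _ n n _ n _ n, symmetric] left_mult_one_mat[of _ n n])
  then show ?thesis using d diag_inverse by (simp add: right_mult_one_mat[of _ n n])
qed

text \<open>Replacing \<open>L * z\<close> by \<open>h * L + E\<close> splits the product into h (L
  x) z^-1, which lies in P, and E x z^-1, which lies in J and has trace 0. By cyclicity the first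
  trace is that of z^-1 h (L x), and z^-1 h is 1 modulo J because h and z have the same diagonal
  part.\<close>

lemma twist_conj_Jr:
  assumes x: "x \<in> Jr"
  shows "z * x * z' \<in> Jr" "trace (L * (z * x * z')) = trace (L * x)"
proof -
  have xJ: "x \<in> J" and Lx: "L * x \<in> P" using x by (auto simp: Jr_def)
  note c = cM J_M[OF xJ]
  have "L * (z * x * z') = L * z * x * z'" using c by (simp add: M_simps)
  also have "\<dots> = h * (L * x) * z' + E * x * z'" unfolding Lz using c by (simp add: M_simps)
  finally have eq: "L * (z * x * z') = h * (L * x) * z' + E * x * z'" .
  have 1: "h * (L * x) * z' \<in> P" using h z Lx by (auto intro: P_mult)
  have 2: "E * x * z' \<in> J" using E_P xJ z by (auto intro: PJ_mult JP_mult)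
  have "L * (z * x * z') \<in> P" unfolding eq using 1 J_P[OF 2] by (rule P_add)
  then show "z * x * z' \<in> Jr" using z xJ by (auto simp: Jr_def intro: PJ_mult JP_mult)
  define N where "N = z' * h - 1\<^sub>m n"
  have N: "N \<in> J" unfolding J_iff_diag_part
  proof
    show "N \<in> P" unfolding N_def using z h one_B by (auto intro: P_minus P_mult B_P)
    have "\<delta> N = \<delta> z' * \<delta> z - 1\<^sub>m n"
      unfolding N_def using c z h one_B
      by (simp add: diag_part_minus mult_M diag_part_mult diag_part_of_B diag_h)
    then show "\<delta> N = 0\<^sub>m n n" using diag_inverse by simp
  qed
  have zh: "z' * h = 1\<^sub>m n + N" unfolding N_def using c
    by (auto simp: mat_eq_iff mult_M simp del: index_mult_mat(1))
  have "trace (L * (z * x * z')) = trace (h * (L * x) * z') + 0"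
    unfolding eq using trace_add[OF P_M[OF 1] J_M[OF 2]] trace_J[OF 2] by simp
  also have "\<dots> = trace (z' * (h * (L * x)))"
    using trace_mult_comm[of "h * (L * x)" n n z'] c by (simp add: mult_M)
  also have "z' * (h * (L * x)) = z' * h * (L * x)" using c by (simp add: M_simps)
  also have "\<dots> = L * x + N * (L * x)" unfolding zh using c J_M[OF N] by (simp add: M_simps)
  also have "trace \<dots> = trace (L * x)"
    using trace_add[of "L * x" n "N * (L * x)"] c J_M[OF N] trace_JP[OF N Lx] by (simp add: mult_M)
  finally show "trace (L * (z * x * z')) = trace (L * x)" .
qed

text \<open>The twist relation lets r pass z on one side of L and h^-1 on the other, each time
  modulo P; the annihilator lemmas then give exact identities for diagonal parts. Since h and z have
  equal diagonal parts, both identities concern the same matrix \<delta> z r \<delta> z^-1.\<close>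

lemma twist_conj_Rc:
  assumes r: "r \<in> Rc"
  shows "\<delta> z * r * \<delta> z' \<in> Rc" "z * r * z' - \<delta> z * r * \<delta> z' \<in> Jr"
    "trace (L * (z * r * z' - \<delta> z * r * \<delta> z')) = 0"
proof -
  have rB: "r \<in> B" and Lr: "L * r = L" and rL: "r * L = L" using r by (auto simp: Rc_def)
  have rP: "r \<in> P" by (rule B_P[OF rB])
  have d: "\<delta> A \<in> M" for A by (rule B_M[OF diag_part_B])
  note c = cM P_M[OF rP] d[of z] d[of z']
  \<comment> \<open>Since L r = L, the terms with h L cancel and \<open>E * r - E\<close>
    remains.\<close>
  define F where "F = L * (z * r - z)"
  have F_P: "F \<in> P"
  proof -
    have "F = L * z * r - L * z" unfolding F_def using c by (simp add: M_simps)
    also have "\<dots> = h * (L * r) + E * r - (h * L + E)" unfolding Lz using c by (simp add: M_simps)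
    also have "\<dots> = E * r - E" unfolding Lr using c
      by (auto simp: mat_eq_iff mult_M simp del: index_mult_mat(1))
    finally show ?thesis using E_P rP by (auto intro: P_minus P_mult)
  qed
  have "L * \<delta> (z * r - z) = 0\<^sub>m n n"
    by (rule diag_part_right_annihilator) (use z rP F_P in \<open>auto simp: F_def intro: P_minus P_mult\<close>)
  moreover have "\<delta> (z * r - z) = \<delta> z * r - \<delta> z"
    using c z(1) rP rB by (simp add: diag_part_minus mult_M diag_part_mult diag_part_of_B)
  ultimately have "L * (\<delta> z * r) - L * \<delta> z = 0\<^sub>m n n" using c by (simp add: M_simps)
  then have Ltr: "L * (\<delta> z * r) = L * \<delta> z"
    using c by (auto simp: mat_eq_iff mult_M simp del: index_mult_mat(1))
  \<comment> \<open>The twist relation for the inverses: multiply L z = h L + E by h^-1 on the left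
    and by z^-1 on the right. It has h^-1 to the left of L, where r L = L can be used.\<close>
  have E': "h' * L - L * z' \<in> P \<and> h' * L = L * z' + (h' * L - L * z')"
  proof
    have "h' * (L * z) * z' = h' * h * L * z' + h' * E * z'" unfolding Lz using c by (simp add: M_simps)
    moreover have "h' * (L * z) * z' = h' * L" 
      using c z by (simp add: M_simps)
    moreover have "h' * h * L * z' = L * z'" using c h by (simp add: mult_M)
    ultimately have "h' * L - L * z' = h' * E * z'"
      using c by (auto simp: mat_eq_iff mult_M simp del: index_mult_mat(1))
    then show "h' * L - L * z' \<in> P" using h z E_P by (auto intro: P_mult)
    show "h' * L = L * z' + (h' * L - L * z')"
      using c by (auto simp: mat_eq_iff mult_M simp del: index_mult_mat(1))
  qed
  define E' where "E' = h' * L - L * z'"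
  have E'P: "E' \<in> P" and h'L: "h' * L = L * z' + E'" using E' by (simp_all add: E'_def)
  have "(r * h' - h') * L \<in> P"
  proof -
    have "(r * h' - h') * L = r * (h' * L) - h' * L" using c by (simp add: M_simps)
    also have "\<dots> = r * L * z' + r * E' - (L * z' + E')"
      unfolding h'L using c P_M[OF E'P] by (simp add: M_simps)
    also have "\<dots> = r * E' - E'" unfolding rL using c P_M[OF E'P]
      by (auto simp: mat_eq_iff mult_M simp del: index_mult_mat(1))
    finally show ?thesis using E'P rP by (auto intro: P_minus P_mult)
  qed
  then have "\<delta> (r * h' - h') * L = 0\<^sub>m n n"
    by (intro diag_part_left_annihilator) (use h rP in \<open>auto intro: P_minus P_mult\<close>)
  moreover have "\<delta> (r * h' - h') = r * \<delta> z' - \<delta> z'"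
    using c h(2) rP rB by (simp add: diag_part_minus mult_M diag_part_mult diag_part_of_B diag_h')
  ultimately have "r * \<delta> z' * L - \<delta> z' * L = 0\<^sub>m n n" using c by (simp add: M_simps)
  then have rtL: "r * \<delta> z' * L = \<delta> z' * L"
    using c by (auto simp: mat_eq_iff mult_M simp del: index_mult_mat(1))
  define r' where "r' = \<delta> z * r * \<delta> z'"
  have r'B: "r' \<in> B" unfolding r'_def using diag_part_B rB by (auto intro: B_mult)
  have Lr': "L * r' = L"
  proof -
    have "L * r' = L * (\<delta> z * r) * \<delta> z'" unfolding r'_def using c by (simp add: M_simps)
    also have "\<dots> = L * (\<delta> z * \<delta> z')" unfolding Ltr using c by (simp add: M_simps)
    finally show ?thesis using diag_inverse c by simp
  qed
  have r'L: "r' * L = L"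
  proof -
    have "r' * L = \<delta> z * (r * \<delta> z' * L)" unfolding r'_def using c by (simp add: M_simps)
    also have "\<dots> = L" unfolding rtL using cancel_left[of "\<delta> z" "\<delta> z'" L] diag_inverse c by simp
    finally show ?thesis .
  qed
  show "\<delta> z * r * \<delta> z' \<in> Rc" using r'B Lr' r'L by (simp add: Rc_def r'_def)
  define Y where "Y = z * r * z' - r'"
  have cr': "r' \<in> M" by (rule B_M[OF r'B])
  have YP: "Y \<in> P" unfolding Y_def using z rP r'B by (auto intro: P_minus P_mult B_P)
  have "\<delta> Y = 0\<^sub>m n n"
  proof -
    have "\<delta> (z * r * z') = r'" unfolding r'_def
      using z rP rB by (simp add: diag_part_mult P_mult diag_part_of_B)
    then show ?thesis unfolding Y_def
      using c cr' r'B by (simp add: diag_part_minus mult_M diag_part_of_B)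
  qed
  then have YJ: "Y \<in> J" using YP by (simp add: J_iff_diag_part)
  have LY: "L * Y = F * z'"
  proof -
    have "L * Y = L * z * r * z' - L" unfolding Y_def using c cr' Lr' by (simp add: M_simps)
    moreover have "F * z' = L * z * r * z' - L * (z * z')" unfolding F_def using c by (simp add: M_simps)
    ultimately show ?thesis using z c by simp
  qed
  have "Y \<in> Jr" unfolding Jr_def using YJ LY F_P z by (auto intro: P_mult)
  then show "z * r * z' - \<delta> z * r * \<delta> z' \<in> Jr" by (simp add: Y_def r'_def)
  have FM: "F \<in> M" by (rule P_M[OF F_P])
  have "trace (L * Y) = trace (F * \<delta> z' + F * (z' - \<delta> z'))"
  proof -
    have "z' = \<delta> z' + (z' - \<delta> z')" using c by auto
    then show ?thesis unfolding LY using mult_add_distrib_mat[OF FM, of "\<delta> z'" n "z' - \<delta> z'"] c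
      by (metis minus_carrier_mat)
  qed
  also have "\<dots> = trace (F * \<delta> z')"
    using trace_add[of "F * \<delta> z'" n "F * (z' - \<delta> z')"] trace_PJ[OF F_P minus_diag_part[OF z(2)]]
      FM c by (simp add: mult_M minus_carrier_mat)
  also have "F * \<delta> z' = (L * z) * (r * \<delta> z') - (L * z) * \<delta> z'"
    unfolding F_def using c by (simp add: M_simps)
  also have "trace \<dots> = trace (r * \<delta> z' * (L * z)) - trace (\<delta> z' * (L * z))"
    using trace_minus[of "(L * z) * (r * \<delta> z')" n "(L * z) * \<delta> z'"]
      trace_mult_comm[of "L * z" n n "r * \<delta> z'"] trace_mult_comm[of "L * z" n n "\<delta> z'"] c
    by (simp only: mult_M)
  also have "r * \<delta> z' * (L * z) = r * \<delta> z' * L * z" using c by (simp add: M_simps)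
  also have "\<dots> = \<delta> z' * (L * z)" unfolding rtL using c by (simp add: M_simps)
  finally show "trace (L * (z * r * z' - \<delta> z * r * \<delta> z')) = 0" by (simp add: Y_def r'_def)
qed

end

end

section \<open>The subgroup carrying the linear character\<close>

context block_functional
begin

abbreviation GLn :: "'a mat monoid" where "GLn \<equiv> GL TYPE('a) n"

text \<open>In the notation of the definitions, \<open>Jr\<close> is \<open>J_right\<close>, \<open>RC\<close> is \<open>R_circ\<close> and \<open>H\<close> is \<open>P_sub\<close>.\<close>

definition RC :: "'a mat set" where "RC = carrier GLn \<inter> Rc"

definition H :: "'a mat set" where "H = {r + x | r x. r \<in> RC \<and> x \<in> Jr}"

section \<open>Identities of functionals as identities of matrices\<close>

lemma L_mult_B_entry: "r \<in> B \<Longrightarrow> i < n \<Longrightarrow> j < n \<Longrightarrow> \<not> \<beta> j < \<beta> i \<Longrightarrow> (L * r) $$ (i,j) = 0"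
proof (rule ccontr)
  assume r: "r \<in> B" and ij: "i < n" "j < n" "\<not> \<beta> j < \<beta> i" "(L * r) $$ (i,j) \<noteq> 0"
  obtain k where "k < n" "L $$ (i,k) \<noteq> 0" "r $$ (k,j) \<noteq> 0"
    using entries_zero_sum[OF L_M B_M[OF r] ij(1,2,4)] by blast
  moreover from this have "\<beta> k = \<beta> j" using r ij by (auto simp: block_diag_def)
  ultimately show False using lower[of i k] ij by simp
qed

lemma B_mult_L_entry: "r \<in> B \<Longrightarrow> i < n \<Longrightarrow> j < n \<Longrightarrow> \<not> \<beta> j < \<beta> i \<Longrightarrow> (r * L) $$ (i,j) = 0"
proof (rule ccontr)
  assume r: "r \<in> B" and ij: "i < n" "j < n" "\<not> \<beta> j < \<beta> i" "(r * L) $$ (i,j) \<noteq> 0"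
  obtain k where "k < n" "r $$ (i,k) \<noteq> 0" "L $$ (k,j) \<noteq> 0"
    using entries_zero_sum[OF B_M[OF r] L_M ij(1,2,4)] by blast
  moreover from this have "\<beta> i = \<beta> k" using r ij by (auto simp: block_diag_def)
  ultimately show False using lower[of k j] ij by simp
qed

text \<open>Traces against J detect exactly the entries below the diagonal blocks; all other entries
  vanish in both A and L. Hence equality modulo P becomes equality.\<close>

lemma eq_L_if_annihilates_J:
  assumes A: "A \<in> M" and zero: "\<And>i j. i < n \<Longrightarrow> j < n \<Longrightarrow> \<not> \<beta> j < \<beta> i \<Longrightarrow> A $$ (i,j) = 0"
    and ann: "\<And>x. x \<in> J \<Longrightarrow> trace (A * x) = trace (L * x)"
  shows "A = L"
proof -
  have "trace ((A - L) * x) = 0" if x: "x \<in> J" for x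
    using ann[OF x] A L_M J_M[OF x] by (simp add: M_simps trace_minus[of _ n])
  then have "A - L \<in> P"
    using P_iff_annihilates_J[of "A - L"] A L_M minus_carrier_mat by blast
  then have P: "A $$ (i,j) = L $$ (i,j)" if "i < n" "j < n" "\<beta> j < \<beta> i" for i j
    using that A L_M by (auto simp: block_upper_def)
  show ?thesis
  proof (rule eq_matI)
    fix i j assume "i < dim_row L" "j < dim_col L"
    then have ij: "i < n" "j < n" using L_M by auto
    show "A $$ (i,j) = L $$ (i,j)"
      using P[OF ij] zero[OF ij] lower[OF ij] by (cases "\<beta> j < \<beta> i") auto
  qed (use A L_M in auto)
qed

lemma L_mult_eq_iff:
  assumes r: "r \<in> B"
  shows "L * r = L \<longleftrightarrow> (\<forall>x\<in>J. trace (L * (r * x)) = trace (L * x))"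
proof
  assume *: "\<forall>x\<in>J. trace (L * (r * x)) = trace (L * x)"
  show "L * r = L"
  proof (rule eq_L_if_annihilates_J)
    fix x assume "x \<in> J"
    with * show "trace (L * r * x) = trace (L * x)"
      using L_M B_M[OF r] J_M by (simp add: M_simps)
  qed (use L_M B_M[OF r] L_mult_B_entry[OF r] in \<open>auto intro: mult_M\<close>)
next
  assume *: "L * r = L"
  show "\<forall>x\<in>J. trace (L * (r * x)) = trace (L * x)"
  proof
    fix x assume x: "x \<in> J"
    have "L * (r * x) = L * r * x" using L_M B_M[OF r] J_M[OF x] by (simp add: M_simps)
    then show "trace (L * (r * x)) = trace (L * x)" by (simp add: *)
  qed
qed

text \<open>Cyclicity of the trace turns multiplication of x by r on the right into multiplication
  of L by r on the left.\<close>

lemma mult_L_eq_iff: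
  assumes r: "r \<in> B"
  shows "r * L = L \<longleftrightarrow> (\<forall>x\<in>J. trace (L * (x * r)) = trace (L * x))"
proof -
  have cyc: "trace (L * (x * r)) = trace (r * L * x)" if x: "x \<in> J" for x
  proof -
    note c = L_M B_M[OF r] J_M[OF x]
    have "trace (L * (x * r)) = trace (L * x * r)" using c by (simp add: M_simps)
    also have "\<dots> = trace (r * (L * x))" by (rule trace_mult_comm) (use c in \<open>auto intro: mult_M\<close>)
    also have "\<dots> = trace (r * L * x)" using c by (simp add: M_simps)
    finally show ?thesis .
  qed
  show ?thesis
  proof
    assume "\<forall>x\<in>J. trace (L * (x * r)) = trace (L * x)"
    with cyc show "r * L = L"
      using L_M B_M[OF r] B_mult_L_entry[OF r] by (intro eq_L_if_annihilates_J) (auto intro: mult_M)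
  qed (use cyc in simp)
qed

section \<open>The group structure and its linear functional\<close>

lemma Jr_J: "x \<in> Jr \<Longrightarrow> x \<in> J" by (simp add: Jr_def)

lemma RC_B: "r \<in> RC \<Longrightarrow> r \<in> B" and RC_GL: "r \<in> RC \<Longrightarrow> r \<in> carrier GLn"
  and L_RC: "r \<in> RC \<Longrightarrow> L * r = L" and RC_L: "r \<in> RC \<Longrightarrow> r * L = L"
  by (simp_all add: RC_def Rc_def)

lemma GL_M: "g \<in> carrier GLn \<Longrightarrow> g \<in> M" by (simp add: carrier_GL)

lemma zero_Jr: "0\<^sub>m n n \<in> Jr"
  using L_M zero_J J_P by (simp add: Jr_def right_mult_zero_mat[of _ n n])

lemma Jr_add: "x \<in> Jr \<Longrightarrow> y \<in> Jr \<Longrightarrow> x + y \<in> Jr"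
  using L_M J_M by (auto simp: Jr_def M_simps intro: J_add P_add)

lemma Jr_mult: assumes x: "x \<in> Jr" and A: "A \<in> P" shows "x * A \<in> Jr"
proof -
  have xJ: "x \<in> J" and Lx: "L * x \<in> P" using x by (auto simp: Jr_def)
  have "L * (x * A) = L * x * A" using L_M J_M[OF xJ] P_M[OF A] by (simp add: M_simps)
  then have "L * (x * A) \<in> P" using Lx A by (simp add: P_mult)
  then show ?thesis using xJ A by (simp add: Jr_def JP_mult)
qed

lemma RC_mult_Jr: assumes r: "r \<in> RC" and x: "x \<in> Jr" shows "r * x \<in> Jr"
proof -
  have xJ: "x \<in> J" and Lx: "L * x \<in> P" using x by (auto simp: Jr_def)
  have "L * (r * x) = L * r * x" using L_M J_M[OF xJ] B_M[OF RC_B[OF r]] by (simp add: M_simps)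
  then show ?thesis using Lx xJ by (simp add: Jr_def L_RC[OF r] PJ_mult B_P RC_B[OF r])
qed

lemma trace_RC_mult: assumes r: "r \<in> RC" and x: "x \<in> Jr"
  shows "trace (L * (r * x)) = trace (L * x)" "trace (L * (x * r)) = trace (L * x)"
  using L_mult_eq_iff[OF RC_B[OF r]] mult_L_eq_iff[OF RC_B[OF r]] L_RC[OF r] RC_L[OF r] Jr_J[OF x]
  by auto

lemma trace_Jr_mult: assumes x: "x \<in> Jr" and y: "y \<in> J" shows "trace (L * (x * y)) = 0"
  using x y by (simp add: Jr_iff)

lemma trace_L_add: "x \<in> Jr \<Longrightarrow> y \<in> Jr \<Longrightarrow> trace (L * (x + y)) = trace (L * x) + trace (L * y)"
  using L_M J_M[OF Jr_J] by (simp add: M_simps trace_add[of _ n])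

lemma finite_subset_M: "X \<subseteq> M \<Longrightarrow> finite X"
  using finite_M by (rule finite_subset[rotated])

lemma finite_GL: "finite (carrier GLn)"
  by (rule finite_subset_M) (auto simp: carrier_GL)

lemma GLP_inverse: assumes "g \<in> carrier GLn" "g \<in> P" shows "inv\<^bsub>GLn\<^esub> g \<in> P"
  using P_inverse[OF assms(2)] inv_GL[OF assms(1)] by blast

lemma subgroup_P: "subgroup (carrier GLn \<inter> P) GLn"
proof (rule group.subgroupI[OF group_GL])
  have "1\<^sub>m n \<in> carrier GLn \<inter> P" using B_P[OF one_B] by (auto simp: carrier_GL)
  then show "carrier GLn \<inter> P \<noteq> {}" by blast
next
  fix g assume "g \<in> carrier GLn \<inter> P"
  then show "inv\<^bsub>GLn\<^esub> g \<in> carrier GLn \<inter> P"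
    using GLP_inverse group.inv_closed[OF group_GL] by blast
next
  fix g h assume g: "g \<in> carrier GLn \<inter> P" and h: "h \<in> carrier GLn \<inter> P"
  then have "g \<otimes>\<^bsub>GLn\<^esub> h \<in> carrier GLn"
    by (intro monoid.m_closed group.is_monoid group_GL) auto
  then show "g \<otimes>\<^bsub>GLn\<^esub> h \<in> carrier GLn \<inter> P"
    using g h by (simp add: mult_GL P_mult)
qed simp

lemma subgroup_RC: "subgroup RC GLn"
proof (rule group.subgroupI[OF group_GL])
  show "RC \<subseteq> carrier GLn" by (auto simp: RC_def)
  have "1\<^sub>m n \<in> carrier GLn" by (auto simp: carrier_GL)
  then have "1\<^sub>m n \<in> RC" using one_B L_M by (simp add: RC_def Rc_def)
  then show "RC \<noteq> {}" by blast
next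
  fix r assume r: "r \<in> RC"
  note i = inv_GL[OF RC_GL[OF r]] and c = B_M[OF RC_B[OF r]]
  have B: "inv\<^bsub>GLn\<^esub> r \<in> B" by (rule B_inverse[OF RC_B[OF r] i(1,2)])
  have "L * inv\<^bsub>GLn\<^esub> r = L * r * inv\<^bsub>GLn\<^esub> r" by (simp add: L_RC[OF r])
  also have "\<dots> = L * (r * inv\<^bsub>GLn\<^esub> r)" using L_M c i(1) by (rule assoc_mult_mat)
  finally have 1: "L * inv\<^bsub>GLn\<^esub> r = L" using i L_M by simp
  have "inv\<^bsub>GLn\<^esub> r * L = inv\<^bsub>GLn\<^esub> r * (r * L)" by (simp add: RC_L[OF r])
  also have "\<dots> = L" by (rule cancel_left[OF i(1) c L_M i(3)])
  finally show "inv\<^bsub>GLn\<^esub> r \<in> RC" using 1 B group.inv_closed[OF group_GL RC_GL[OF r]]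
    by (simp add: RC_def Rc_def)
next
  fix r s assume r: "r \<in> RC" and s: "s \<in> RC"
  note c = L_M B_M[OF RC_B[OF r]] B_M[OF RC_B[OF s]]
  have "r * s \<in> carrier GLn"
    using monoid.m_closed[OF group.is_monoid[OF group_GL] RC_GL[OF r] RC_GL[OF s]] by (simp add: mult_GL)
  moreover have "L * (r * s) = L"
    using c assoc_mult_mat[OF c, symmetric] by (simp add: L_RC r s)
  moreover have "r * s * L = L"
    using c assoc_mult_mat[OF c(2,3,1)] by (simp add: RC_L r s)
  ultimately show "r \<otimes>\<^bsub>GLn\<^esub> s \<in> RC"
    using B_mult[OF RC_B[OF r] RC_B[OF s]] by (simp add: mult_GL RC_def Rc_def)
qed

text \<open>Elements of \<open>Jr\<close> have no diagonal part, so the diagonal part of the sum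
  recovers r.\<close>

lemma decomposition_unique:
  assumes "r \<in> RC" "s \<in> RC" "x \<in> Jr" "y \<in> Jr" "r + x = s + y"
  shows "r = s" "x = y"
proof -
  note c = B_M[OF RC_B[OF assms(1)]] B_M[OF RC_B[OF assms(2)]]
    J_M[OF Jr_J[OF assms(3)]] J_M[OF Jr_J[OF assms(4)]]
  have "\<delta> (r + x) = r" "\<delta> (s + y) = s"
    using assms(1-4) c by (simp_all add: diag_part_add diag_part_of_B RC_B diag_part_of_J Jr_J)
  then show rs: "r = s" using assms(5) by simp
  have "x = (r + x) - r" "y = (s + y) - s" using c by auto
  then show "x = y" using assms(5) rs by metis
qed

lemma H_I: "r \<in> RC \<Longrightarrow> x \<in> Jr \<Longrightarrow> r + x \<in> H" by (auto simp: H_def)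

text \<open>The trace is additive because r and s fix the functional and the product x y of elements
  of \<open>Jr\<close> has trace 0 against L. This makes \<epsilon> of the trace a multiplicative
  factor on \<open>H\<close>.\<close>

lemma H_mult_eq:
  assumes r: "r \<in> RC" and s: "s \<in> RC" and x: "x \<in> Jr" and y: "y \<in> Jr"
  shows "(r + x) * (s + y) = r * s + (r * y + x * s + x * y)" "r * s \<in> RC"
    "r * y + x * s + x * y \<in> Jr"
    "trace (L * (r * y + x * s + x * y)) = trace (L * x) + trace (L * y)"
proof -
  note c = B_M[OF RC_B[OF r]] B_M[OF RC_B[OF s]] J_M[OF Jr_J[OF x]] J_M[OF Jr_J[OF y]]
  have "(r + x) * (s + y) = (r * s + x * s) + (r * y + x * y)"
    using c by (simp add: M_simps)
  also have "\<dots> = r * s + (r * y + x * s + x * y)"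
    using c by (auto simp: mat_eq_iff mult_M simp del: index_mult_mat(1))
  finally show "(r + x) * (s + y) = r * s + (r * y + x * s + x * y)" .
  show "r * s \<in> RC" using subgroup.m_closed[OF subgroup_RC r s] by (simp add: mult_GL)
  have 1: "r * y \<in> Jr" "x * s \<in> Jr" "x * y \<in> Jr"
    using assms by (auto intro: RC_mult_Jr Jr_mult B_P RC_B J_P Jr_J)
  then show "r * y + x * s + x * y \<in> Jr" by (intro Jr_add)
  show "trace (L * (r * y + x * s + x * y)) = trace (L * x) + trace (L * y)"
    using 1 by (simp add: trace_L_add Jr_add trace_RC_mult[OF r y] trace_RC_mult[OF s x]
        trace_Jr_mult[OF x Jr_J[OF y]])
qed

lemma H_M: "h \<in> H \<Longrightarrow> h \<in> M"
  by (auto simp: H_def dest!: RC_B Jr_J B_M J_M)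

text \<open>The sum r + x equals r (1 + r^-1 x), and r^-1 x stays in \<open>Jr\<close>; this links
  the additive description with the product defining \<open>P_sub\<close>.\<close>

lemma H_eq: "H = {r * (1\<^sub>m n + x) | r x. r \<in> RC \<and> x \<in> Jr}"
proof -
  have 1: "r * (1\<^sub>m n + x) = r + r * x" if "r \<in> RC" "x \<in> Jr" for r x
    using B_M[OF RC_B[OF that(1)]] J_M[OF Jr_J[OF that(2)]] by (simp add: M_simps)
  have 2: "r + x = r * (1\<^sub>m n + inv\<^bsub>GLn\<^esub> r * x)" "inv\<^bsub>GLn\<^esub> r * x \<in> Jr"
    if r: "r \<in> RC" and x: "x \<in> Jr" for r x
  proof -
    have ir: "inv\<^bsub>GLn\<^esub> r \<in> RC" by (rule subgroup.m_inv_closed[OF subgroup_RC r])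
    then show 3: "inv\<^bsub>GLn\<^esub> r * x \<in> Jr" using x by (rule RC_mult_Jr)
    have "r * (inv\<^bsub>GLn\<^esub> r * x) = x"
      by (rule cancel_left) (use RC_B[OF r] RC_B[OF ir] Jr_J[OF x] inv_GL[OF RC_GL[OF r]] in \<open>auto intro: B_M J_M\<close>)
    then show "r + x = r * (1\<^sub>m n + inv\<^bsub>GLn\<^esub> r * x)" unfolding 1[OF r 3] by simp
  qed
  show ?thesis
  proof (intro subset_antisym subsetI)
    fix g assume "g \<in> H"
    then obtain r x where "g = r + x" "r \<in> RC" "x \<in> Jr" unfolding H_def by blast
    then show "g \<in> {r * (1\<^sub>m n + x) | r x. r \<in> RC \<and> x \<in> Jr}" using 2 by blast
  next
    fix g assume "g \<in> {r * (1\<^sub>m n + x) | r x. r \<in> RC \<and> x \<in> Jr}"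
    then obtain r x where "g = r * (1\<^sub>m n + x)" "r \<in> RC" "x \<in> Jr" by blast
    then show "g \<in> H" using H_I RC_mult_Jr by (simp add: 1)
  qed
qed

lemma one_RC: "1\<^sub>m n \<in> RC"
  using subgroup.one_closed[OF subgroup_RC] by (simp add: one_GL)

lemma one_plus_H: "x \<in> Jr \<Longrightarrow> 1\<^sub>m n + x \<in> H"
  by (rule H_I[OF one_RC])

lemma H_GL_P: "H \<subseteq> carrier GLn \<inter> P"
proof
  fix h assume "h \<in> H"
  then obtain r x where h: "h = r * (1\<^sub>m n + x)" "r \<in> RC" "x \<in> Jr" unfolding H_eq by blast
  obtain w where w: "w \<in> P" "(1\<^sub>m n + x) * w = 1\<^sub>m n" "w * (1\<^sub>m n + x) = 1\<^sub>m n"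
    using unipotent_inverse[OF Jr_J[OF h(3)]] by blast
  have "1\<^sub>m n + x \<in> carrier GLn"
    unfolding carrier_GL using w P_M[OF w(1)] J_M[OF Jr_J[OF h(3)]] by auto
  then have "h \<in> carrier GLn"
    using monoid.m_closed[OF group.is_monoid[OF group_GL] RC_GL[OF h(2)]] h(1) by (simp add: mult_GL)
  moreover have "h \<in> P"
    using h one_B by (auto intro: P_mult P_add B_P RC_B J_P Jr_J)
  ultimately show "h \<in> carrier GLn \<inter> P" by blast
qed

lemma H_mult_closed: assumes "g \<in> H" "h \<in> H" shows "g * h \<in> H"
proof -
  obtain r x s y where "g = r + x" "h = s + y" and rs: "r \<in> RC" "s \<in> RC" "x \<in> Jr" "y \<in> Jr"
    using assms unfolding H_def by blast
  then show ?thesis using H_mult_eq[OF rs] H_I by simp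
qed

lemma H_inverse: assumes h: "h \<in> H" shows "inv\<^bsub>GLn\<^esub> h \<in> H"
proof (rule inverse_closed)
  show "1\<^sub>m n \<in> H" using one_plus_H[OF zero_Jr] by simp
  have "h \<in> carrier GLn" using h H_GL_P by blast
  from inv_GL[OF this] show "h * inv\<^bsub>GLn\<^esub> h = 1\<^sub>m n" "inv\<^bsub>GLn\<^esub> h \<in> M" by auto
qed (use h H_M H_mult_closed in auto)

lemma H_cancel:
  assumes g: "g \<in> H" and k: "k \<in> M" shows "g * k \<in> H \<longleftrightarrow> k \<in> H"
proof
  assume gk: "g * k \<in> H"
  have "inv\<^bsub>GLn\<^esub> g * (g * k) \<in> H" by (rule H_mult_closed[OF H_inverse[OF g] gk])
  also have "inv\<^bsub>GLn\<^esub> g * (g * k) = k"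
  proof (rule cancel_left[OF _ H_M[OF g] k])
    have "g \<in> carrier GLn" using g H_GL_P by blast
    from inv_GL[OF this] show "inv\<^bsub>GLn\<^esub> g \<in> M" "inv\<^bsub>GLn\<^esub> g * g = 1\<^sub>m n" by auto
  qed
  finally show "k \<in> H" .
qed (rule H_mult_closed[OF g])

end

section \<open>Vanishing of the Mackey sums\<close>

lemma additive_character_scale:
  fixes \<epsilon> :: "'a::field \<Rightarrow> complex"
  assumes "nontrivial_additive_character \<epsilon>" "a \<noteq> b"
  obtains c where "\<epsilon> (c * a) \<noteq> \<epsilon> (c * b)"
proof -
  obtain t where t: "\<epsilon> t \<noteq> 1" using assms(1) unfolding nontrivial_additive_character_def by blast
  \<comment> \<open>The scaling moves the difference a - b to a point t where the character is not
    1.\<close>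
  define c where "c = t / (a - b)"
  have "c * a = t + c * b" using assms(2) by (simp add: c_def field_simps)
  then have "\<epsilon> (c * a) = \<epsilon> t * \<epsilon> (c * b)" "\<epsilon> (c * b) \<noteq> 0"
    using assms(1) unfolding nontrivial_additive_character_def by simp_all
  with t that show thesis by force
qed

context block_functional
begin

definition stabilizer :: "'a mat set" where
  "stabilizer = {z \<in> carrier GLn \<inter> P. \<forall>x\<in>Jr. z * x * inv\<^bsub>GLn\<^esub> z \<in> Jr \<and>
     trace (L * (z * x * inv\<^bsub>GLn\<^esub> z)) = trace (L * x)}"

lemma GL_mult: "g \<in> carrier GLn \<Longrightarrow> h \<in> carrier GLn \<Longrightarrow> g * h \<in> carrier GLn"
  using monoid.m_closed[OF group.is_monoid[OF group_GL]] by (simp add: mult_GL)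

lemma Jr_smult: "x \<in> Jr \<Longrightarrow> c \<cdot>\<^sub>m x \<in> Jr"
  using L_M J_M by (auto simp: Jr_def mult_smult_distrib[of _ n n _ n] intro: J_smult P_smult)

lemma one_plus_mult_H:
  assumes r: "r \<in> RC" and x: "x \<in> Jr" and y: "y \<in> Jr"
  obtains w where "(1\<^sub>m n + y) * (r + x) = r + w" "w \<in> Jr"
    "trace (L * w) = trace (L * x) + trace (L * y)"
  using that H_mult_eq[OF one_RC r y x] B_M[OF RC_B[OF r]]
  by (simp add: left_mult_one_mat[of _ n n] add.commute)

lemma mult_one_plus_H:
  assumes r: "r \<in> RC" and x: "x \<in> Jr" and y: "y \<in> Jr"
  obtains w where "(r + x) * (1\<^sub>m n + y) = r + w" "w \<in> Jr"
    "trace (L * w) = trace (L * x) + trace (L * y)"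
  using that H_mult_eq[OF r one_RC x y] B_M[OF RC_B[OF r]]
  by (simp add: right_mult_one_mat[of _ n n])

context
  fixes \<epsilon> :: "'a \<Rightarrow> complex" and \<theta> \<theta>' \<xi> \<xi>' :: "'a mat \<Rightarrow> complex"
  assumes \<epsilon>: "nontrivial_additive_character \<epsilon>"
    and \<xi>: "\<And>r x. r \<in> RC \<Longrightarrow> x \<in> Jr \<Longrightarrow> \<xi> (r + x) = \<theta> r * \<epsilon> (trace (L * x))"
    and \<xi>': "\<And>r x. r \<in> RC \<Longrightarrow> x \<in> Jr \<Longrightarrow> \<xi>' (r + x) = \<theta>' r * \<epsilon> (trace (L * x))"
begin

text \<open>Put k = 1 + x and let y be the conjugate of x by z. Replacing h by h k multiplies the
  first factor by \<epsilon>(trace (L x)) and multiplies the argument of the second by (1 + y)^-1 on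
  the left, which divides its value by \<epsilon>(trace (L y)). The sum is therefore unchanged by a
  factor other than 1.\<close>

lemma inner_sum_eq_0_if_incompatible:
  assumes z: "z \<in> carrier GLn \<inter> P" and x0: "x0 \<in> Jr" and y0: "z * x0 * inv\<^bsub>GLn\<^esub> z \<in> Jr"
    and ne: "trace (L * (z * x0 * inv\<^bsub>GLn\<^esub> z)) \<noteq> trace (L * x0)"
  shows "(\<Sum>h\<in>H. \<xi> h * (if z * inv\<^bsub>GLn\<^esub> h * inv\<^bsub>GLn\<^esub> z \<in> H
    then \<xi>' (z * inv\<^bsub>GLn\<^esub> h * inv\<^bsub>GLn\<^esub> z) else 0)) = 0"
proof -
  define z' where "z' = inv\<^bsub>GLn\<^esub> z"
  have zG: "z \<in> carrier GLn" using z by blast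
  have zz: "z' \<in> M" "z * z' = 1\<^sub>m n" "z' * z = 1\<^sub>m n" using inv_GL[OF zG] by (simp_all add: z'_def)
  have zM: "z \<in> M" using z P_M by blast
  obtain c where c: "\<epsilon> (c * trace (L * (z * x0 * z'))) \<noteq> \<epsilon> (c * trace (L * x0))"
    using additive_character_scale[OF \<epsilon> ne[folded z'_def]] by blast
  define x where "x = c \<cdot>\<^sub>m x0"
  define y where "y = z * x * z'"
  have x: "x \<in> Jr" unfolding x_def by (rule Jr_smult[OF x0])
  have x0M: "x0 \<in> M" and xM: "x \<in> M" by (rule J_M, rule Jr_J, fact)+
  have y_eq: "y = c \<cdot>\<^sub>m (z * x0 * z')"
    unfolding y_def x_def using x0M zM zz(1)
    by (simp add: mult_smult_distrib[of _ n n _ n] mult_smult_assoc_mat[of _ n n _ n] mult_M)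
  have y: "y \<in> Jr" unfolding y_eq z'_def by (rule Jr_smult[OF y0])
  have yM: "y \<in> M" by (rule J_M[OF Jr_J[OF y]])
  have tr: "trace (L * x) = c * trace (L * x0)" "trace (L * y) = c * trace (L * (z * x0 * z'))"
    unfolding x_def y_eq using x0M zM zz(1) L_M
    by (simp_all add: mult_smult_distrib[of _ n n _ n] mult_M trace_smult[of _ n])
  have add: "\<epsilon> (s + t) = \<epsilon> s * \<epsilon> t" for s t
    using \<epsilon> unfolding nontrivial_additive_character_def by blast
  define T where "T h = \<xi> h * (if z * inv\<^bsub>GLn\<^esub> h * z' \<in> H then \<xi>' (z * inv\<^bsub>GLn\<^esub> h * z') else 0)" for h
  define k where "k = 1\<^sub>m n + x"
  have kH: "k \<in> H" unfolding k_def by (rule one_plus_H[OF x])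
  have kG: "k \<in> carrier GLn" using kH H_GL_P by blast
  \<comment> \<open>The factor for y stands on the left so that no inverse of 1 + y has to be
    evaluated.\<close>
  have T_shift: "\<epsilon> (trace (L * y)) * T (h * k) = \<epsilon> (trace (L * x)) * T h" if h: "h \<in> H" for h
  proof -
    have hG: "h \<in> carrier GLn" using h H_GL_P by blast
    define q where "q = z * inv\<^bsub>GLn\<^esub> (h * k) * z'"
    note ih = inv_GL[OF hG] and ik = inv_GL[OF kG]
    note cc = GL_M[OF hG] GL_M[OF kG] ih(1) ik(1) zM zz(1) xM yM
    have inv_hk: "inv\<^bsub>GLn\<^esub> (h * k) = inv\<^bsub>GLn\<^esub> k * inv\<^bsub>GLn\<^esub> h"
      using group.inv_mult_group[OF group_GL hG kG] by (simp add: mult_GL)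
    have qM: "q \<in> M" unfolding q_def inv_hk using cc by (auto intro: mult_M)
    have "z * k * z' = z * z' + z * x * z'" unfolding k_def using cc by (simp add: M_simps)
    then have zkz: "1\<^sub>m n + y = z * k * z'" by (simp add: zz y_def)
    have "(1\<^sub>m n + y) * q = z * (k * (z' * (z * (inv\<^bsub>GLn\<^esub> k * (inv\<^bsub>GLn\<^esub> h * z')))))"
      unfolding zkz q_def inv_hk using cc by (simp add: M_simps)
    also have "\<dots> = z * (k * (inv\<^bsub>GLn\<^esub> k * (inv\<^bsub>GLn\<^esub> h * z')))"
      using cc cancel_left[OF zz(1) zM _ zz(3)] by (simp add: mult_M)
    also have "\<dots> = z * inv\<^bsub>GLn\<^esub> h * z'"
      using cc cancel_left[OF cc(2,4) _ ik(2)] by (simp add: M_simps)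
    finally have eq: "(1\<^sub>m n + y) * q = z * inv\<^bsub>GLn\<^esub> h * z'" .
    obtain r w where rw: "h = r + w" "r \<in> RC" "w \<in> Jr" using h unfolding H_def by blast
    have left: "\<xi> (h * k) = \<epsilon> (trace (L * x)) * \<xi> h"
    proof -
      obtain v where v: "h * k = r + v" "v \<in> Jr" "trace (L * v) = trace (L * w) + trace (L * x)"
        using mult_one_plus_H[OF rw(2,3) x] unfolding rw(1) k_def by blast
      show ?thesis unfolding v(1) \<xi>[OF rw(2) v(2)] v(3) unfolding rw(1) \<xi>[OF rw(2,3)] by (simp add: add)
    qed
    have iff: "(1\<^sub>m n + y) * q \<in> H \<longleftrightarrow> q \<in> H" by (rule H_cancel[OF one_plus_H[OF y] qM])
    have right: "\<xi>' ((1\<^sub>m n + y) * q) = \<epsilon> (trace (L * y)) * \<xi>' q" if qH: "q \<in> H"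
    proof -
      obtain s u where su: "q = s + u" "s \<in> RC" "u \<in> Jr" using qH unfolding H_def by blast
      obtain v where v: "(1\<^sub>m n + y) * q = s + v" "v \<in> Jr" "trace (L * v) = trace (L * u) + trace (L * y)"
        using one_plus_mult_H[OF su(2,3) y] unfolding su(1) by blast
      show ?thesis unfolding v(1) \<xi>'[OF su(2) v(2)] v(3) unfolding su(1) \<xi>'[OF su(2,3)] by (simp add: add)
    qed
    have "T (h * k) = \<epsilon> (trace (L * x)) * \<xi> h * (if q \<in> H then \<xi>' q else 0)"
      unfolding T_def q_def[symmetric] left ..
    moreover have "T h = \<xi> h * (if q \<in> H then \<epsilon> (trace (L * y)) * \<xi>' q else 0)"
      unfolding T_def eq[symmetric] using iff right by simp
    ultimately show ?thesis by simp
  qed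
  have "bij_betw (\<lambda>h. h * k) H H"
  proof (rule bij_betwI')
    fix g h assume g: "g \<in> H" and h: "h \<in> H"
    show "g * k = h * k \<longleftrightarrow> g = h"
    proof
      assume "g * k = h * k"
      then have "g \<otimes>\<^bsub>GLn\<^esub> k = h \<otimes>\<^bsub>GLn\<^esub> k" by (simp add: mult_GL)
      moreover have "g \<in> carrier GLn" "h \<in> carrier GLn" using g h H_GL_P by blast+
      ultimately show "g = h" using group.right_cancel[OF group_GL kG] by blast
    qed simp
  next
    fix h assume h: "h \<in> H"
    show "\<exists>g\<in>H. h = g * k"
    proof
      show "h * inv\<^bsub>GLn\<^esub> k \<in> H" by (rule H_mult_closed[OF h H_inverse[OF kH]])
      show "h = h * inv\<^bsub>GLn\<^esub> k * k"
        using inv_GL[OF kG] H_M[OF h] GL_M[OF kG] by (simp add: M_simps)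
    qed
  qed (rule H_mult_closed[OF _ kH])
  then have "(\<Sum>h\<in>H. T (h * k)) = (\<Sum>h\<in>H. T h)" by (rule sum.reindex_bij_betw)
  then have "\<epsilon> (trace (L * y)) * (\<Sum>h\<in>H. T h) = (\<Sum>h\<in>H. \<epsilon> (trace (L * y)) * T (h * k))"
    by (simp add: sum_distrib_left[symmetric])
  also have "\<dots> = \<epsilon> (trace (L * x)) * (\<Sum>h\<in>H. T h)"
    using T_shift by (simp add: sum_distrib_left)
  finally have "(\<Sum>h\<in>H. T h) = 0" using c unfolding tr by simp
  then show ?thesis unfolding T_def z'_def .
qed

text \<open>Write the inverse of r + x as s + y. Then s = r^-1, and conjugation by z changes neither
  \<theta>' of the diagonal part nor the trace, so the two values of \<epsilon> cancel. Each term
  depends on r alone, and summing over x gives the factor \<open>card Jr\<close>.\<close>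

lemma inner_sum_eq_0_if_twist:
  assumes z: "z \<in> carrier GLn \<inter> P" and h: "h \<in> P" "h' \<in> P" "h * h' = 1\<^sub>m n" "h' * h = 1\<^sub>m n"
    and tw: "twist z h"
    and inv: "\<And>r. r \<in> RC \<Longrightarrow> \<theta>' (\<delta> z * r * \<delta> (inv\<^bsub>GLn\<^esub> z)) = \<theta>' r"
    and pairing: "(\<Sum>r\<in>RC. \<theta> r * \<theta>' (inv\<^bsub>GLn\<^esub> r)) = 0"
  shows "(\<Sum>h\<in>H. \<xi> h * (if z * inv\<^bsub>GLn\<^esub> h * inv\<^bsub>GLn\<^esub> z \<in> H
    then \<xi>' (z * inv\<^bsub>GLn\<^esub> h * inv\<^bsub>GLn\<^esub> z) else 0)) = 0"
proof -
  define z' where "z' = inv\<^bsub>GLn\<^esub> z"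
  have zG: "z \<in> carrier GLn" and zP: "z \<in> P" using z by blast+
  have zz: "z' \<in> M" "z * z' = 1\<^sub>m n" "z' * z = 1\<^sub>m n" using inv_GL[OF zG] by (simp_all add: z'_def)
  have z'P: "z' \<in> P" by (rule P_inverse[OF zP zz(1,2)])
  note conj_Jr = twist_conj_Jr[OF zP z'P zz(2,3) h tw] and conj_Rc = twist_conj_Rc[OF zP z'P zz(2,3) h tw]
  have \<epsilon>_neg: "\<epsilon> s * \<epsilon> t = 1" if "s + t = 0" for s t
  proof -
    have "\<epsilon> 0 * \<epsilon> 0 = \<epsilon> 0 * 1" "\<epsilon> 0 \<noteq> 0" "\<epsilon> (s + t) = \<epsilon> s * \<epsilon> t"
      using \<epsilon> unfolding nontrivial_additive_character_def by (metis add_0 mult_1_right, blast+)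
    then show ?thesis using that by simp
  qed
  have \<delta>GL: "\<delta> z \<in> carrier GLn" "\<delta> z' \<in> carrier GLn"
  proof -
    have "\<delta> z * \<delta> z' = 1\<^sub>m n" "\<delta> z' * \<delta> z = 1\<^sub>m n"
      using zP z'P zz one_B by (simp_all add: diag_part_mult[symmetric] diag_part_of_B)
    then show "\<delta> z \<in> carrier GLn" "\<delta> z' \<in> carrier GLn"
      using B_M[OF diag_part_B] by (auto simp: carrier_GL)
  qed
  define T where "T h = \<xi> h * (if z * inv\<^bsub>GLn\<^esub> h * z' \<in> H then \<xi>' (z * inv\<^bsub>GLn\<^esub> h * z') else 0)" for h
  have T: "T (r + x) = \<theta> r * \<theta>' (inv\<^bsub>GLn\<^esub> r)" if r: "r \<in> RC" and x: "x \<in> Jr" for r x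
  proof -
    have rxH: "r + x \<in> H" by (rule H_I[OF r x])
    have rxG: "r + x \<in> carrier GLn" using rxH H_GL_P by blast
    obtain s y where sy: "inv\<^bsub>GLn\<^esub> (r + x) = s + y" "s \<in> RC" "y \<in> Jr"
      using H_inverse[OF rxH] unfolding H_def by blast
    \<comment> \<open>Writing the identity as 1 + 0 lets uniqueness of decompositions compare the
      parts in \<open>RC\<close> and in \<open>Jr\<close>; the second comparison shows that x and y
      have opposite traces against L.\<close>
    have "1\<^sub>m n + 0\<^sub>m n n = (r + x) * inv\<^bsub>GLn\<^esub> (r + x)" unfolding inv_GL(2)[OF rxG] by simp
    also have "\<dots> = r * s + (r * y + x * s + x * y)"
      unfolding sy(1) by (rule H_mult_eq(1)[OF r sy(2) x sy(3)])
    finally have "1\<^sub>m n + 0\<^sub>m n n = r * s + (r * y + x * s + x * y)" .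
    note u = decomposition_unique[OF one_RC H_mult_eq(2)[OF r sy(2) x sy(3)] zero_Jr
        H_mult_eq(3)[OF r sy(2) x sy(3)] this]
    have "s = inv\<^bsub>GLn\<^esub> r"
    proof (rule group.inv_equality[OF group_GL, symmetric])
      show "s \<otimes>\<^bsub>GLn\<^esub> r = \<one>\<^bsub>GLn\<^esub>" unfolding mult_GL one_GL
        by (rule mat_mult_left_right_inverse) (use u(1) r sy(2) in \<open>auto intro: B_M RC_B\<close>)
    qed (use r sy(2) in \<open>auto intro: RC_GL\<close>)
    have "trace (L * x) + trace (L * y) = trace (L * 0\<^sub>m n n)"
      unfolding u(2) H_mult_eq(4)[OF r sy(2) x sy(3)] ..
    also have "\<dots> = 0" using L_M by (simp add: right_mult_zero_mat[of _ n n] trace_def)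
    finally have \<epsilon>xy: "\<epsilon> (trace (L * x)) * \<epsilon> (trace (L * y)) = 1" by (rule \<epsilon>_neg)
    have sRc: "s \<in> Rc" using sy(2) by (simp add: RC_def)
    define s' where "s' = \<delta> z * s * \<delta> z'"
    \<comment> \<open>The part in \<open>Jr\<close> of the conjugate of s + y: the error of
      replacing z by its diagonal part on s, which has trace 0 against L, plus the conjugate of
      y.\<close>
    define w where "w = (z * s * z' - s') + z * y * z'"
    have s'RC: "s' \<in> RC"
    proof -
      have "\<delta> z * s * \<delta> z' \<in> carrier GLn"
        by (intro GL_mult \<delta>GL RC_GL[OF sy(2)])
      then show ?thesis using conj_Rc(1)[OF sRc] by (simp add: RC_def s'_def)
    qed
    have 1: "z * s * z' - s' \<in> Jr" "z * y * z' \<in> Jr"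
      using conj_Rc(2)[OF sRc] conj_Jr(1)[OF sy(3)] by (simp_all add: s'_def)
    then have wJr: "w \<in> Jr" unfolding w_def by (rule Jr_add)
    have tw: "trace (L * w) = trace (L * y)"
      unfolding w_def trace_L_add[OF 1] using conj_Rc(3)[OF sRc] conj_Jr(2)[OF sy(3)]
      by (simp add: s'_def)
    have c: "s \<in> M" "y \<in> M" "s' \<in> M" "z \<in> M"
      using sy s'RC zP by (auto intro: B_M RC_B J_M Jr_J P_M)
    have "z * (s + y) * z' = z * s * z' + z * y * z'" using c zz(1) by (simp add: M_simps)
    also have "\<dots> = s' + w" unfolding w_def using c zz(1)
      by (auto simp: mat_eq_iff mult_M simp del: index_mult_mat(1))
    finally have eq: "z * inv\<^bsub>GLn\<^esub> (r + x) * z' = s' + w" unfolding sy(1) .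
    have "T (r + x) = \<theta> r * \<epsilon> (trace (L * x)) * (\<theta>' s' * \<epsilon> (trace (L * y)))"
      unfolding T_def eq using H_I[OF s'RC wJr] by (simp add: \<xi>[OF r x] \<xi>'[OF s'RC wJr] tw)
    also have "\<theta>' s' = \<theta>' s" unfolding s'_def z'_def by (rule inv[OF sy(2)])
    finally have "T (r + x) = \<theta> r * \<theta>' s * (\<epsilon> (trace (L * x)) * \<epsilon> (trace (L * y)))"
      by (simp add: mult_ac)
    then show ?thesis unfolding \<epsilon>xy using \<open>s = inv\<^bsub>GLn\<^esub> r\<close> by simp
  qed
  have "(\<Sum>h\<in>H. T h) = (\<Sum>(r,x)\<in>RC \<times> Jr. T (r + x))"
  proof -
    have "inj_on (\<lambda>(r,x). r + x) (RC \<times> Jr)"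
      using decomposition_unique by (auto intro!: inj_onI; blast)
    moreover have "H = (\<lambda>(r,x). r + x) ` (RC \<times> Jr)" unfolding H_def by auto
    ultimately show ?thesis by (simp add: sum.reindex case_prod_unfold)
  qed
  also have "\<dots> = (\<Sum>(r,x)\<in>RC \<times> Jr. \<theta> r * \<theta>' (inv\<^bsub>GLn\<^esub> r))"
    using T by (intro sum.cong) auto
  also have "\<dots> = (\<Sum>r\<in>RC. \<Sum>x\<in>Jr. \<theta> r * \<theta>' (inv\<^bsub>GLn\<^esub> r))"
    by (rule sum.cartesian_product[symmetric])
  also have "\<dots> = of_nat (card Jr) * (\<Sum>r\<in>RC. \<theta> r * \<theta>' (inv\<^bsub>GLn\<^esub> r))"
    by (simp add: sum_distrib_left)
  also have "\<dots> = 0" by (simp add: pairing)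
  finally show ?thesis unfolding T_def z'_def .
qed

text \<open>Either a single bad x kills the sum, or the compatibility needed for a twist holds for
  all x. In the latter case z stabilizes the restricted functional, so invariance of \<theta>' is
  demanded only there.\<close>

lemma inner_sum_eq_0:
  assumes z: "z \<in> carrier GLn \<inter> P"
    and inv: "\<And>r. z \<in> stabilizer \<Longrightarrow> r \<in> RC \<Longrightarrow> \<theta>' (\<delta> z * r * \<delta> (inv\<^bsub>GLn\<^esub> z)) = \<theta>' r"
    and pairing: "(\<Sum>r\<in>RC. \<theta> r * \<theta>' (inv\<^bsub>GLn\<^esub> r)) = 0"
  shows "(\<Sum>h\<in>H. \<xi> h * (if z * inv\<^bsub>GLn\<^esub> h * inv\<^bsub>GLn\<^esub> z \<in> H
    then \<xi>' (z * inv\<^bsub>GLn\<^esub> h * inv\<^bsub>GLn\<^esub> z) else 0)) = 0"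
proof (cases "\<exists>x\<in>Jr. z * x * inv\<^bsub>GLn\<^esub> z \<in> Jr \<and> trace (L * (z * x * inv\<^bsub>GLn\<^esub> z)) \<noteq> trace (L * x)")
  case True
  then show ?thesis using inner_sum_eq_0_if_incompatible[OF z] by blast
next
  case False
  have zG: "z \<in> carrier GLn" and zP: "z \<in> P" using z by blast+
  note zz = inv_GL[OF zG]
  have z'P: "inv\<^bsub>GLn\<^esub> z \<in> P" by (rule P_inverse[OF zP zz(1,2)])
  obtain h h' where h: "h \<in> P" "h' \<in> P" "h * h' = 1\<^sub>m n" "h' * h = 1\<^sub>m n" "twist z h"
    using twist_if_compatible[OF zP z'P zz(2,3)] False by blast
  have "z \<in> stabilizer"
    using twist_conj_Jr[OF zP z'P zz(2,3) h] z by (simp add: stabilizer_def)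
  then show ?thesis using inner_sum_eq_0_if_twist[OF z h inv pairing] by blast
qed

end

end

section \<open>Disjointness of the induced characters\<close>

text \<open>The first segment whose end exceeds i; segment k ends at the sum of the first k + 1
  parts. The value matters only for i below \<open>sum_list ns\<close>.\<close>

definition block_index :: "nat list \<Rightarrow> nat \<Rightarrow> nat" where
  "block_index ns i = (LEAST k. i < sum_list (take (Suc k) ns))"

lemma sum_list_take_mono: "k \<le> l \<Longrightarrow> sum_list (take k ns) \<le> sum_list (take l ns)" for ns :: "nat list"
proof -
  assume "k \<le> l"
  then have "take l ns = take k ns @ take (l - k) (drop k ns)"
    by (metis le_add_diff_inverse take_add)
  then show ?thesis by simp
qed

lemma block_index_eq: "i \<in> segment ns k \<Longrightarrow> block_index ns i = k"
  unfolding block_index_def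
proof (rule Least_equality)
  fix l assume i: "i \<in> segment ns k" and l: "i < sum_list (take (Suc l) ns)"
  show "k \<le> l"
  proof (rule ccontr)
    assume "\<not> k \<le> l"
    then have "sum_list (take (Suc l) ns) \<le> sum_list (take k ns)" by (intro sum_list_take_mono) simp
    with i l show False by (simp add: segment_def)
  qed
qed (simp add: segment_def)

lemma block_index_segment:
  assumes "i < sum_list ns"
  shows "block_index ns i < length ns" "i \<in> segment ns (block_index ns i)"
proof -
  let ?Q = "\<lambda>k. i < sum_list (take (Suc k) ns)"
  have "?Q (length ns - 1)" using assms by (cases ns) auto
  then have le: "block_index ns i \<le> length ns - 1" and Q: "?Q (block_index ns i)"
    unfolding block_index_def by (rule Least_le, rule LeastI)
  have "ns \<noteq> []" using assms by auto
  with le show "block_index ns i < length ns" by (cases ns) auto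
  have "sum_list (take (block_index ns i) ns) \<le> i"
  proof (cases "block_index ns i")
    case (Suc m)
    then have "\<not> ?Q m" unfolding block_index_def by (intro not_less_Least) simp
    then show ?thesis using Suc by simp
  qed simp
  with Q show "i \<in> segment ns (block_index ns i)" by (simp add: segment_def)
qed

lemma segment_less: "k < length ns \<Longrightarrow> i \<in> segment ns k \<Longrightarrow> i < sum_list ns"
  using sum_list_take_mono[of "Suc k" "length ns" ns] by (simp add: segment_def)

lemma block_index_mono:
  assumes "i \<le> j" "j < sum_list ns"
  shows "block_index ns i \<le> block_index ns j"
proof -
  have "i < sum_list (take (Suc (block_index ns j)) ns)"
    using block_index_segment(2)[OF assms(2)] assms(1) by (simp add: segment_def)
  then show ?thesis unfolding block_index_def[of ns i] by (rule Least_le)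
qed

lemma Delta_J_iff: "(i,j) \<in> Delta_J ns \<longleftrightarrow>
    i < sum_list ns \<and> j < sum_list ns \<and> block_index ns i < block_index ns j"
proof
  assume "(i,j) \<in> Delta_J ns"
  then obtain k l where "l < length ns" "k < l" "i \<in> segment ns k" "j \<in> segment ns l"
    unfolding Delta_J_def by auto
  then show "i < sum_list ns \<and> j < sum_list ns \<and> block_index ns i < block_index ns j"
    using block_index_eq[of i ns k] block_index_eq[of j ns l] segment_less[of k ns i] segment_less[of l ns j]
    by simp
next
  assume "i < sum_list ns \<and> j < sum_list ns \<and> block_index ns i < block_index ns j"
  then show "(i,j) \<in> Delta_J ns"
    unfolding Delta_J_def using block_index_segment[of i ns] block_index_segment[of j ns] by blast
qed

lemma algebra_J_eq: "algebra_J ns = block_strict (sum_list ns) (block_index ns)"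
  by (auto simp: algebra_J_def block_strict_def Delta_J_iff not_less)

lemma group_P_eq: "group_P ns = carrier (GL TYPE('a::field) (sum_list ns)) \<inter> block_upper (sum_list ns) (block_index ns)"
proof -
  have "(\<forall>k<length ns. \<forall>l<k. \<forall>i\<in>segment ns k. \<forall>j\<in>segment ns l. g $$ (i,j) = 0)
    \<longleftrightarrow> g \<in> block_upper (sum_list ns) (block_index ns)" (is "?l \<longleftrightarrow> ?r")
    if g: "g \<in> carrier_mat (sum_list ns) (sum_list ns)" for g :: "'a mat"
  proof
    assume ?l
    then show ?r using g block_index_segment unfolding block_upper_def by blast
  next
    assume r: ?r
    show ?l
    proof (intro allI impI ballI)
      fix k l i j assume "k < length ns" "l < k" "i \<in> segment ns k" "j \<in> segment ns l"
      then show "g $$ (i,j) = 0"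
        using r block_index_eq[of i ns k] block_index_eq[of j ns l] segment_less[of k ns i] segment_less[of l ns j]
        by (simp add: block_upper_def)
    qed
  qed
  then have "g \<in> group_P ns \<longleftrightarrow> g \<in> carrier (GL TYPE('a) (sum_list ns)) \<inter> block_upper (sum_list ns) (block_index ns)"
    for g :: "'a mat"
    unfolding group_P_def by (cases "g \<in> carrier_mat (sum_list ns) (sum_list ns)") (simp_all add: carrier_GL)
  then show ?thesis by blast
qed

lemma group_R_eq: "group_R ns = carrier (GL TYPE('a::field) (sum_list ns)) \<inter> block_diag (sum_list ns) (block_index ns)"
proof -
  have "(\<forall>k<length ns. \<forall>l<length ns. k \<noteq> l \<longrightarrow> (\<forall>i\<in>segment ns k. \<forall>j\<in>segment ns l. g $$ (i,j) = 0))
    \<longleftrightarrow> g \<in> block_diag (sum_list ns) (block_index ns)" (is "?l \<longleftrightarrow> ?r")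
    if g: "g \<in> carrier_mat (sum_list ns) (sum_list ns)" for g :: "'a mat"
  proof
    assume ?l
    then show ?r using g block_index_segment unfolding block_diag_def by blast
  next
    assume r: ?r
    show ?l
    proof (intro allI impI ballI)
      fix k l i j assume "k < length ns" "l < length ns" "k \<noteq> l" "i \<in> segment ns k" "j \<in> segment ns l"
      then show "g $$ (i,j) = 0"
        using r block_index_eq[of i ns k] block_index_eq[of j ns l] segment_less[of k ns i] segment_less[of l ns j]
        by (simp add: block_diag_def)
    qed
  qed
  then have "g \<in> group_R ns \<longleftrightarrow> g \<in> carrier (GL TYPE('a) (sum_list ns)) \<inter> block_diag (sum_list ns) (block_index ns)"
    for g :: "'a mat"
    unfolding group_R_def by (cases "g \<in> carrier_mat (sum_list ns) (sum_list ns)") (simp_all add: carrier_GL)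
  then show ?thesis by blast
qed

text \<open>A row of L corresponds to a column of D and a column of L to a row of D. Two nonzero
  entries in one line of L therefore belong to the same block-rook, whose row set and column set
  each lie in one segment.\<close>

lemma associated_functional_matrix:
  fixes lam :: "'a::{field,finite} mat \<Rightarrow> 'a"
  assumes D: "block_rook_placement ns D" and lam: "associated_functional ns D lam"
  obtains L :: "'a mat" where "block_functional (sum_list ns) (block_index ns) L"
    "\<And>x. x \<in> algebra_J ns \<Longrightarrow> lam x = trace (L * x)"
proof -
  let ?n = "sum_list ns" and ?b = "block_index ns"
  have DJ: "D \<subseteq> Delta_J ns" using D by (simp add: block_rook_placement_def)
  obtain c \<B> where \<B>: "block_rooks_of ns D \<B>"
    and lam: "\<And>x. x \<in> algebra_J ns \<Longrightarrow> lam x = (\<Sum>(i, j)\<in>D. c $$ (i, j) * x $$ (i, j))"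
    using lam unfolding associated_functional_def by blast
  \<comment> \<open>The coefficient matrix is transposed, as the trace form requires, so an upper
    position of D becomes a lower position of L. Inside the matrix constructor the first index j is
    the column index of D.\<close>
  define L where "L = mat ?n ?n (\<lambda>(j,i). if (i,j) \<in> D then c $$ (i,j) else 0)"
  have L_D: "(j,i) \<in> D" if "i < ?n" "j < ?n" "L $$ (i,j) \<noteq> 0" for i j
    using that by (auto simp: L_def split: if_splits)
  have same_index: "?b i = ?b i'" if "A \<subseteq> segment ns k" "i \<in> A" "i' \<in> A" for A k i i'
    using that block_index_eq by (metis subsetD)
  have "block_functional ?n ?b L"
  proof
    show "i \<le> j \<Longrightarrow> j < ?n \<Longrightarrow> ?b i \<le> ?b j" for i j by (rule block_index_mono)
    show "L \<in> carrier_mat ?n ?n" by (simp add: L_def)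
    fix i j assume i: "i < ?n" and j: "j < ?n"
    show "?b j < ?b i" if "L $$ (i,j) \<noteq> 0"
      using L_D[OF i j that] DJ by (auto simp: Delta_J_iff)
    show "?b j = ?b j'" if j': "j' < ?n" and ne: "L $$ (i,j) \<noteq> 0" "L $$ (i,j') \<noteq> 0" for j'
    proof -
      obtain X Y where X: "X \<in> \<B>" "j \<in> fst X" "i \<in> snd X" and Y: "Y \<in> \<B>" "j' \<in> fst Y" "i \<in> snd Y"
        using L_D[OF i j ne(1)] L_D[OF i j' ne(2)] \<B> unfolding block_rooks_of_def by auto
      have "X = Y" using \<B> X Y unfolding block_rooks_of_def disjoint_family_on_def by blast
      moreover obtain k where "fst X \<subseteq> segment ns k"
        using \<B> X unfolding block_rooks_of_def block_rook_def by fastforce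
      ultimately show ?thesis using same_index X Y by blast
    qed
    show "?b i = ?b i'" if i': "i' < ?n" and ne: "L $$ (i,j) \<noteq> 0" "L $$ (i',j) \<noteq> 0" for i'
    proof -
      obtain X Y where X: "X \<in> \<B>" "j \<in> fst X" "i \<in> snd X" and Y: "Y \<in> \<B>" "j \<in> fst Y" "i' \<in> snd Y"
        using L_D[OF i j ne(1)] L_D[OF i' j ne(2)] \<B> unfolding block_rooks_of_def by auto
      have "X = Y" using \<B> X Y unfolding block_rooks_of_def disjoint_family_on_def by blast
      moreover obtain k where "snd X \<subseteq> segment ns k"
        using \<B> X unfolding block_rooks_of_def block_rook_def by fastforce
      ultimately show ?thesis using same_index X Y by blast
    qed
  qed
  moreover have "lam x = trace (L * x)" if x: "x \<in> algebra_J ns" for x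
  proof -
    have xM: "x \<in> carrier_mat ?n ?n" using x by (simp add: algebra_J_def)
    have LM: "L \<in> carrier_mat ?n ?n" by (simp add: L_def)
    have D_sub: "D \<subseteq> {..<?n} \<times> {..<?n}" using DJ by (auto simp: Delta_J_iff)
    have "trace (L * x) = (\<Sum>i<?n. \<Sum>j<?n. L $$ (j,i) * x $$ (i,j))"
      unfolding trace_mult[OF LM xM] by (rule sum.swap)
    also have "\<dots> = (\<Sum>(i,j)\<in>{..<?n} \<times> {..<?n}. if (i,j) \<in> D then c $$ (i,j) * x $$ (i,j) else 0)"
      unfolding sum.cartesian_product by (intro sum.cong) (auto simp: L_def)
    also have "\<dots> = (\<Sum>(i,j)\<in>D. c $$ (i,j) * x $$ (i,j))"
      using D_sub by (intro sum.mono_neutral_cong_right) auto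
    finally show ?thesis using lam[OF x] by simp
  qed
  ultimately show thesis by (rule that)
qed

theorem proposition5p3:
  fixes ns :: "nat list"
    and D :: "(nat \<times> nat) set"
    and lam :: "'a::{field, finite} mat \<Rightarrow> 'a"
    and \<epsilon> :: "'a \<Rightarrow> complex"
    and \<theta> \<theta>' :: "'a mat \<Rightarrow> complex"
  assumes "ns \<noteq> []" and "\<forall>m\<in>set ns. 0 < m"
    and "block_rook_placement ns D"
    and "associated_functional ns D lam"
    and "nontrivial_additive_character \<epsilon>"
    and "group_character (subgroup_of_GL ns (R_circ ns lam)) \<theta>"
    and "group_character (subgroup_of_GL ns (R_circ ns lam)) \<theta>'"
    and "S_invariant ns lam \<theta>" and "S_invariant ns lam \<theta>'"
    and "disjoint_characters (subgroup_of_GL ns (R_circ ns lam)) \<theta> \<theta>'"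
  shows "disjoint_characters (subgroup_of_GL ns (group_P ns))
           (chi ns lam \<epsilon> \<theta>) (chi ns lam \<epsilon> \<theta>')"
proof -
  obtain L :: "'a mat" where "block_functional (sum_list ns) (block_index ns) L"
    and lam: "\<And>x. x \<in> algebra_J ns \<Longrightarrow> lam x = trace (L * x)"
    using associated_functional_matrix[OF assms(3,4)] by blast
  then interpret block_functional "sum_list ns" "block_index ns" "TYPE('a)" L by simp
  have J_eq: "algebra_J ns = J" by (rule algebra_J_eq)
  have R_eq: "group_R ns = carrier GLn \<inter> B" by (rule group_R_eq)
  have P_eq: "group_P ns = carrier GLn \<inter> P" by (rule group_P_eq)
  have Jr_eq: "J_right ns lam = Jr"
    using lam J_eq by (auto simp: J_right_def Jr_iff JP_mult J_P)
  have RC_eq: "R_circ ns lam = RC"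
  proof (intro subset_antisym subsetI)
    fix r assume "r \<in> R_circ ns lam"
    then have r: "r \<in> carrier GLn" "r \<in> B" "\<forall>x\<in>J. lam (r * x) = lam x" "\<forall>x\<in>J. lam (x * r) = lam x"
      by (auto simp: R_circ_def R_right_def R_left_def R_eq J_eq)
    then show "r \<in> RC"
      using lam J_eq L_mult_eq_iff[OF r(2)] mult_L_eq_iff[OF r(2)]
      by (simp add: RC_def Rc_def PJ_mult JP_mult B_P)
  next
    fix r assume "r \<in> RC"
    then have r: "r \<in> carrier GLn" "r \<in> B" "L * r = L" "r * L = L" by (auto simp: RC_def Rc_def)
    then show "r \<in> R_circ ns lam"
      using lam J_eq L_mult_eq_iff[OF r(2)] mult_L_eq_iff[OF r(2)]
      by (simp add: R_circ_def R_right_def R_left_def R_eq PJ_mult JP_mult B_P)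
  qed
  have H_eq': "P_sub ns lam = H"
    unfolding P_sub_def H_eq N_right_def Jr_eq RC_eq by blast
  \<comment> \<open>The definite description has one solution because the decomposition r + x is
    unique.\<close>
  have xi: "xi ns lam \<epsilon> \<phi> (r + x) = \<phi> r * \<epsilon> (trace (L * x))" if r: "r \<in> RC" and x: "x \<in> Jr" for \<phi> r x
    unfolding xi_def Jr_eq RC_eq
  proof (rule the_equality)
    show "\<exists>s\<in>RC. \<exists>y\<in>Jr. r + x = s + y \<and> \<phi> r * \<epsilon> (trace (L * x)) = \<phi> s * \<epsilon> (lam y)"
      using r x lam[of x] Jr_J[OF x] J_eq by (intro bexI[of _ r] bexI[of _ x]) auto
    fix w assume "\<exists>s\<in>RC. \<exists>y\<in>Jr. r + x = s + y \<and> w = \<phi> s * \<epsilon> (lam y)"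
    then obtain s y where sy: "s \<in> RC" "y \<in> Jr" "r + x = s + y" "w = \<phi> s * \<epsilon> (lam y)" by blast
    then show "w = \<phi> r * \<epsilon> (trace (L * x))"
      using decomposition_unique[OF r sy(1) x sy(2,3)] lam[of x] Jr_J[OF x] J_eq by simp
  qed
  have S_eq: "group_S ns lam = stabilizer"
    unfolding group_S_def stabilizer_def Jr_eq P_eq using lam J_eq Jr_J by auto
  \<comment> \<open>Invariance is stated for factorizations z = b t with b in N and t in R. Here t =
    \<delta> z and b = z \<delta> z^-1, which is 1 plus a strictly upper matrix because its diagonal
    part is 1.\<close>
  have inv: "\<theta>' (\<delta> z * r * \<delta> (inv\<^bsub>GLn\<^esub> z)) = \<theta>' r" if z: "z \<in> stabilizer" and r: "r \<in> RC" for z r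
  proof -
    have zG: "z \<in> carrier GLn" and zP: "z \<in> P" using z by (auto simp: stabilizer_def)
    define z' where "z' = inv\<^bsub>GLn\<^esub> z"
    have zz: "z' \<in> M" "z * z' = 1\<^sub>m (sum_list ns)" "z' * z = 1\<^sub>m (sum_list ns)"
      using inv_GL[OF zG] by (simp_all add: z'_def)
    have z'P: "z' \<in> P" by (rule P_inverse[OF zP zz(1,2)])
    have d: "\<delta> z * \<delta> z' = 1\<^sub>m (sum_list ns)" "\<delta> z' * \<delta> z = 1\<^sub>m (sum_list ns)"
      using zP z'P zz one_B by (simp_all add: diag_part_mult[symmetric] diag_part_of_B)
    have dM: "\<delta> z \<in> M" "\<delta> z' \<in> M" by (rule B_M[OF diag_part_B])+
    have dG: "\<delta> z \<in> carrier GLn" "\<delta> z' \<in> carrier GLn" using d dM by (auto simp: carrier_GL)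
    have dR: "\<delta> z \<in> group_R ns" using dG diag_part_B by (simp add: R_eq)
    have inv_d: "inv\<^bsub>GLn\<^esub> (\<delta> z) = \<delta> z'"
      by (rule group.inv_equality[OF group_GL]) (use d dG in \<open>auto simp: mult_GL one_GL\<close>)
    have N: "z * \<delta> z' \<in> group_N ns"
    proof -
      define x where "x = z * \<delta> z' - 1\<^sub>m (sum_list ns)"
      have "x \<in> P" unfolding x_def using zP one_B by (auto intro: P_minus P_mult B_P diag_part_B)
      moreover have "\<delta> x = 0\<^sub>m (sum_list ns) (sum_list ns)"
        unfolding x_def using P_M[OF zP] dM zP one_B d
        by (simp add: diag_part_minus mult_M diag_part_mult B_P[OF diag_part_B] diag_part_of_B diag_part_B)
      ultimately have "x \<in> algebra_J ns" by (simp add: J_eq J_iff_diag_part)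
      moreover have "z * \<delta> z' = 1\<^sub>m (sum_list ns) + x" unfolding x_def
        using P_M[OF zP] dM by (auto simp: mat_eq_iff simp del: index_mult_mat(1))
      ultimately show ?thesis unfolding group_N_def by blast
    qed
    have "z * \<delta> z' * \<delta> z = z" using P_M[OF zP] dM d by (simp add: M_simps)
    then have "z * \<delta> z' * \<delta> z \<in> group_S ns lam" using z by (simp add: S_eq)
    then have "\<theta>' (\<delta> z * r * inv\<^bsub>GLn\<^esub> (\<delta> z)) = \<theta>' r"
      using assms(9) N dR r unfolding S_invariant_def RC_eq by blast
    then show ?thesis by (simp add: inv_d z'_def)
  qed
  \<comment> \<open>The subgroups share the multiplication of the matrix group by construction.
    Their inverses are taken within their own carriers and are identified with matrix inverses on
    those carriers.\<close>
  let ?K = "subgroup_of_GL ns RC" and ?G = "subgroup_of_GL ns (carrier GLn \<inter> P)"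
  have K: "group ?K" "carrier ?K = RC" and invK: "\<And>r. r \<in> RC \<Longrightarrow> inv\<^bsub>?K\<^esub> r = inv\<^bsub>GLn\<^esub> r"
    unfolding subgroup_of_GL_def
    using subgroup.subgroup_is_group[OF subgroup_RC group_GL] group.m_inv_consistent[OF group_GL subgroup_RC]
    by auto
  have G: "group ?G" "carrier ?G = carrier GLn \<inter> P"
    and invG: "\<And>g. g \<in> carrier GLn \<inter> P \<Longrightarrow> inv\<^bsub>?G\<^esub> g = inv\<^bsub>GLn\<^esub> g"
    and multG: "\<And>g h. g \<otimes>\<^bsub>?G\<^esub> h = g * h"
    unfolding subgroup_of_GL_def
    using subgroup.subgroup_is_group[OF subgroup_P group_GL] group.m_inv_consistent[OF group_GL subgroup_P]
    by (auto simp: mult_GL)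
  have "character_pairing ?K \<theta> \<theta>' = 0"
    using pairing_eq_0_if_disjoint[OF K(1)] assms(6,7,10) by (simp add: RC_eq)
  then have pairing: "(\<Sum>r\<in>RC. \<theta> r * \<theta>' (inv\<^bsub>GLn\<^esub> r)) = 0"
    unfolding character_pairing_def K(2) using invK by simp
  have "character_pairing ?G (induced_character ?G H (xi ns lam \<epsilon> \<theta>))
      (induced_character ?G H (xi ns lam \<epsilon> \<theta>')) = 0"
  proof (rule pairing_induced_eq_0[OF G(1)])
    show "finite (carrier ?G)" unfolding G(2) using finite_GL by blast
    show "H \<subseteq> carrier ?G" unfolding G(2) by (rule H_GL_P)
    fix z assume "z \<in> carrier ?G"
    then have z: "z \<in> carrier GLn \<inter> P" by (simp only: G(2))
    have "(\<Sum>h\<in>H. xi ns lam \<epsilon> \<theta> h * (if z \<otimes>\<^bsub>?G\<^esub> inv\<^bsub>?G\<^esub> h \<otimes>\<^bsub>?G\<^esub> inv\<^bsub>?G\<^esub> z \<in> H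
        then xi ns lam \<epsilon> \<theta>' (z \<otimes>\<^bsub>?G\<^esub> inv\<^bsub>?G\<^esub> h \<otimes>\<^bsub>?G\<^esub> inv\<^bsub>?G\<^esub> z) else 0))
      = (\<Sum>h\<in>H. xi ns lam \<epsilon> \<theta> h * (if z * inv\<^bsub>GLn\<^esub> h * inv\<^bsub>GLn\<^esub> z \<in> H
        then xi ns lam \<epsilon> \<theta>' (z * inv\<^bsub>GLn\<^esub> h * inv\<^bsub>GLn\<^esub> z) else 0))"
    proof (rule sum.cong[OF refl])
      fix h assume "h \<in> H"
      then have "inv\<^bsub>?G\<^esub> h = inv\<^bsub>GLn\<^esub> h" using invG H_GL_P by blast
      then show "xi ns lam \<epsilon> \<theta> h * (if z \<otimes>\<^bsub>?G\<^esub> inv\<^bsub>?G\<^esub> h \<otimes>\<^bsub>?G\<^esub> inv\<^bsub>?G\<^esub> z \<in> H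
          then xi ns lam \<epsilon> \<theta>' (z \<otimes>\<^bsub>?G\<^esub> inv\<^bsub>?G\<^esub> h \<otimes>\<^bsub>?G\<^esub> inv\<^bsub>?G\<^esub> z) else 0)
        = xi ns lam \<epsilon> \<theta> h * (if z * inv\<^bsub>GLn\<^esub> h * inv\<^bsub>GLn\<^esub> z \<in> H
          then xi ns lam \<epsilon> \<theta>' (z * inv\<^bsub>GLn\<^esub> h * inv\<^bsub>GLn\<^esub> z) else 0)"
        by (simp only: multG invG[OF z])
    qed
    also have "\<dots> = 0"
      using inner_sum_eq_0[OF assms(5), of "xi ns lam \<epsilon> \<theta>" \<theta> "xi ns lam \<epsilon> \<theta>'" \<theta>'] xi z inv pairing by blast
    finally show "(\<Sum>h\<in>H. xi ns lam \<epsilon> \<theta> h * (if z \<otimes>\<^bsub>?G\<^esub> inv\<^bsub>?G\<^esub> h \<otimes>\<^bsub>?G\<^esub> inv\<^bsub>?G\<^esub> z \<in> H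
        then xi ns lam \<epsilon> \<theta>' (z \<otimes>\<^bsub>?G\<^esub> inv\<^bsub>?G\<^esub> h \<otimes>\<^bsub>?G\<^esub> inv\<^bsub>?G\<^esub> z) else 0)) = 0" .
  qed
  then show ?thesis
    unfolding chi_def H_eq' P_eq using disjoint_if_pairing_eq_0[OF G(1)] finite_GL G(2) by simp
qed

end
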